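(* For every $\ell\ge 2$ there exist $K,c>0$ such that the following holds for all sufficiently large $n$ and all $t\ge K$. Given a $3$-graph $H$ with $n$ vertices and $tn^2$ edges, there exists a collection $\mathcal{S}$ of copies of $C^3_{2\ell}$ in $H$ such that for all $1\le j\le 2\ell$, $$\Delta_j(\mathcal{S})\le\frac{c|\mathcal{S}|\log n}{tn^2}\left(\max\left\{\left(\frac{t}{\log n}\right)^{-\frac{\ell(4\ell-3)}{4\ell^2-5\ell+2}}n^{-\frac{(\ell-1)(4\ell-3)}{4\ell^2-5\ell+2}},\ \left(\frac{t}{\log n}\right)^{-1}n^{-\frac{2\ell-2}{2\ell-1}}\right\}\right)^{j-1}.$$ In particular, when $t\ge n^{\frac{1}{2(2\ell-1)}}\log n$, $$\Delta_j(\mathcal{S})\le\frac{c|\mathcal{S}|\log n}{tn^2}\left(\left(\frac{t}{\log n}\right)^{-1}n^{-\frac{2\ell-2}{2\ell-1}}\right)^{j-1}\quad\text{for all }1\le j\le 2\ell.$$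
   Context: A $3$-graph is a $3$-uniform hypergraph. The linear cycle $C^3_k$ ($k\ge 3$) has vertices $v_1,\dots,v_{2k}$ and edges $e_i=\{v_{2i-2},v_{2i-1},v_{2i}\}$, $1\le i\le k$, with $v_0=v_{2k}$. For a collection $\mathcal{S}$ of copies of $C^3_{2\ell}$ in $H$, $\Delta_j(\mathcal{S})$ is the maximum, over all sets $J$ of $j$ edges of $H$, of the number of members of $\mathcal{S}$ containing all edges of $J$. *)

theory Defs
  imports Complex_Main
begin

definition three_graph :: "'a set \<Rightarrow> 'a set set \<Rightarrow> bool" where
  "three_graph V E \<longleftrightarrow> finite V \<and> (\<forall>e\<in>E. e \<subseteq> V \<and> card e = 3)"

text \<open>The linear cycle with \<open>k\<close> edges lives on the vertices \<open>1, \<dots>, 2 * k\<close>, where the index \<open>0\<close>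
  is read as \<open>2 * k\<close>.\<close>

definition linear_cycle :: "nat \<Rightarrow> nat set set" where
  "linear_cycle k = (\<lambda>i. {if i = 1 then 2 * k else 2 * i - 2, 2 * i - 1, 2 * i}) ` {1..k}"

text \<open>Linear cycles have no isolated vertices, so a copy (a subgraph isomorphic to the linear
  cycle) is identified with its edge set.\<close>

definition linear_cycle_copies :: "nat \<Rightarrow> 'a set set \<Rightarrow> 'a set set set" where
  "linear_cycle_copies k E =
     {C. C \<subseteq> E \<and> (\<exists>v. inj_on v {1..2 * k} \<and> C = (\<lambda>e. v ` e) ` linear_cycle k)}"

definition max_codegree :: "'a set set \<Rightarrow> nat \<Rightarrow> 'a set set set \<Rightarrow> nat" where
  "max_codegree E j S = Max {card {C \<in> S. J \<subseteq> C} | J. J \<subseteq> E \<and> card J = j}"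

end

theory Submission
  imports Defs "HOL-Library.FuncSet" "HOL-Real_Asymp.Real_Asymp"
begin

(* Call J saturated in a family of cycles if its codegree has reached a prescribed cap. A family that
   is maximal subject to the caps is large as soon as some random cycle avoids the saturated sets with
   positive probability, so it suffices to construct random cycles for which fixing j edges has
   small probability.

   Let Core_d be the largest subgraph of H in which every covered pair has codegree at least d. A dyadic
   pigeonholing over d (this is where log n is lost) gives a core with about t n^2 / log n edges whose
   shadow has at least t n^2 / (d log n) pairs. If d is large, take a stationary random walk in the link
   of a vertex c: it closes up through c to a 2l-cycle of the shadow, which is expanded by random
   third vertices. If d is small, the shadow is dense and one expands the cycles of a balanced family
   of graph 2l-cycles. The two bounds agree when d = codeg_threshold, and this gives the first term
   of the maximum.

   The balanced family of graph cycles is found as follows. Fix an out-degree delta in every vertex and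
   let s be the least length such that from some x a positive proportion of the s-step walks end in
   vertices y reached by about b^(1-s) walks. By minimality no shorter piece of a typical walk is
   concentrated in this way. Join two such walks from x by a random zigzag between their last two
   levels, where all steps are reversible: every vertex of the resulting closed 2l-walk is spread at
   scale b, conditionally on any earlier edge. *)

section \<open>Saturated families\<close>

text \<open>A set of j < 2l edges of a 2l-cycle touches at least j + 1 vertices, so after one edge
  is fixed the others force at least j - 1 new vertices, and the ratio per edge is the price of one
  vertex. The full cycle touches only 2l vertices: 2l - 2 new ones against the exponent 2l - 1. This
  missing vertex yields \<open>ratio_dense\<close> in the shadow construction, as the root of order
  2l - 1 of \<open>card V / \<delta> ^ (2 * l - 1)\<close>, and the exponent (4l - 3)/(2l - 1) of
  1/d in the core construction. The other condition on graph cycles,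
  \<open>b ^ (l - 1) = card V / \<delta> ^ l\<close>, makes b^(1-l) the average number of l-step
  walks between two vertices. After expansion it contributes the ratio b/d, which grows like
  d^(1/(l-1)), whereas the core ratio falls with d; hence a threshold. The obstacle is order of
  exploration: a random cycle is easily controlled from its start onwards, but a prescribed edge may
  sit anywhere in it. Therefore both random cycles are built from reversible walks, so that a
  pattern can be read in the more convenient direction.\<close>

definition cdeg :: "'a set set \<Rightarrow> 'a set \<Rightarrow> nat" where
  "cdeg S J = card {C \<in> S. J \<subseteq> C}"

lemma card_filter_eq_sum:
  "finite A \<Longrightarrow> card {x \<in> A. P x} = (\<Sum>x\<in>A. if P x then 1 else 0)"
  using sum.inter_filter[of A "\<lambda>_. 1::nat" P] by simp

lemma sum_cdeg_le:
  assumes "finite X" "finite S" "\<And>C. C \<in> S \<Longrightarrow> finite C \<and> card C = m"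
  shows "(\<Sum>J\<in>X. cdeg S J) \<le> 2 ^ m * card S"
proof -
  have "(\<Sum>J\<in>X. cdeg S J) = (\<Sum>J\<in>X. \<Sum>C\<in>S. if J \<subseteq> C then 1 else 0)"
    unfolding cdeg_def using assms(2) by (simp add: card_filter_eq_sum)
  also have "\<dots> = (\<Sum>C\<in>S. \<Sum>J\<in>X. if J \<subseteq> C then 1 else 0)"
    by (rule sum.swap)
  also have "\<dots> \<le> (\<Sum>C\<in>S. 2 ^ m)"
  proof (rule sum_mono)
    fix C assume "C \<in> S"
    have "(\<Sum>J\<in>X. if J \<subseteq> C then 1 else (0::nat)) = card {J\<in>X. J \<subseteq> C}"
      using assms(1) by (simp add: card_filter_eq_sum)
    also have "\<dots> \<le> card (Pow C)"
      using assms(3)[OF \<open>C \<in> S\<close>] by (intro card_mono) auto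
    finally show "(\<Sum>J\<in>X. if J \<subseteq> C then 1 else (0::nat)) \<le> 2 ^ m"
      using assms(3)[OF \<open>C \<in> S\<close>] by (simp add: card_Pow)
  qed
  finally show ?thesis by (simp add: mult.commute)
qed

text \<open>Double counting of the pairs \<open>J \<subseteq> C\<close>: each member has
  \<open>2 ^ m\<close> subsets. Since \<open>1 \<le> D\<close>, a saturated set has codegree at
  least 1, so \<open>D < cdeg S J + 1 \<le> 2 * cdeg S J\<close>, whence the factor 2.\<close>

lemma card_saturated_le:
  fixes D :: real
  assumes "finite X" "finite S" "\<And>C. C \<in> S \<Longrightarrow> finite C \<and> card C = m"
    and "1 \<le> D" "\<And>J. J \<in> X \<Longrightarrow> D < real (cdeg S J) + 1"
  shows "real (card X) * D \<le> 2 * 2 ^ m * real (card S)"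
proof -
  have "D / 2 \<le> real (cdeg S J)" if "J \<in> X" for J
  proof -
    have "D < real (cdeg S J) + 1" using assms(5) that .
    moreover have "cdeg S J \<ge> 1" using calculation assms(4) by (cases "cdeg S J") auto
    ultimately show ?thesis by linarith
  qed
  then have "real (card X) * (D / 2) \<le> (\<Sum>J\<in>X. real (cdeg S J))"
    using sum_bounded_below[of X "D/2" "\<lambda>J. real (cdeg S J)"] by simp
  also have "\<dots> \<le> 2 ^ m * real (card S)"
  proof -
    have "real (\<Sum>J\<in>X. cdeg S J) \<le> real (2 ^ m * card S)"
      using sum_cdeg_le[OF assms(1-3)] of_nat_le_iff by blast
    then show ?thesis by simp
  qed
  finally show ?thesis by simp
qed

text \<open>The same count among the members through \<open>e\<close>; passing to them does not
  change the codegree of a set containing \<open>e\<close>. It bounds the saturated sets at one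
  edge, which is what a walk explored from that edge can meet.\<close>

lemma card_saturated_containing_le:
  fixes D :: real
  assumes "finite X" "finite S" "\<And>C. C \<in> S \<Longrightarrow> finite C \<and> card C = m"
    and "1 \<le> D" "\<And>J. J \<in> X \<Longrightarrow> D < real (cdeg S J) + 1" "\<And>J. J \<in> X \<Longrightarrow> e \<in> J"
  shows "real (card X) * D \<le> 2 * 2 ^ m * real (cdeg S {e})"
proof -
  define T where "T = {C \<in> S. e \<in> C}"
  have eq: "cdeg T J = cdeg S J" if "J \<in> X" for J
    unfolding cdeg_def T_def using assms(6)[OF that] by (intro arg_cong[where f=card]) auto
  have "real (card X) * D \<le> 2 * 2 ^ m * real (card T)"
    by (rule card_saturated_le) (use assms eq in \<open>auto simp: T_def\<close>)
  then show ?thesis by (simp add: T_def cdeg_def)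
qed

text \<open>A family of maximum size under the caps works: with fewer than \<open>N\<close> members,
  some \<open>C\<close> all of whose subsets have room for one more could be inserted. The cap
  \<open>D m = 1\<close> guarantees that this \<open>C\<close> is new.\<close>

lemma saturation:
  fixes D :: "nat \<Rightarrow> real" and N :: real and U :: "'a set set"
  assumes "finite U" and U: "\<And>C. C \<in> U \<Longrightarrow> finite C \<and> card C = m" and "1 \<le> m"
    and D: "\<And>j. 1 \<le> j \<Longrightarrow> j \<le> m \<Longrightarrow> 1 \<le> D j" "D m = 1"
    and step: "\<And>S. S \<subseteq> U \<Longrightarrow> (\<And>J. card J \<in> {1..m} \<Longrightarrow> real (cdeg S J) \<le> D (card J)) \<Longrightarrow>
      real (card S) < N \<Longrightarrow> \<exists>C\<in>U. \<forall>J\<subseteq>C. J \<noteq> {} \<longrightarrow> real (cdeg S J) + 1 \<le> D (card J)"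
  shows "\<exists>S\<subseteq>U. (\<forall>J. card J \<in> {1..m} \<longrightarrow> real (cdeg S J) \<le> D (card J)) \<and> N \<le> real (card S)"
proof -
  define A where "A = {S. S \<subseteq> U \<and> (\<forall>J. card J \<in> {1..m} \<longrightarrow> real (cdeg S J) \<le> D (card J))}"
  have finA: "finite A" using \<open>finite U\<close> unfolding A_def by auto
  have "{} \<in> A" unfolding A_def cdeg_def using D by (auto intro: order_trans[OF zero_le_one])
  then have "Max (card ` A) \<in> card ` A" using finA by (intro Max_in) auto
  then obtain S where S: "S \<in> A" and "card S = Max (card ` A)" by auto
  then have max: "card T \<le> card S" if "T \<in> A" for T using finA that by simp
  have "N \<le> real (card S)"
  proof (rule ccontr)
    assume "\<not> N \<le> real (card S)"
    then obtain C where C: "C \<in> U" and un: "\<And>J. J \<subseteq> C \<Longrightarrow> J \<noteq> {} \<Longrightarrow> real (cdeg S J) + 1 \<le> D (card J)"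
      using step[of S] S unfolding A_def by auto
    have finS: "finite S" using S \<open>finite U\<close> unfolding A_def by (auto intro: finite_subset)
    have "C \<noteq> {}" using U[OF C] \<open>1 \<le> m\<close> by auto
    then have "cdeg S C = 0" using un[of C] U[OF C] D by simp
    then have "C \<notin> S" unfolding cdeg_def using finS by auto
    have "insert C S \<in> A"
      unfolding A_def
    proof (safe)
      show "\<And>x. x \<in> S \<Longrightarrow> x \<in> U" using S unfolding A_def by auto
      show "C \<in> U" by fact
      fix J :: "'a set" assume J: "card J \<in> {1..m}"
      show "real (cdeg (insert C S) J) \<le> D (card J)"
      proof (cases "J \<subseteq> C")
        case True
        have "J \<noteq> {}" using J by auto
        have "{C' \<in> insert C S. J \<subseteq> C'} = insert C {C' \<in> S. J \<subseteq> C'}" using True by auto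
        then have "cdeg (insert C S) J = cdeg S J + 1"
          unfolding cdeg_def using finS \<open>C \<notin> S\<close> by simp
        then show ?thesis using un[OF True \<open>J \<noteq> {}\<close>] by simp
      next
        case False
        then have "{C' \<in> insert C S. J \<subseteq> C'} = {C' \<in> S. J \<subseteq> C'}" by auto
        then show ?thesis using S J unfolding A_def cdeg_def by auto
      qed
    qed
    from max[OF this] show False using finS \<open>C \<notin> S\<close> by simp
  qed
  then show ?thesis using S unfolding A_def by auto
qed

text \<open>The caps are chosen so that, for every \<open>j\<close>, the weighted number of
  saturated \<open>j\<close>-sets inside \<open>\<psi> \<omega>\<close> is at most
  \<open>1 / (4 * m)\<close>. Summed over \<open>j\<close> this is \<open>1 / 4\<close>, less than
  the total mass, so some outcome contains no saturated set.\<close>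

lemma weighted_saturation:
  fixes \<mu> :: "'w \<Rightarrow> real" and \<psi> :: "'w \<Rightarrow> 'a set"
  assumes "finite \<Omega>" and \<mu>: "\<And>\<omega>. \<omega> \<in> \<Omega> \<Longrightarrow> 0 \<le> \<mu> \<omega>" and tot: "1 / 2 \<le> sum \<mu> \<Omega>"
    and \<psi>: "\<And>\<omega>. \<omega> \<in> \<Omega> \<Longrightarrow> finite (\<psi> \<omega>) \<and> card (\<psi> \<omega>) = m" and "1 \<le> m"
    and "0 < \<alpha>" "0 < \<beta>" "\<beta> \<le> 1"
    and spread: "\<And>J. card J \<in> {1..m} \<Longrightarrow> (\<Sum>\<omega> | \<omega> \<in> \<Omega> \<and> J \<subseteq> \<psi> \<omega>. \<mu> \<omega>) \<le> \<alpha> * \<beta> ^ (card J - 1)"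
  shows "\<exists>S\<subseteq>\<psi> ` \<Omega>. S \<noteq> {} \<and> (\<forall>J. card J \<in> {1..m} \<longrightarrow>
    real (cdeg S J) \<le> 8 * real m * 2 ^ m * real (card S) * \<alpha> * \<beta> ^ (card J - 1))"
proof -
  \<comment> \<open>Solved from
    \<open>D j = 8 * m * 2 ^ m * N * \<alpha> * \<beta> ^ (j - 1)\<close>, the wanted bound for a
    family of size \<open>N\<close>. With \<open>D j\<close> a power of \<open>1 / \<beta>\<close>
    normalised by \<open>D m = 1\<close>, the same \<open>N\<close> serves every
    \<open>j\<close>.\<close>
  define N where "N = 1 / (8 * real m * 2 ^ m * \<alpha> * \<beta> ^ (m - 1))"
  define D where "D j = (1 / \<beta>) ^ (m - j)" for j
  have Npos: "0 < N" unfolding N_def using assms by simp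
  have D1: "1 \<le> D j" for j unfolding D_def using assms by (intro one_le_power) auto
  have Dab: "\<beta> ^ (j - 1) = D j * \<beta> ^ (m - 1)" if "j \<in> {1..m}" for j
  proof -
    have "m - 1 = (m - j) + (j - 1)" using that by auto
    then have "\<beta> ^ (m - 1) = \<beta> ^ (m - j) * \<beta> ^ (j - 1)" by (metis power_add)
    then show ?thesis unfolding D_def using \<open>0 < \<beta>\<close> by (simp add: power_divide)
  qed
  have "\<exists>S\<subseteq>\<psi> ` \<Omega>. (\<forall>J. card J \<in> {1..m} \<longrightarrow> real (cdeg S J) \<le> D (card J)) \<and> N \<le> real (card S)"
  proof (rule saturation)
    show "finite (\<psi> ` \<Omega>)" using assms by auto
    show "\<And>C. C \<in> \<psi> ` \<Omega> \<Longrightarrow> finite C \<and> card C = m" using \<psi> by auto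
    show "1 \<le> m" by fact
    show "\<And>j. 1 \<le> D j" by (rule D1)
    show "D m = 1" unfolding D_def by simp
    fix S assume S: "S \<subseteq> \<psi> ` \<Omega>" and small: "real (card S) < N"
    have finS: "finite S" using S assms(1) by (auto intro: finite_subset)
    \<comment> \<open>Only sets inside some \<open>\<psi> \<omega>\<close> are listed, which keeps
      \<open>X j\<close> finite.\<close>
    define X where "X j = {J. (\<exists>\<omega>\<in>\<Omega>. J \<subseteq> \<psi> \<omega>) \<and> card J = j \<and> D j < real (cdeg S J) + 1}" for j
    have finX: "finite (X j)" for j
    proof (rule finite_subset)
      show "X j \<subseteq> (\<Union>\<omega>\<in>\<Omega>. Pow (\<psi> \<omega>))" unfolding X_def by auto
      show "finite (\<Union>\<omega>\<in>\<Omega>. Pow (\<psi> \<omega>))" using assms(1) \<psi> by auto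
    qed
    have bad: "(\<Sum>J\<in>X j. \<Sum>\<omega> | \<omega> \<in> \<Omega> \<and> J \<subseteq> \<psi> \<omega>. \<mu> \<omega>) \<le> 1 / (4 * real m)" if j: "j \<in> {1..m}" for j
    proof -
      have c: "real (card (X j)) * D j \<le> 2 * 2 ^ m * real (card S)"
        by (rule card_saturated_le[OF finX finS]) (use S \<psi> D1 in \<open>auto simp: X_def\<close>)
      have "(\<Sum>J\<in>X j. \<Sum>\<omega> | \<omega> \<in> \<Omega> \<and> J \<subseteq> \<psi> \<omega>. \<mu> \<omega>) \<le> (\<Sum>J\<in>X j. \<alpha> * \<beta> ^ (j - 1))"
        by (rule sum_mono) (use spread j in \<open>auto simp: X_def\<close>)
      also have "\<dots> = real (card (X j)) * D j * (\<alpha> * \<beta> ^ (m - 1))"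
        using Dab[OF j] by simp
      also have "\<dots> \<le> 2 * 2 ^ m * N * (\<alpha> * \<beta> ^ (m - 1))"
      proof (rule mult_right_mono)
        have "2 * 2 ^ m * real (card S) \<le> 2 * 2 ^ m * N"
          using small by (intro mult_left_mono) auto
        then show "real (card (X j)) * D j \<le> 2 * 2 ^ m * N" using c by linarith
        show "0 \<le> \<alpha> * \<beta> ^ (m - 1)" using assms by simp
      qed
      also have "\<dots> = 1 / (4 * real m)"
        unfolding N_def using assms by (simp add: field_simps)
      finally show ?thesis .
    qed
    have "(\<Sum>j\<in>{1..m}. \<Sum>J\<in>X j. \<Sum>\<omega> | \<omega> \<in> \<Omega> \<and> J \<subseteq> \<psi> \<omega>. \<mu> \<omega>) \<le> (\<Sum>j\<in>{1..m}. 1 / (4 * real m))"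
      by (rule sum_mono) (rule bad)
    also have "\<dots> \<le> 1 / 4" using \<open>1 \<le> m\<close> by simp
    finally have small': "(\<Sum>j\<in>{1..m}. \<Sum>J\<in>X j. \<Sum>\<omega> | \<omega> \<in> \<Omega> \<and> J \<subseteq> \<psi> \<omega>. \<mu> \<omega>) \<le> 1 / 4" .
    show "\<exists>C\<in>\<psi> ` \<Omega>. \<forall>J\<subseteq>C. J \<noteq> {} \<longrightarrow> real (cdeg S J) + 1 \<le> D (card J)"
    proof (rule ccontr)
      assume contra: "\<not> ?thesis"
      have ex: "\<exists>j\<in>{1..m}. \<exists>J\<in>X j. J \<subseteq> \<psi> \<omega>" if "\<omega> \<in> \<Omega>" for \<omega>
      proof -
        obtain J where J: "J \<subseteq> \<psi> \<omega>" "J \<noteq> {}" "\<not> real (cdeg S J) + 1 \<le> D (card J)"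
          using contra \<open>\<omega> \<in> \<Omega>\<close> by auto
        have "finite J" using J \<psi>[OF that] finite_subset by blast
        moreover have "card J \<le> m" using J \<psi>[OF that] card_mono by metis
        ultimately have "card J \<in> {1..m}" using J by (simp add: Suc_leI card_gt_0_iff)
        moreover have "J \<in> X (card J)" using J that unfolding X_def by auto
        ultimately show ?thesis using J by blast
      qed
      have "sum \<mu> \<Omega> \<le> (\<Sum>\<omega>\<in>\<Omega>. \<Sum>j\<in>{1..m}. \<Sum>J\<in>X j. if J \<subseteq> \<psi> \<omega> then \<mu> \<omega> else 0)"
      proof (rule sum_mono)
        fix \<omega> assume w: "\<omega> \<in> \<Omega>"
        then obtain j J where jJ: "j \<in> {1..m}" "J \<in> X j" "J \<subseteq> \<psi> \<omega>" using ex by blast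
        have "\<mu> \<omega> = (if J \<subseteq> \<psi> \<omega> then \<mu> \<omega> else 0)" using jJ by simp
        also have "\<dots> \<le> (\<Sum>J\<in>X j. if J \<subseteq> \<psi> \<omega> then \<mu> \<omega> else 0)"
          by (rule member_le_sum) (use jJ finX \<mu> w in auto)
        also have "\<dots> \<le> (\<Sum>j\<in>{1..m}. \<Sum>J\<in>X j. if J \<subseteq> \<psi> \<omega> then \<mu> \<omega> else 0)"
          by (rule member_le_sum[of j]) (use jJ \<mu> w in \<open>auto intro!: sum_nonneg\<close>)
        finally show "\<mu> \<omega> \<le> (\<Sum>j\<in>{1..m}. \<Sum>J\<in>X j. if J \<subseteq> \<psi> \<omega> then \<mu> \<omega> else 0)" .
      qed
      also have "\<dots> = (\<Sum>j\<in>{1..m}. \<Sum>\<omega>\<in>\<Omega>. \<Sum>J\<in>X j. if J \<subseteq> \<psi> \<omega> then \<mu> \<omega> else 0)"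
        by (rule sum.swap)
      also have "\<dots> = (\<Sum>j\<in>{1..m}. \<Sum>J\<in>X j. \<Sum>\<omega>\<in>\<Omega>. if J \<subseteq> \<psi> \<omega> then \<mu> \<omega> else 0)"
        by (rule sum.cong[OF refl]) (rule sum.swap)
      also have "\<dots> = (\<Sum>j\<in>{1..m}. \<Sum>J\<in>X j. \<Sum>\<omega> | \<omega> \<in> \<Omega> \<and> J \<subseteq> \<psi> \<omega>. \<mu> \<omega>)"
        using assms(1) by (simp add: sum.inter_filter)
      also have "\<dots> \<le> 1 / 4" by (rule small')
      finally show False using tot by simp
    qed
  qed
  then obtain S where S: "S \<subseteq> \<psi> ` \<Omega>" "\<And>J. card J \<in> {1..m} \<Longrightarrow> real (cdeg S J) \<le> D (card J)"
    "N \<le> real (card S)" by auto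
  have "S \<noteq> {}" using S Npos by auto
  moreover have "real (cdeg S J) \<le> 8 * real m * 2 ^ m * real (card S) * \<alpha> * \<beta> ^ (card J - 1)"
    if J: "card J \<in> {1..m}" for J
  proof -
    have "real (cdeg S J) \<le> D (card J)" using S J by auto
    also have "\<dots> = N * (8 * real m * 2 ^ m * \<alpha> * \<beta> ^ (card J - 1))"
      unfolding Dab[OF J] N_def using assms by (simp add: field_simps)
    also have "\<dots> \<le> real (card S) * (8 * real m * 2 ^ m * \<alpha> * \<beta> ^ (card J - 1))"
      using S assms by (intro mult_right_mono) auto
    finally show ?thesis by (simp add: mult_ac)
  qed
  ultimately show ?thesis using S by blast
qed

section \<open>Sums over lists and walks\<close>

definition nlists :: "'a set \<Rightarrow> nat \<Rightarrow> 'a list set" where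
  "nlists V n = {L. set L \<subseteq> V \<and> length L = n}"

lemma finite_nlists: "finite V \<Longrightarrow> finite (nlists V n)"
  unfolding nlists_def by (rule finite_lists_length_eq)

lemma nlists_0: "nlists V 0 = {[]}"
  unfolding nlists_def by auto

lemma sum_nlists_append:
  "(\<Sum>L\<in>nlists V (a + b). f L) = (\<Sum>L\<in>nlists V a. \<Sum>R\<in>nlists V b. f (L @ R))"
  unfolding sum.cartesian_product
  by (rule sum.reindex_bij_witness[where i="\<lambda>(L, R). L @ R" and j="\<lambda>L. (take a L, drop a L)"])
    (auto simp: nlists_def dest: in_set_takeD in_set_dropD)

lemma sum_nlists_1: "(\<Sum>L\<in>nlists V (Suc 0). f L) = (\<Sum>v\<in>V. f [v])"
  by (rule sum.reindex_bij_witness[where i="\<lambda>v. [v]" and j=hd])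
    (auto simp: nlists_def length_Suc_conv)

lemma sum_nlists_snoc:
  "(\<Sum>L\<in>nlists V (Suc a). f L) = (\<Sum>L\<in>nlists V a. \<Sum>v\<in>V. f (L @ [v]))"
  using sum_nlists_append[of f V a "Suc 0"] by (simp add: sum_nlists_1)

text \<open>The weight behaves like a random list built entry by entry: by \<open>sub\<close> the
  mass does not grow when an entry is added, by \<open>cost\<close> prescribing the entry at
  position \<open>k\<close> loses a factor \<open>c k\<close>. The induction peels off the last
  entry, using \<open>cost\<close> if its position is prescribed and \<open>sub\<close>
  otherwise.\<close>

lemma chain_sum:
  fixes w :: "'a list \<Rightarrow> real" and c :: "nat \<Rightarrow> real"
  assumes "finite V" and P: "P \<in> nlists V i"
    and w0: "\<And>L. 0 \<le> w L" and c0: "\<And>k. 0 \<le> c k"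
    and sub: "\<And>L. i \<le> length L \<Longrightarrow> length L < i + r \<Longrightarrow> set L \<subseteq> V \<Longrightarrow> (\<Sum>v\<in>V. w (L @ [v])) \<le> w L"
    and cost: "\<And>L v. i \<le> length L \<Longrightarrow> length L < i + r \<Longrightarrow> set L \<subseteq> V \<Longrightarrow> v \<in> V \<Longrightarrow> w (L @ [v]) \<le> c (length L) * w L"
    and "Z \<subseteq> {i..<i + r}"
  shows "(\<Sum>R\<in>nlists V r. if \<forall>k\<in>Z. (P @ R) ! k = a k then w (P @ R) else 0) \<le> w P * (\<Prod>k\<in>Z. c k)"
  using sub cost \<open>Z \<subseteq> {i..<i + r}\<close>
proof (induction r arbitrary: Z)
  case 0
  then show ?case by (simp add: nlists_0)
next
  case (Suc r)
  have lenP: "length P = i" "set P \<subseteq> V" using P by (auto simp: nlists_def)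
  define Z' where "Z' = Z - {i + r}"
  have Z': "Z' \<subseteq> {i..<i + r}" using Suc.prems(3) unfolding Z'_def by (auto simp: less_Suc_eq)
  have finZ: "finite Z'" using Z' finite_subset by blast
  define C where "C = (if i + r \<in> Z then c (i + r) else 1)"
  have C0: "0 \<le> C" unfolding C_def using c0 by auto
  have prodC: "(\<Prod>k\<in>Z. c k) = C * (\<Prod>k\<in>Z'. c k)"
  proof (cases "i + r \<in> Z")
    case True
    then have "Z = insert (i + r) Z'" "i + r \<notin> Z'" unfolding Z'_def by auto
    then show ?thesis using finZ True unfolding C_def by simp
  qed (simp add: C_def Z'_def)
  have IH: "(\<Sum>R\<in>nlists V r. if \<forall>k\<in>Z'. (P @ R) ! k = a k then w (P @ R) else 0) \<le> w P * (\<Prod>k\<in>Z'. c k)"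
    by (rule Suc.IH) (use Suc.prems Z' in auto)
  have inner: "(\<Sum>v\<in>V. if \<forall>k\<in>Z. (P @ R @ [v]) ! k = a k then w (P @ R @ [v]) else 0)
      \<le> C * (if \<forall>k\<in>Z'. (P @ R) ! k = a k then w (P @ R) else 0)" if R: "R \<in> nlists V r" for R
  proof -
    have lenR: "length (P @ R) = i + r" "set (P @ R) \<subseteq> V" using R lenP by (auto simp: nlists_def)
    have split: "(\<forall>k\<in>Z. (P @ R @ [v]) ! k = a k) \<longleftrightarrow>
        (\<forall>k\<in>Z'. (P @ R) ! k = a k) \<and> (i + r \<in> Z \<longrightarrow> v = a (i + r))" for v
    proof -
      have 1: "((P @ R) @ [v]) ! k = (P @ R) ! k" if "k \<in> Z'" for k
        using that Z' lenR by (subst nth_append) auto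
      have 2: "((P @ R) @ [v]) ! (i + r) = v" using lenR by (metis nth_append_length)
      show ?thesis
      proof
        assume "\<forall>k\<in>Z. (P @ R @ [v]) ! k = a k"
        then show "(\<forall>k\<in>Z'. (P @ R) ! k = a k) \<and> (i + r \<in> Z \<longrightarrow> v = a (i + r))"
          using 1 2 by (auto simp: Z'_def)
      next
        assume "(\<forall>k\<in>Z'. (P @ R) ! k = a k) \<and> (i + r \<in> Z \<longrightarrow> v = a (i + r))"
        then show "\<forall>k\<in>Z. (P @ R @ [v]) ! k = a k"
          using 1 2 by (metis DiffI Z'_def append.assoc singletonD)
      qed
    qed
    show ?thesis
    proof (cases "\<forall>k\<in>Z'. (P @ R) ! k = a k")
      case False
      then have "(\<Sum>v\<in>V. if \<forall>k\<in>Z. (P @ R @ [v]) ! k = a k then w (P @ R @ [v]) else 0) = 0"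
        unfolding split by (intro sum.neutral) auto
      then show ?thesis using False by (simp only: if_False)
    next
      case True
      show ?thesis
      proof (cases "i + r \<in> Z")
        case False
        have "(\<Sum>v\<in>V. w ((P @ R) @ [v])) \<le> w (P @ R)"
          by (rule Suc.prems(1)) (use lenR in auto)
        then show ?thesis using True False split by (simp add: C_def)
      next
        case iZ: True
        have "(\<Sum>v\<in>V. if \<forall>k\<in>Z. (P @ R @ [v]) ! k = a k then w (P @ R @ [v]) else 0)
          = (\<Sum>v\<in>V. if v = a (i + r) then w (P @ R @ [v]) else 0)"
          using True iZ split by simp
        also have "\<dots> \<le> C * w (P @ R)"
        proof (cases "a (i + r) \<in> V")
          case True
          have "w ((P @ R) @ [a (i + r)]) \<le> c (length (P @ R)) * w (P @ R)"
            by (rule Suc.prems(2)) (use lenR True in auto)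
          then show ?thesis using True lenR iZ assms(1) by (simp add: C_def)
        next
          case False
          then have "(\<Sum>v\<in>V. if v = a (i + r) then w (P @ R @ [v]) else 0) = 0"
            by (intro sum.neutral) auto
          then show ?thesis using C0 w0 by simp
        qed
        finally show ?thesis using True by simp
      qed
    qed
  qed
  have "(\<Sum>R\<in>nlists V (Suc r). if \<forall>k\<in>Z. (P @ R) ! k = a k then w (P @ R) else 0)
    = (\<Sum>R\<in>nlists V r. \<Sum>v\<in>V. if \<forall>k\<in>Z. (P @ R @ [v]) ! k = a k then w (P @ R @ [v]) else 0)"
    by (simp add: sum_nlists_snoc)
  also have "\<dots> \<le> (\<Sum>R\<in>nlists V r. C * (if \<forall>k\<in>Z'. (P @ R) ! k = a k then w (P @ R) else 0))"
    by (rule sum_mono) (rule inner)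
  also have "\<dots> = C * (\<Sum>R\<in>nlists V r. if \<forall>k\<in>Z'. (P @ R) ! k = a k then w (P @ R) else 0)"
    by (rule sum_distrib_left[symmetric])
  also have "\<dots> \<le> C * (w P * (\<Prod>k\<in>Z'. c k))"
    by (rule mult_left_mono[OF IH C0])
  finally show ?case by (simp add: prodC mult_ac)
qed

text \<open>Maximising \<open>|Y|\<close> minus the total demand of the fibres met by \<open>Y\<close> leaves no deficient fibre.\<close>

lemma peel_fibres:
  fixes \<phi> :: "'b \<Rightarrow> real" and \<gamma> :: "'c \<Rightarrow> real"
  assumes "finite X" "\<And>v. 0 \<le> \<phi> v" "\<And>v. 0 \<le> \<gamma> v"
  shows "\<exists>Y\<subseteq>X. (\<forall>x\<in>Y. \<phi> (f x) \<le> card {y\<in>Y. f y = f x} \<and> \<gamma> (g x) \<le> card {y\<in>Y. g y = g x}) \<and>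
    real (card X) - sum \<phi> (f ` X) - sum \<gamma> (g ` X) \<le> real (card Y)"
proof -
  define \<Phi> where "\<Phi> Y = real (card Y) - sum \<phi> (f ` Y) - sum \<gamma> (g ` Y)" for Y
  have "Max (\<Phi> ` Pow X) \<in> \<Phi> ` Pow X" using assms(1) by (intro Max_in) auto
  then obtain Y where Y: "Y \<subseteq> X" and eq: "\<Phi> Y = Max (\<Phi> ` Pow X)" by auto
  have max: "\<Phi> T \<le> \<Phi> Y" if "T \<subseteq> X" for T unfolding eq using assms(1) that by simp
  have finY: "finite Y" using Y assms(1) finite_subset by blast
  have F: "\<phi> (f x) \<le> card {y\<in>Y. f y = f x}" if x: "x \<in> Y" for x
  proof -
    define W where "W = {y\<in>Y. f y = f x}"
    have W: "W \<subseteq> Y" "finite W" unfolding W_def using finY by auto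
    have im: "f ` Y = insert (f x) (f ` (Y - W))" "f x \<notin> f ` (Y - W)" using x unfolding W_def by auto
    have c: "real (card (Y - W)) = real (card Y) - real (card W)"
      using W finY by (simp add: card_Diff_subset card_mono of_nat_diff)
    have "sum \<phi> (f ` Y) = \<phi> (f x) + sum \<phi> (f ` (Y - W))" unfolding im(1) using finY im(2) by simp
    moreover have "sum \<gamma> (g ` (Y - W)) \<le> sum \<gamma> (g ` Y)"
      using finY assms by (intro sum_mono2) auto
    moreover have "\<Phi> (Y - W) \<le> \<Phi> Y" using max[of "Y - W"] Y by auto
    ultimately show ?thesis unfolding \<Phi>_def c W_def[symmetric] by linarith
  qed
  have G: "\<gamma> (g x) \<le> card {y\<in>Y. g y = g x}" if x: "x \<in> Y" for x
  proof -
    define W where "W = {y\<in>Y. g y = g x}"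
    have W: "W \<subseteq> Y" "finite W" unfolding W_def using finY by auto
    have im: "g ` Y = insert (g x) (g ` (Y - W))" "g x \<notin> g ` (Y - W)" using x unfolding W_def by auto
    have c: "real (card (Y - W)) = real (card Y) - real (card W)"
      using W finY by (simp add: card_Diff_subset card_mono of_nat_diff)
    have "sum \<gamma> (g ` Y) = \<gamma> (g x) + sum \<gamma> (g ` (Y - W))" unfolding im(1) using finY im(2) by simp
    moreover have "sum \<phi> (f ` (Y - W)) \<le> sum \<phi> (f ` Y)"
      using finY assms by (intro sum_mono2) auto
    moreover have "\<Phi> (Y - W) \<le> \<Phi> Y" using max[of "Y - W"] Y by auto
    ultimately show ?thesis unfolding \<Phi>_def c W_def[symmetric] by linarith
  qed
  have "real (card X) - sum \<phi> (f ` X) - sum \<gamma> (g ` X) \<le> real (card Y)"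
  proof -
    have "\<Phi> X \<le> \<Phi> Y" using max[of X] by simp
    moreover have "0 \<le> sum \<phi> (f ` Y)" "0 \<le> sum \<gamma> (g ` Y)" using assms by (auto intro: sum_nonneg)
    ultimately show ?thesis unfolding \<Phi>_def by linarith
  qed
  then show ?thesis using F G Y by blast
qed

section \<open>Walks in a digraph of constant out-degree\<close>

locale out_regular =
  fixes V :: "'a set" and out :: "'a \<Rightarrow> 'a set" and \<delta> :: nat
  assumes finite_V: "finite V" and out_subset: "v \<in> V \<Longrightarrow> out v \<subseteq> V"
    and card_out: "v \<in> V \<Longrightarrow> card (out v) = \<delta>" and \<delta>_pos: "0 < \<delta>"
begin

definition walks :: "nat \<Rightarrow> 'a \<Rightarrow> 'a list set" where
  "walks s a = {L. length L = Suc s \<and> L ! 0 = a \<and> set L \<subseteq> V \<and> (\<forall>i<s. L ! Suc i \<in> out (L ! i))}"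

lemma walks_subset_nlists: "walks s a \<subseteq> nlists V (Suc s)"
  unfolding walks_def nlists_def by auto

lemma finite_walks: "finite (walks s a)"
  using finite_subset[OF walks_subset_nlists finite_nlists[OF finite_V]] .

lemma last_walk: "L \<in> walks s a \<Longrightarrow> last L = L ! s"
  unfolding walks_def by (cases "L = []") (auto simp: last_conv_nth)

lemma last_walk_in: "L \<in> walks s a \<Longrightarrow> last L \<in> V"
  unfolding walks_def by (metis (mono_tags, lifting) last_in_set length_0_conv mem_Collect_eq nat.distinct(1) subsetD)

lemma walk_append_nth:
  assumes "L1 \<in> walks r a" "L2 \<in> walks s (last L1)"
  shows "k \<le> r \<Longrightarrow> (L1 @ tl L2) ! k = L1 ! k" "k \<le> s \<Longrightarrow> (L1 @ tl L2) ! (r + k) = L2 ! k"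
    "last (L1 @ tl L2) = last L2"
proof -
  have len: "length L1 = Suc r" "length L2 = Suc s" "L2 ! 0 = last L1" using assms by (auto simp: walks_def)
  show *: "k \<le> r \<Longrightarrow> (L1 @ tl L2) ! k = L1 ! k" for k using len by (simp add: nth_append)
  show **: "k \<le> s \<Longrightarrow> (L1 @ tl L2) ! (r + k) = L2 ! k" for k
  proof (cases k)
    case 0
    then show ?thesis using * len last_walk[OF assms(1)] by simp
  next
    case (Suc k')
    assume "k \<le> s"
    then show ?thesis using len Suc by (simp add: nth_append nth_tl)
  qed
  have "length (L1 @ tl L2) = Suc (r + s)" using len by simp
  then have "last (L1 @ tl L2) = (L1 @ tl L2) ! (r + s)"
    by (metis One_nat_def diff_Suc_Suc diff_zero last_conv_nth length_0_conv nat.distinct(1))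
  also have "\<dots> = last L2" using **[of s] last_walk[OF assms(2)] by simp
  finally show "last (L1 @ tl L2) = last L2" .
qed

text \<open>A walk is cut at the vertex at position \<open>r\<close>, which belongs to both halves;
  hence \<open>tl L2\<close> in the gluing.\<close>

lemma sum_walks_add:
  "(\<Sum>L\<in>walks (r + s) a. f L) = (\<Sum>L1\<in>walks r a. \<Sum>L2\<in>walks s (last L1). f (L1 @ tl L2))"
proof -
  have fin: "finite (walks r a)" "\<forall>L1\<in>walks r a. finite (walks s (last L1))" by (auto intro: finite_walks)
  show ?thesis
    unfolding sum.Sigma[OF fin]
  proof (rule sum.reindex_bij_witness[where i="\<lambda>(L1, L2). L1 @ tl L2" and j="\<lambda>L. (take (Suc r) L, drop r L)"])
    fix L assume L: "L \<in> walks (r + s) a"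
    then have len: "length L = Suc (r + s)" by (simp add: walks_def)
    have "tl (drop r L) = drop (Suc r) L" by (simp add: drop_Suc drop_tl)
    then show "(case (take (Suc r) L, drop r L) of (L1, L2) \<Rightarrow> L1 @ tl L2) = L" by simp
    then show "(case (take (Suc r) L, drop r L) of (x, y) \<Rightarrow> f (x @ tl y)) = f L" by simp
    have "take (Suc r) L \<in> walks r a"
      using L by (auto simp: walks_def dest: in_set_takeD)
    moreover have "last (take (Suc r) L) = L ! r" using last_walk[OF calculation] by simp
    moreover have "drop r L \<in> walks s (L ! r)"
      using L by (auto simp: walks_def dest: in_set_dropD)
    ultimately show "(take (Suc r) L, drop r L) \<in> (SIGMA L1:walks r a. walks s (last L1))" by auto
  next
    fix p assume "p \<in> (SIGMA L1:walks r a. walks s (last L1))"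
    then obtain L1 L2 where p: "p = (L1, L2)" and L1: "L1 \<in> walks r a" and L2: "L2 \<in> walks s (last L1)" by auto
    have len: "length L1 = Suc r" "length L2 = Suc s" "L2 ! 0 = last L1" using L1 L2 by (auto simp: walks_def)
    note nth = walk_append_nth[OF L1 L2]
    have dr: "drop r (L1 @ tl L2) = L2"
      by (rule nth_equalityI) (use len nth(2) in \<open>auto simp del: drop_append\<close>)
    then show "(\<lambda>L. (take (Suc r) L, drop r L)) (case p of (L1, L2) \<Rightarrow> L1 @ tl L2) = p"
      using p len by simp
    have "(L1 @ tl L2) ! Suc i \<in> out ((L1 @ tl L2) ! i)" if "i < r + s" for i
    proof (cases "i < r")
      case True
      then show ?thesis using nth(1)[of i] nth(1)[of "Suc i"] L1 by (auto simp: walks_def)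
    next
      case False
      define k where "k = i - r"
      have "i = r + k" "k < s" using False that unfolding k_def by auto
      then show ?thesis using nth(2)[of k] nth(2)[of "Suc k"] L2 by (auto simp: walks_def)
    qed
    moreover have "set (L1 @ tl L2) \<subseteq> V" using L1 L2 by (cases L2) (auto simp: walks_def)
    moreover have "(L1 @ tl L2) ! 0 = a" using nth(1)[of 0] L1 by (simp add: walks_def)
    ultimately show "(case p of (L1, L2) \<Rightarrow> L1 @ tl L2) \<in> walks (r + s) a"
      using p len by (simp add: walks_def)
  qed
qed

lemma walks_0: "a \<in> V \<Longrightarrow> walks 0 a = {[a]}"
  unfolding walks_def by (auto simp: length_Suc_conv)

lemma card_walks_1: assumes "a \<in> V" shows "card (walks 1 a) = \<delta>"
proof -
  have "walks 1 a = (\<lambda>v. [a, v]) ` out a"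
    using assms out_subset[OF assms] unfolding walks_def by (auto simp: length_Suc_conv numeral_2_eq_2)
  then show ?thesis using card_out[OF assms] by (simp add: card_image inj_on_def)
qed

lemma card_walks: "a \<in> V \<Longrightarrow> card (walks s a) = \<delta> ^ s"
proof (induction s)
  case 0
  then show ?case by (simp add: walks_0)
next
  case (Suc s)
  have "card (walks (s + 1) a) = (\<Sum>L\<in>walks (s + 1) a. 1)" by simp
  also have "\<dots> = (\<Sum>L1\<in>walks s a. \<Sum>L2\<in>walks 1 (last L1). 1)" by (rule sum_walks_add)
  also have "\<dots> = (\<Sum>L1\<in>walks s a. \<delta>)"
    by (rule sum.cong) (use card_walks_1 last_walk_in in auto)
  finally show ?case using Suc by simp
qed

definition Nw :: "nat \<Rightarrow> 'a \<Rightarrow> 'a \<Rightarrow> nat" where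
  "Nw s a y = card {L \<in> walks s a. last L = y}"

lemma sum_Nw: "a \<in> V \<Longrightarrow> (\<Sum>y\<in>V. Nw s a y) = \<delta> ^ s"
proof -
  assume a: "a \<in> V"
  have "(\<Sum>y\<in>V. Nw s a y) = card (walks s a)"
    unfolding Nw_def card_eq_sum
    by (rule sum.group[OF finite_walks finite_V]) (use last_walk_in in auto)
  then show ?thesis using card_walks[OF a] by simp
qed

text \<open>All out-degrees agree, so a uniform walk is Markov with free beginning and end: wherever
  the first \<open>i\<close> steps lead, the next \<open>s\<close> steps satisfy \<open>Q\<close>
  with frequency at most \<open>\<epsilon>\<close>, and all of them have equally many
  continuations.\<close>

lemma card_walks_filter_le:
  fixes \<epsilon> :: real
  assumes "x \<in> V" "i + s \<le> t" "\<And>a. a \<in> V \<Longrightarrow> real (card {L \<in> walks s a. Q a (last L)}) \<le> \<epsilon> * \<delta> ^ s"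
  shows "real (card {L \<in> walks t x. Q (L ! i) (L ! (i + s))}) \<le> \<epsilon> * \<delta> ^ t"
proof -
  let ?I = "\<lambda>b. if b then 1 else (0::nat)"
  note cf = card_filter_eq_sum
  have "card {L \<in> walks t x. Q (L ! i) (L ! (i + s))} = (\<Sum>L\<in>walks (i + (s + (t - i - s))) x. ?I (Q (L ! i) (L ! (i + s))))"
    using assms(2) by (simp add: cf finite_walks)
  also have "\<dots> = (\<Sum>L1\<in>walks i x. \<Sum>L2\<in>walks (s + (t - i - s)) (last L1). ?I (Q ((L1 @ tl L2) ! i) ((L1 @ tl L2) ! (i + s))))"
    by (rule sum_walks_add)
  also have "\<dots> = (\<Sum>L1\<in>walks i x. \<Sum>L2\<in>walks (s + (t - i - s)) (last L1). ?I (Q (last L1) (L2 ! s)))"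
    by (intro sum.cong refl) (simp add: walk_append_nth(1,2) last_walk)
  also have "\<dots> = (\<Sum>L1\<in>walks i x. \<Sum>L2\<in>walks s (last L1). \<Sum>L3\<in>walks (t - i - s) (last L2). ?I (Q (last L1) ((L2 @ tl L3) ! s)))"
    by (simp add: sum_walks_add)
  also have "\<dots> = (\<Sum>L1\<in>walks i x. \<Sum>L2\<in>walks s (last L1). \<Sum>L3\<in>walks (t - i - s) (last L2). ?I (Q (last L1) (last L2)))"
    by (intro sum.cong refl) (simp add: walk_append_nth(1) last_walk)
  also have "\<dots> = (\<Sum>L1\<in>walks i x. \<Sum>L2\<in>walks s (last L1). \<delta> ^ (t - i - s) * ?I (Q (last L1) (last L2)))"
    by (intro sum.cong refl) (simp add: card_walks last_walk_in)
  also have "\<dots> = \<delta> ^ (t - i - s) * (\<Sum>L1\<in>walks i x. card {L2 \<in> walks s (last L1). Q (last L1) (last L2)})"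
    by (simp add: cf finite_walks sum_distrib_left)
  finally have "real (card {L \<in> walks t x. Q (L ! i) (L ! (i + s))}) =
      \<delta> ^ (t - i - s) * (\<Sum>L1\<in>walks i x. real (card {L2 \<in> walks s (last L1). Q (last L1) (last L2)}))" by simp
  also have "\<dots> \<le> \<delta> ^ (t - i - s) * (\<Sum>L1\<in>walks i x. \<epsilon> * \<delta> ^ s)"
    by (intro mult_left_mono sum_mono assms(3)) (auto simp: last_walk_in)
  also have "\<dots> = \<epsilon> * (\<delta> ^ (t - i - s) * \<delta> ^ i * \<delta> ^ s)"
    using card_walks[OF assms(1)] by simp
  also have "real (\<delta> ^ (t - i - s) * \<delta> ^ i * \<delta> ^ s) = \<delta> ^ t"
    using assms(2) by (simp flip: power_add)
  finally show ?thesis by simp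
qed

text \<open>Cutting at the prescribed positions bounds the count by a product of \<open>Nw\<close>
  over consecutive ones, each at most 1/b to the power gap - 1. The gaps add up to \<open>t\<close>,
  which leaves the exponent \<open>t - 1 - card Z\<close>. The pair \<open>(0, t)\<close> is exempt
  for nonempty \<open>Z\<close>: in the application the whole walk is concentrated and only its
  shorter pieces are not.\<close>

lemma card_walks_through_le:
  fixes b :: real
  assumes "0 < b" "Z \<subseteq> {1..<t}" "1 \<le> t"
    and "\<And>i j. i \<in> insert 0 Z \<Longrightarrow> j \<in> insert t Z \<Longrightarrow> i < j \<Longrightarrow> Z = {} \<or> (i, j) \<noteq> (0, t) \<Longrightarrow>
      real (Nw (j - i) (a i) (a j)) * b ^ (j - i - 1) \<le> 1"
  shows "real (card {L \<in> walks t (a 0). last L = a t \<and> (\<forall>k\<in>Z. L ! k = a k)}) * b ^ (t - 1 - card Z) \<le> 1"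
  using assms(2-)
proof (induction "card Z" arbitrary: Z t)
  case 0
  then have "Z = {}" by (metis card_0_eq finite_atLeastLessThan finite_subset)
  then show ?case using 0(4)[of 0 t] 0 by (simp add: Nw_def)
next
  case (Suc n)
  have finZ: "finite Z" using Suc.prems finite_subset by blast
  have ne: "Z \<noteq> {}" using Suc by auto
  \<comment> \<open>Cut at the last prescribed position; the part before it falls under the
    induction hypothesis.\<close>
  define k where "k = Max Z"
  have kZ: "k \<in> Z" unfolding k_def using finZ ne by simp
  have kmax: "j \<le> k" if "j \<in> Z" for j unfolding k_def using finZ that by simp
  have k: "1 \<le> k" "k < t" using kZ Suc.prems by auto
  have sub: "Z - {k} \<subseteq> {1..<k}" using Suc.prems(1) kmax by (force simp: le_neq_implies_less)
  have cZ: "card (Z - {k}) = n" using Suc.hyps(2) kZ finZ by simp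
  have nk: "n \<le> k - 1" using card_mono[OF _ sub] cZ by simp
  have IH: "real (card {L \<in> walks k (a 0). last L = a k \<and> (\<forall>k\<in>Z - {k}. L ! k = a k)}) * b ^ (k - 1 - card (Z - {k})) \<le> 1"
  proof (rule Suc.hyps(1))
    show "n = card (Z - {k})" using cZ by simp
    show "Z - {k} \<subseteq> {1..<k}" by (rule sub)
    show "1 \<le> k" by (rule k)
    fix i j assume "i \<in> insert 0 (Z - {k})" "j \<in> insert k (Z - {k})" "i < j"
    then show "real (Nw (j - i) (a i) (a j)) * b ^ (j - i - 1) \<le> 1"
      using kZ k kmax by (intro Suc.prems(3)) force+
  qed
  let ?I = "\<lambda>b. if b then 1 else (0::nat)"
  note cf = card_filter_eq_sum
  have "card {L \<in> walks t (a 0). last L = a t \<and> (\<forall>k\<in>Z. L ! k = a k)}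
    = (\<Sum>L\<in>walks (k + (t - k)) (a 0). ?I (last L = a t \<and> (\<forall>k\<in>Z. L ! k = a k)))"
    using k by (simp add: cf finite_walks)
  also have "\<dots> = (\<Sum>L1\<in>walks k (a 0). \<Sum>L2\<in>walks (t - k) (last L1).
      ?I (last (L1 @ tl L2) = a t \<and> (\<forall>k\<in>Z. (L1 @ tl L2) ! k = a k)))"
    by (rule sum_walks_add)
  also have "\<dots> = (\<Sum>L1\<in>walks k (a 0). \<Sum>L2\<in>walks (t - k) (last L1).
      ?I (last L2 = a t \<and> (\<forall>k\<in>Z. L1 ! k = a k)))"
    using kmax by (intro sum.cong refl) (simp add: walk_append_nth(1,3) cong: ball_cong)
  also have "\<dots> = (\<Sum>L1\<in>walks k (a 0). ?I (\<forall>k\<in>Z. L1 ! k = a k) * Nw (t - k) (a k) (a t))"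
  proof (rule sum.cong[OF refl])
    fix L1 assume L1: "L1 \<in> walks k (a 0)"
    show "(\<Sum>L2\<in>walks (t - k) (last L1). ?I (last L2 = a t \<and> (\<forall>k\<in>Z. L1 ! k = a k))) =
       ?I (\<forall>k\<in>Z. L1 ! k = a k) * Nw (t - k) (a k) (a t)"
    proof (cases "\<forall>k\<in>Z. L1 ! k = a k")
      case True
      then have "last L1 = a k" using last_walk[OF L1] kZ by auto
      then show ?thesis using True by (simp add: Nw_def cf finite_walks)
    next
      case False
      then show ?thesis by (subst sum.neutral) auto
    qed
  qed
  also have "\<dots> = card {L1 \<in> walks k (a 0). \<forall>k\<in>Z. L1 ! k = a k} * Nw (t - k) (a k) (a t)"
    by (simp add: cf finite_walks sum_distrib_right)
  also have "{L1 \<in> walks k (a 0). \<forall>k\<in>Z. L1 ! k = a k} = {L \<in> walks k (a 0). last L = a k \<and> (\<forall>k\<in>Z - {k}. L ! k = a k)}"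
    using kZ by (auto simp: last_walk)
  finally have eq: "card {L \<in> walks t (a 0). last L = a t \<and> (\<forall>k\<in>Z. L ! k = a k)} =
    card {L \<in> walks k (a 0). last L = a k \<and> (\<forall>k\<in>Z - {k}. L ! k = a k)} * Nw (t - k) (a k) (a t)" .
  have "t - 1 - card Z = (k - 1 - card (Z - {k})) + (t - k - 1)" using k nk cZ Suc.hyps(2) by simp
  then have p: "b ^ (t - 1 - card Z) = b ^ (k - 1 - card (Z - {k})) * b ^ (t - k - 1)" by (simp add: power_add)
  have N: "real (Nw (t - k) (a k) (a t)) * b ^ (t - k - 1) \<le> 1"
    by (rule Suc.prems(3)) (use kZ k in auto)
  have "real (card {L \<in> walks k (a 0). last L = a k \<and> (\<forall>k\<in>Z - {k}. L ! k = a k)}) * b ^ (k - 1 - card (Z - {k})) *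
    (real (Nw (t - k) (a k) (a t)) * b ^ (t - k - 1)) \<le> 1 * 1"
    by (rule mult_mono[OF IH N]) (use assms(1) in auto)
  then show ?case unfolding eq p by (simp add: mult_ac)
qed

end

section \<open>Zigzags between concentrated walks\<close>

text \<open>\<open>P\<close> is the family of concentrated walks from \<open>x\<close>.
  \<open>P_large\<close> compares a uniform member with a uniform walk; \<open>P_ext\<close> gives
  every vertex probability at most \<open>Q / \<delta>\<close> in the last step;
  \<open>P_spread\<close> says that, given the endpoint, interior vertices are spread at scale
  \<open>b\<close>, which controls a path read backwards. \<open>m\<close> is the number of double
  steps that bring the closed walk to its prescribed length.\<close>

locale zigzag = out_regular +
  fixes x :: 'a and t m :: nat and P :: "'a list set" and b Q :: real
  assumes t_ge: "2 \<le> t" and x_in: "x \<in> V" and P_walks: "P \<subseteq> walks t x" and P_ne: "P \<noteq> {}"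
    and b_pos: "0 < b" and inv_\<delta>_le: "1 / \<delta> \<le> b" and Q_ge: "1 \<le> Q"
    and P_large: "real \<delta> ^ t \<le> Q * card P"
    and P_ext: "p \<in> P \<Longrightarrow> real \<delta> \<le> Q * card {q \<in> P. butlast q = butlast p}"
    and P_spread: "Z \<subseteq> {1..<t} \<Longrightarrow> Z \<noteq> {} \<Longrightarrow>
      real (card {p \<in> P. last p = y \<and> (\<forall>k\<in>Z. p ! k = a k)}) \<le> Q * b ^ card Z * card {p \<in> P. last p = y}"
begin

text \<open>The bipartite multigraph between the last two levels, one edge for each path of
  \<open>P\<close>. \<open>nY\<close> and \<open>nZ\<close> are its degrees, and \<open>kap\<close>
  is its random walk, standing on the \<open>Y\<close> side at time \<open>t\<close>.\<close>

definition om :: "'a \<Rightarrow> 'a \<Rightarrow> real" where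
  "om z y = card {p \<in> P. p ! (t - 1) = z \<and> p ! t = y}"

definition nY :: "'a \<Rightarrow> real" where "nY y = card {p \<in> P. p ! t = y}"

definition nZ :: "'a \<Rightarrow> real" where "nZ z = card {p \<in> P. p ! (t - 1) = z}"

definition kap :: "nat \<Rightarrow> 'a \<Rightarrow> 'a \<Rightarrow> real" where
  "kap k a c = (if even (k - t) then om c a / nY a else om a c / nZ a)"

text \<open>The price of prescribing position \<open>k\<close>: an outgoing step, or a step from the
  \<open>Z\<close> to the \<open>Y\<close> side, costs \<open>1 / \<delta>\<close>; a step from
  \<open>Y\<close> to \<open>Z\<close>, or on the way back to \<open>x\<close>, costs
  \<open>b\<close>.\<close>

definition cst :: "nat \<Rightarrow> real" where
  "cst k = (if k \<le> t \<or> k \<le> t + 2 * m \<and> even (k - t) then 1 / \<delta> else b)"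

lemma finite_P: "finite P"
  using P_walks finite_walks finite_subset by blast

lemma P_len: "p \<in> P \<Longrightarrow> length p = Suc t" "p \<in> P \<Longrightarrow> set p \<subseteq> V" "p \<in> P \<Longrightarrow> p ! 0 = x"
  "p \<in> P \<Longrightarrow> last p = p ! t"
  using P_walks last_walk by (auto simp: walks_def)

lemma P_nth_in: "p \<in> P \<Longrightarrow> k \<le> t \<Longrightarrow> p ! k \<in> V"
  using P_len(1,2)[of p] nth_mem[of k p] by auto

lemma card_P_pos: "0 < card P" using P_ne finite_P by auto

lemma cst_nonneg: "0 \<le> cst k" unfolding cst_def using b_pos by auto

lemma cst_le: "cst k \<le> b" unfolding cst_def using inv_\<delta>_le by auto

lemma om_nonneg: "0 \<le> om z y" and nY_nonneg: "0 \<le> nY y" and nZ_nonneg: "0 \<le> nZ z"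
  unfolding om_def nY_def nZ_def by auto

lemma om_le_nY: "om z y \<le> nY y" and om_le_nZ: "om z y \<le> nZ z"
  unfolding om_def nY_def nZ_def using finite_P by (auto intro!: card_mono)

lemma sum_om: "(\<Sum>z\<in>V. om z y) = nY y" "(\<Sum>y\<in>V. om z y) = nZ z"
proof -
  have "(\<Sum>z\<in>V. sum (\<lambda>_. 1) {p \<in> {p \<in> P. p ! t = y}. p ! (t - 1) = z}) = sum (\<lambda>_. 1::real) {p \<in> P. p ! t = y}"
    by (rule sum.group) (use finite_P finite_V P_nth_in in auto)
  then show "(\<Sum>z\<in>V. om z y) = nY y" unfolding om_def nY_def by (simp add: conj_ac)
  have "(\<Sum>y\<in>V. sum (\<lambda>_. 1) {p \<in> {p \<in> P. p ! (t - 1) = z}. p ! t = y}) = sum (\<lambda>_. 1::real) {p \<in> P. p ! (t - 1) = z}"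
    by (rule sum.group) (use finite_P finite_V P_nth_in in auto)
  then show "(\<Sum>y\<in>V. om z y) = nZ z" unfolding om_def nZ_def by simp
qed

lemma om_le_b: "om z y \<le> Q * b * nY y"
proof -
  have "real (card {p \<in> P. last p = y \<and> (\<forall>k\<in>{t - 1}. p ! k = z)}) \<le> Q * b ^ card {t - 1} * card {p \<in> P. last p = y}"
    by (rule P_spread) (use t_ge in auto)
  moreover have "{p \<in> P. last p = y \<and> (\<forall>k\<in>{t - 1}. p ! k = z)} = {p \<in> P. p ! (t - 1) = z \<and> p ! t = y}"
    "{p \<in> P. last p = y} = {p \<in> P. p ! t = y}" using P_len(4) by auto
  ultimately show ?thesis unfolding om_def nY_def by simp
qed

text \<open>Given \<open>z\<close> and \<open>y\<close>, a path is determined by its prefix, so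
  \<open>om z y\<close> is at most the number of prefixes ending in \<open>z\<close>. By
  \<open>P_ext\<close> each of these accounts for at least \<open>\<delta> / Q\<close> paths counted
  by \<open>nZ z\<close>.\<close>

lemma om_le_\<delta>: "om z y \<le> Q * (1 / \<delta>) * nZ z"
proof -
  define A where "A = {p \<in> P. p ! (t - 1) = z}"
  define B where "B = butlast ` A"
  have finA: "finite A" unfolding A_def using finite_P by simp
  have bl: "p ! (t - 1) = butlast p ! (t - 1)" if "p \<in> P" for p
    using P_len(1)[OF that] t_ge by (simp add: nth_butlast)
  have "om z y \<le> card B"
  proof -
    have "inj_on butlast {p \<in> P. p ! (t - 1) = z \<and> p ! t = y}"
    proof (rule inj_onI)
      fix p q assume "p \<in> {p \<in> P. p ! (t - 1) = z \<and> p ! t = y}" "q \<in> {p \<in> P. p ! (t - 1) = z \<and> p ! t = y}"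
        and e: "butlast p = butlast q"
      then have "last p = last q" "length p = Suc t" "length q = Suc t" using P_len by auto
      then show "p = q" using e by (metis append_butlast_last_id length_0_conv nat.distinct(1))
    qed
    then have "card {p \<in> P. p ! (t - 1) = z \<and> p ! t = y} = card (butlast ` {p \<in> P. p ! (t - 1) = z \<and> p ! t = y})"
      by (simp add: card_image)
    also have "\<dots> \<le> card B" unfolding B_def A_def using finite_P by (intro card_mono) auto
    finally show ?thesis unfolding om_def by simp
  qed
  moreover have "real (card B) * (\<delta> / Q) \<le> nZ z"
  proof -
    have "real (card B) * (\<delta> / Q) = (\<Sum>\<pi>\<in>B. \<delta> / Q)" by simp
    also have "\<dots> \<le> (\<Sum>\<pi>\<in>B. real (card {q \<in> A. butlast q = \<pi>}))"
    proof (rule sum_mono)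
      fix \<pi> assume "\<pi> \<in> B"
      then obtain p where p: "p \<in> P" "p ! (t - 1) = z" "\<pi> = butlast p" unfolding B_def A_def by auto
      have "{q \<in> P. butlast q = butlast p} = {q \<in> A. butlast q = \<pi>}"
        unfolding A_def p(3) using bl p by force
      then show "\<delta> / Q \<le> real (card {q \<in> A. butlast q = \<pi>})"
        using P_ext[OF p(1)] Q_ge by (simp add: field_simps)
    qed
    also have "\<dots> = (\<Sum>\<pi>\<in>B. sum (\<lambda>_. 1) {q \<in> A. butlast q = \<pi>})" by simp
    also have "\<dots> = sum (\<lambda>_. 1) A" by (rule sum.group) (use finA in \<open>auto simp: B_def\<close>)
    finally show ?thesis unfolding nZ_def A_def by simp
  qed
  ultimately have "om z y * (\<delta> / Q) \<le> nZ z"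
    using Q_ge \<delta>_pos by (meson divide_nonneg_nonneg mult_right_mono of_nat_0_le_iff order_trans zero_le_one)
  then show ?thesis using Q_ge \<delta>_pos by (simp add: field_simps)
qed

lemma kap_nonneg: "0 \<le> kap k a c"
  unfolding kap_def using om_nonneg nY_nonneg nZ_nonneg by auto

text \<open>From \<open>Y\<close> back to \<open>Z\<close> the bound is \<open>P_spread\<close> at
  position \<open>t - 1\<close>; from \<open>Z\<close> to \<open>Y\<close> it is
  \<open>P_ext\<close>.\<close>

lemma kap_le: assumes "t \<le> k" "k < t + 2 * m" shows "kap k a c \<le> Q * cst (Suc k)"
proof (cases "even (k - t)")
  case True
  then have "cst (Suc k) = b" unfolding cst_def using assms by (auto simp: Suc_diff_le)
  moreover have "om c a / nY a \<le> Q * b"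
    using om_le_b[of c a] nY_nonneg[of a] Q_ge b_pos by (cases "nY a = 0") (auto simp: field_simps)
  ultimately show ?thesis unfolding kap_def using True by simp
next
  case False
  then have "cst (Suc k) = 1 / \<delta>" unfolding cst_def using assms by (auto simp: Suc_diff_le)
  moreover have "om a c / nZ a \<le> Q * (1 / \<delta>)"
    using om_le_\<delta>[of a c] nZ_nonneg[of a] Q_ge by (cases "nZ a = 0") (auto simp: field_simps)
  ultimately show ?thesis unfolding kap_def using False by simp
qed

lemma sum_kap:
  "(\<Sum>v\<in>V. kap k a v) = (if (if even (k - t) then nY a else nZ a) = 0 then 0 else 1)"
  unfolding kap_def using sum_om by (simp flip: sum_divide_distrib)

lemma sum_kap_le: "(\<Sum>v\<in>V. kap k a v) \<le> 1"
  unfolding sum_kap by auto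

definition walkish :: "'a list \<Rightarrow> bool" where
  "walkish L \<longleftrightarrow> L ! 0 = x \<and> (\<forall>i. Suc i < length L \<and> i < t \<longrightarrow> L ! Suc i \<in> out (L ! i))"

text \<open>Dominates, up to the factor \<open>Q\<close>, the weight of an initial segment of the random closed walk \<open>mu\<close>
  below: the uniform path of \<open>P\<close> is replaced by a uniform walk.\<close>

definition wd :: "'a list \<Rightarrow> real" where
  "wd L = (if walkish L then 1 else 0) / real \<delta> ^ min (length L - 1) t *
     (\<Prod>k\<in>{t..<length L - 1}. kap k (L ! k) (L ! Suc k))"

lemma wd_nonneg: "0 \<le> wd L"
  unfolding wd_def using kap_nonneg by (auto intro!: prod_nonneg divide_nonneg_nonneg)

lemma walkish_snoc:
  assumes "length L = Suc k" shows "walkish (L @ [v]) \<longleftrightarrow> walkish L \<and> (k < t \<longrightarrow> v \<in> out (L ! k))"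
proof -
  have 1: "(L @ [v]) ! i = L ! i" if "i \<le> k" for i using that assms by (simp add: nth_append)
  have 2: "(L @ [v]) ! Suc k = v" using assms by (metis nth_append_length)
  show ?thesis
  proof
    assume *: "walkish (L @ [v])"
    then have out: "(L @ [v]) ! Suc i \<in> out ((L @ [v]) ! i)" if "i \<le> k" "i < t" for i
      using that assms unfolding walkish_def by simp
    have "L ! Suc i \<in> out (L ! i)" if "Suc i < length L" "i < t" for i
      using out[of i] 1[of i] 1[of "Suc i"] that assms by simp
    moreover have "v \<in> out (L ! k)" if "k < t" using out[of k] that 1[of k] 2 by simp
    moreover have "L ! 0 = x" using * 1[of 0] unfolding walkish_def by simp
    ultimately show "walkish L \<and> (k < t \<longrightarrow> v \<in> out (L ! k))" unfolding walkish_def by simp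
  next
    assume *: "walkish L \<and> (k < t \<longrightarrow> v \<in> out (L ! k))"
    have "(L @ [v]) ! Suc i \<in> out ((L @ [v]) ! i)" if "i \<le> k" "i < t" for i
    proof (cases "i = k")
      case True
      then show ?thesis using * that 1[of k] 2 by simp
    next
      case False
      then show ?thesis using * that 1[of i] 1[of "Suc i"] assms unfolding walkish_def by simp
    qed
    then show "walkish (L @ [v])" using * 1[of 0] assms unfolding walkish_def by simp
  qed
qed

lemma wd_snoc_1:
  assumes "length L = Suc k" "k < t"
  shows "wd (L @ [v]) = wd L * ((if v \<in> out (L ! k) then 1 else 0) / \<delta>)"
proof -
  have "{t..<length (L @ [v]) - 1} = {}" "{t..<length L - 1} = {}"
    "min (length (L @ [v]) - 1) t = Suc k" "min (length L - 1) t = k" using assms by auto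
  then show ?thesis unfolding wd_def walkish_snoc[OF assms(1)] using assms(2) by simp
qed

lemma wd_snoc_2:
  assumes "length L = Suc k" "t \<le> k"
  shows "wd (L @ [v]) = wd L * kap k (L ! k) v"
proof -
  have "(\<Prod>i\<in>{t..<Suc k}. kap i ((L @ [v]) ! i) ((L @ [v]) ! Suc i)) =
      (\<Prod>i\<in>{t..<k}. kap i ((L @ [v]) ! i) ((L @ [v]) ! Suc i)) * kap k ((L @ [v]) ! k) ((L @ [v]) ! Suc k)"
    using assms by (simp add: prod.atLeastLessThan_Suc)
  also have "(\<Prod>i\<in>{t..<k}. kap i ((L @ [v]) ! i) ((L @ [v]) ! Suc i)) = (\<Prod>i\<in>{t..<k}. kap i (L ! i) (L ! Suc i))"
    using assms by (intro prod.cong) (auto simp: nth_append)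
  also have "(L @ [v]) ! k = L ! k" using assms by (simp add: nth_append)
  also have "(L @ [v]) ! Suc k = v" using assms by (metis nth_append_length)
  finally show ?thesis
    using assms unfolding wd_def walkish_snoc[OF assms(1)] by (simp add: min_def)
qed

text \<open>Together with \<open>wd_cost\<close> this supplies the hypotheses of
  \<open>chain_sum\<close>. Mass can be lost: a uniform walk may end at a vertex with
  \<open>nY\<close> equal to 0, whose \<open>kap\<close> row vanishes.\<close>

lemma wd_sub:
  assumes "1 \<le> length L" "set L \<subseteq> V"
  shows "(\<Sum>v\<in>V. wd (L @ [v])) \<le> wd L"
proof -
  obtain k where k: "length L = Suc k" using assms(1) by (cases "length L") auto
  have Lk: "L ! k \<in> V" using assms(2) k nth_mem[of k L] by auto
  show ?thesis
  proof (cases "k < t")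
    case True
    have "(\<Sum>v\<in>V. (if v \<in> out (L ! k) then 1 else 0) / real \<delta>) = (\<Sum>v\<in>V. if v \<in> out (L ! k) then 1 else 0) / real \<delta>"
      by (simp add: sum_divide_distrib)
    also have "(\<Sum>v\<in>V. if v \<in> out (L ! k) then 1 else (0::real)) = card (V \<inter> out (L ! k))"
      using finite_V by (simp add: sum.If_cases Int_def)
    also have "V \<inter> out (L ! k) = out (L ! k)" using out_subset[OF Lk] by auto
    finally have "(\<Sum>v\<in>V. (if v \<in> out (L ! k) then 1 else 0) / real \<delta>) = 1"
      using card_out[OF Lk] \<delta>_pos by simp
    then show ?thesis unfolding wd_snoc_1[OF k True] by (simp only: flip: sum_distrib_left)
  next
    case False
    then have "(\<Sum>v\<in>V. wd (L @ [v])) = wd L * (\<Sum>v\<in>V. kap k (L ! k) v)"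
      by (simp add: wd_snoc_2[OF k] sum_distrib_left)
    then show ?thesis using mult_left_mono[OF sum_kap_le wd_nonneg] by simp
  qed
qed

lemma wd_cost:
  assumes "1 \<le> length L" "length L \<le> t + 2 * m"
  shows "wd (L @ [v]) \<le> (Q * cst (length L)) * wd L"
proof -
  obtain k where k: "length L = Suc k" using assms(1) by (cases "length L") auto
  show ?thesis
  proof (cases "k < t")
    case True
    then have "cst (length L) = 1 / \<delta>" unfolding cst_def k by auto
    then have "(if v \<in> out (L ! k) then 1 else 0) / \<delta> \<le> Q * cst (length L)"
      using Q_ge by (auto simp: divide_right_mono)
    then have "wd L * ((if v \<in> out (L ! k) then 1 else 0) / \<delta>) \<le> wd L * (Q * cst (length L))"
      by (rule mult_left_mono) (rule wd_nonneg)
    then show ?thesis unfolding wd_snoc_1[OF k True] by (simp add: mult_ac)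
  next
    case False
    then have "wd L * kap k (L ! k) v \<le> wd L * (Q * cst (length L))"
      unfolding k using assms k by (intro mult_left_mono kap_le wd_nonneg) auto
    then show ?thesis using False by (simp add: wd_snoc_2[OF k] mult_ac)
  qed
qed

lemma sum_wd_le: "(\<Sum>L\<in>nlists V (Suc r). wd L) \<le> 1"
proof (induction r)
  case 0
  have "(\<Sum>v\<in>V. wd [v]) = (\<Sum>v\<in>V. if v = x then 1 else 0)"
    by (rule sum.cong) (auto simp: wd_def walkish_def)
  then show ?case using finite_V x_in by (simp add: sum_nlists_1)
next
  case (Suc r)
  have "(\<Sum>L\<in>nlists V (Suc (Suc r)). wd L) = (\<Sum>L\<in>nlists V (Suc r). \<Sum>v\<in>V. wd (L @ [v]))"
    by (rule sum_nlists_snoc)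
  also have "\<dots> \<le> (\<Sum>L\<in>nlists V (Suc r). wd L)"
    by (intro sum_mono wd_sub) (auto simp: nlists_def)
  finally show ?case using Suc by simp
qed

text \<open>The random closed walk runs through a uniform path of \<open>P\<close>, then through \<open>m\<close> double steps
  \<open>y, z, y'\<close> between the last two levels, and returns to \<open>x\<close> along a uniform path of \<open>P\<close> read
  backwards.\<close>

definition n2 :: nat where "n2 = 2 * t + 2 * m"

text \<open>Conditional weight of the returning path given its start \<open>y\<close>:
  \<open>R\<close> lists the vertices strictly between \<open>y\<close> and \<open>x\<close> in the
  order of the closed walk, hence \<open>rev\<close>.\<close>

definition closing :: "'a list \<Rightarrow> 'a \<Rightarrow> real" where
  "closing R y = (if x # rev R @ [y] \<in> P then 1 else 0) / nY y"

definition mu :: "'a list \<Rightarrow> real" where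
  "mu u = (if take (Suc t) u \<in> P \<and> x # rev (drop (t + 2 * m) u) \<in> P then 1 else 0) / card P *
     (\<Prod>k\<in>{t..<t + 2 * m}. kap k (u ! k) (u ! Suc k)) / nY (u ! (t + 2 * m))"

lemma mu_nonneg: "0 \<le> mu u"
  unfolding mu_def using kap_nonneg nY_nonneg by (auto intro!: prod_nonneg divide_nonneg_nonneg mult_nonneg_nonneg)

lemma walkish_P: "p \<in> P \<Longrightarrow> take (Suc t) L = p \<Longrightarrow> walkish L"
proof -
  assume p: "p \<in> P" "take (Suc t) L = p"
  have "p \<in> walks t x" using p P_walks by auto
  then have w: "p ! 0 = x" "\<And>i. i < t \<Longrightarrow> p ! Suc i \<in> out (p ! i)" "length p = Suc t" by (auto simp: walks_def)
  have "p ! i = L ! i" if "i \<le> t" for i using that p(2) by (metis le_imp_less_Suc nth_take)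
  then show "walkish L" unfolding walkish_def using w by (metis Suc_leI le0 less_imp_le)
qed

text \<open>\<open>mu\<close> starts with a uniform path of \<open>P\<close>, \<open>wd\<close> with
  a uniform walk; by \<open>P_large\<close> a path weighs at most \<open>Q\<close> times as much as
  a walk. This is how the first \<open>t\<close> steps get the price \<open>1 / \<delta>\<close>
  although \<open>P_ext\<close> speaks only of the last one.\<close>

lemma mu_append_le:
  assumes "length L = Suc (t + 2 * m)"
  shows "mu (L @ R) \<le> Q * wd L * closing R (last L)"
proof (cases "take (Suc t) (L @ R) \<in> P \<and> x # rev (drop (t + 2 * m) (L @ R)) \<in> P")
  case False
  then have "mu (L @ R) = 0" unfolding mu_def by auto
  then show ?thesis using wd_nonneg Q_ge nY_nonneg unfolding closing_def by auto
next
  case True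
  have last: "last L = L ! (t + 2 * m)" using assms by (metis diff_Suc_1 last_conv_nth length_0_conv nat.distinct(1))
  have tk: "take (Suc t) L \<in> P" using True assms by simp
  have "drop (t + 2 * m) L = [last L]" using assms last
    by (metis Cons_nth_drop_Suc drop_all lessI order_refl)
  then have cl: "closing R (last L) = 1 / nY (last L)" using True assms unfolding closing_def by simp
  have w: "walkish L" using walkish_P[OF tk refl] .
  have pr: "(\<Prod>k\<in>{t..<t + 2 * m}. kap k ((L @ R) ! k) ((L @ R) ! Suc k)) = (\<Prod>k\<in>{t..<t + 2 * m}. kap k (L ! k) (L ! Suc k))"
    using assms by (intro prod.cong) (auto simp: nth_append)
  define p where "p = (\<Prod>k\<in>{t..<t + 2 * m}. kap k (L ! k) (L ! Suc k))"
  have p0: "0 \<le> p" unfolding p_def by (intro prod_nonneg) (auto simp: kap_nonneg)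
  have "(L @ R) ! (t + 2 * m) = last L" using last assms by (simp add: nth_append)
  then have "mu (L @ R) = 1 / card P * p / nY (last L)"
    unfolding mu_def p_def[symmetric] pr using True by simp
  moreover have "wd L = 1 / real \<delta> ^ t * p"
    unfolding wd_def p_def using w assms by (simp add: min_def)
  moreover have "1 / card P \<le> Q * (1 / real \<delta> ^ t)"
    using P_large card_P_pos \<delta>_pos by (simp add: field_simps)
  ultimately show ?thesis
    unfolding cl using mult_right_mono[of "1 / card P" "Q * (1 / real \<delta> ^ t)" "p / nY (last L)"] p0 nY_nonneg
    by simp
qed

text \<open>Position \<open>k\<close> of the closed walk is position \<open>n2 - k\<close> of the
  returning path, so this is \<open>P_spread\<close>. For empty \<open>Z\<close> it is the
  normalisation by \<open>nY\<close>.\<close>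

lemma closing_sum_le:
  assumes "length L = Suc (t + 2 * m)" "Z \<subseteq> {Suc (t + 2 * m)..<n2}"
  shows "(\<Sum>R\<in>nlists V (t - 1). if \<forall>k\<in>Z. (L @ R) ! k = a k then closing R y else 0) \<le> Q * b ^ card Z"
proof -
  define Z' where "Z' = (\<lambda>k. n2 - k) ` Z"
  have finZ: "finite Z" using assms(2) finite_subset by blast
  have Z': "Z' \<subseteq> {1..<t}" unfolding Z'_def using assms(2) by (force simp: n2_def)
  have cZ: "card Z' = card Z" unfolding Z'_def
  proof (rule card_image, rule inj_onI)
    fix k k' assume "k \<in> Z" "k' \<in> Z" "n2 - k = n2 - k'"
    moreover from this have "k < n2" "k' < n2" using assms(2) by auto
    ultimately show "k = k'" by simp
  qed
  define A where "A = {p \<in> P. last p = y \<and> (\<forall>k\<in>Z'. p ! k = a (n2 - k))}"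
  have "(\<Sum>R\<in>nlists V (t - 1). if \<forall>k\<in>Z. (L @ R) ! k = a k then closing R y else 0)
    = (\<Sum>R | R \<in> nlists V (t - 1) \<and> (\<forall>k\<in>Z. (L @ R) ! k = a k) \<and> x # rev R @ [y] \<in> P. 1 / nY y)"
    unfolding sum.inter_filter[OF finite_nlists[OF finite_V]]
    by (rule sum.cong) (auto simp: closing_def)
  also have "\<dots> = real (card {R \<in> nlists V (t - 1). (\<forall>k\<in>Z. (L @ R) ! k = a k) \<and> x # rev R @ [y] \<in> P}) / nY y" by simp
  also have "card {R \<in> nlists V (t - 1). (\<forall>k\<in>Z. (L @ R) ! k = a k) \<and> x # rev R @ [y] \<in> P} \<le> card A"
  proof (rule card_inj_on_le[where f="\<lambda>R. x # rev R @ [y]"])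
    show "inj_on (\<lambda>R. x # rev R @ [y]) {R \<in> nlists V (t - 1). (\<forall>k\<in>Z. (L @ R) ! k = a k) \<and> x # rev R @ [y] \<in> P}"
      by (auto simp: inj_on_def)
    show "finite A" unfolding A_def using finite_P by simp
    show "(\<lambda>R. x # rev R @ [y]) ` {R \<in> nlists V (t - 1). (\<forall>k\<in>Z. (L @ R) ! k = a k) \<and> x # rev R @ [y] \<in> P} \<subseteq> A"
    proof safe
      fix R assume R: "R \<in> nlists V (t - 1)" "\<forall>k\<in>Z. (L @ R) ! k = a k" "x # rev R @ [y] \<in> P"
      have lenR: "length R = t - 1" using R by (simp add: nlists_def)
      have "(x # rev R @ [y]) ! k' = a (n2 - k')" if k': "k' \<in> Z'" for k'
      proof -
        obtain k where k: "k \<in> Z" "k' = n2 - k" using k' unfolding Z'_def by auto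
        then have kb: "Suc (t + 2 * m) \<le> k" "k < n2" using assms(2) by auto
        have "(x # rev R @ [y]) ! k' = rev R ! (k' - 1)"
        proof -
          have "k' = Suc (k' - 1)" "k' - 1 < length (rev R)" using k kb lenR t_ge by (auto simp: n2_def)
          then show ?thesis by (metis nth_Cons_Suc nth_append)
        qed
        also have "\<dots> = R ! (k - Suc (t + 2 * m))"
          using k kb lenR by (subst rev_nth) (auto simp: n2_def intro!: arg_cong[where f="nth R"])
        also have "\<dots> = (L @ R) ! k" using kb assms(1) by (simp add: nth_append)
        also have "\<dots> = a k" using R k by auto
        finally show ?thesis using k kb by simp
      qed
      then show "x # rev R @ [y] \<in> A" unfolding A_def using R by simp
    qed
  qed
  also have "real (card A) / nY y \<le> Q * b ^ card Z"
  proof -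
    have eq: "{p \<in> P. last p = y} = {p \<in> P. p ! t = y}" using P_len(4) by auto
    have "real (card A) \<le> Q * b ^ card Z * nY y"
    proof (cases "Z = {}")
      case True
      have "card A \<le> card {p \<in> P. p ! t = y}" unfolding eq[symmetric]
        using finite_P by (intro card_mono) (auto simp: A_def)
      then have "real (card A) \<le> nY y" by (simp add: nY_def)
      also have "nY y \<le> Q * nY y" using Q_ge nY_nonneg[of y] by (simp add: mult_le_cancel_right1)
      finally show ?thesis using True by simp
    next
      case False
      then have "Z' \<noteq> {}" unfolding Z'_def by auto
      from P_spread[OF Z' this, of y "\<lambda>k. a (n2 - k)"] show ?thesis
        unfolding A_def nY_def cZ eq[symmetric] .
    qed
    then show ?thesis using nY_nonneg[of y] Q_ge b_pos by (cases "nY y = 0") (auto simp: field_simps)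
  qed
  finally show ?thesis using nY_nonneg by (simp add: divide_right_mono)
qed

end

section \<open>Spread, total mass and reversibility of the random closed walk\<close>

context zigzag
begin

text \<open>Density of the edge at positions \<open>i\<close> and \<open>Suc i\<close> under
  \<open>wd\<close>. Its sum over all edges is at most 1, which disposes of the first edge in every
  union bound.\<close>

definition rho :: "nat \<Rightarrow> 'a \<Rightarrow> 'a \<Rightarrow> real" where
  "rho i e0 e1 = (\<Sum>L\<in>nlists V (i + 2). if L ! i = e0 \<and> L ! Suc i = e1 then wd L else 0)"

lemma rho_nonneg: "0 \<le> rho i e0 e1"
  unfolding rho_def using wd_nonneg by (intro sum_nonneg) auto

lemma sum_rho_le: "(\<Sum>e0\<in>V. \<Sum>e1\<in>V. rho i e0 e1) \<le> 1"
proof -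
  have "(\<Sum>e0\<in>V. \<Sum>e1\<in>V. rho i e0 e1) =
      (\<Sum>e\<in>V \<times> V. \<Sum>L\<in>nlists V (i + 2). if (L ! i, L ! Suc i) = e then wd L else 0)"
    unfolding rho_def sum.cartesian_product[of "\<lambda>e0 e1. \<Sum>L\<in>nlists V (i + 2). if L ! i = e0 \<and> L ! Suc i = e1 then wd L else 0"]
    by (rule sum.cong) auto
  also have "\<dots> = (\<Sum>L\<in>nlists V (i + 2). \<Sum>e\<in>V \<times> V. if (L ! i, L ! Suc i) = e then wd L else 0)"
    by (rule sum.swap)
  also have "\<dots> \<le> (\<Sum>L\<in>nlists V (i + 2). wd L)"
    by (rule sum_mono) (use finite_V wd_nonneg in auto)
  also have "\<dots> \<le> 1" using sum_wd_le[of "Suc i"] by simp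
  finally show ?thesis .
qed

text \<open>The segment up to the edge gives \<open>rho\<close>; later prescribed positions up to
  \<open>t + 2 * m\<close> are paid by \<open>chain_sum\<close>, those beyond by
  \<open>closing_sum_le\<close>. One extra factor \<open>Q\<close> comes from replacing
  \<open>mu\<close> by \<open>wd\<close>, the other from the closing path. The edge must precede the
  closing path, hence the bound on \<open>i\<close>.\<close>

lemma spread:
  assumes i: "i < t + 2 * m" and Z: "Z \<subseteq> {i + 2..<n2}"
  shows "(\<Sum>u\<in>nlists V n2. if u ! i = e0 \<and> u ! Suc i = e1 \<and> (\<forall>k\<in>Z. u ! k = a k) then mu u else 0)
    \<le> Q * Q * rho i e0 e1 * (\<Prod>k\<in>Z. Q * cst k)"
proof -
  \<comment> \<open>The list is cut into \<open>i + 2\<close> entries ending with the edge,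
    \<open>r\<close> entries up to position \<open>t + 2 * m\<close>, and the \<open>t - 1\<close>
    entries of the closing path.\<close>
  define r where "r = t + 2 * m - Suc i"
  have n: "n2 = (i + 2) + r + (t - 1)" "i + 2 + r = Suc (t + 2 * m)"
    using i t_ge unfolding r_def n2_def by auto
  define Z1 where "Z1 = Z \<inter> {i + 2..<i + 2 + r}"
  define Z2 where "Z2 = Z \<inter> {Suc (t + 2 * m)..<n2}"
  have finZ: "finite Z" using Z finite_subset by blast
  have ZZ: "Z = Z1 \<union> Z2" "Z1 \<inter> Z2 = {}" using Z n(2) unfolding Z1_def Z2_def by force+
  have pr: "(\<Prod>k\<in>Z. Q * cst k) = (\<Prod>k\<in>Z1. Q * cst k) * (\<Prod>k\<in>Z2. Q * cst k)"
    using ZZ finZ by (metis finite_Un prod.union_disjoint)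
  have Z2c: "b ^ card Z2 \<le> (\<Prod>k\<in>Z2. Q * cst k)"
  proof -
    have "b \<le> Q * cst k" if "k \<in> Z2" for k
    proof -
      have "cst k = b" using that unfolding Z2_def cst_def by auto
      then show ?thesis using Q_ge b_pos by (simp add: mult_le_cancel_right1)
    qed
    then have "(\<Prod>k\<in>Z2. b) \<le> (\<Prod>k\<in>Z2. Q * cst k)" using b_pos by (intro prod_mono) auto
    then show ?thesis by simp
  qed
  let ?M = "\<lambda>u. u ! i = e0 \<and> u ! Suc i = e1"
  define f where "f u = (if ?M u \<and> (\<forall>k\<in>Z. u ! k = a k) then mu u else 0)" for u
  have "(\<Sum>u\<in>nlists V n2. f u) = (\<Sum>L\<in>nlists V (i + 2). \<Sum>R\<in>nlists V r. \<Sum>S\<in>nlists V (t - 1). f ((L @ R) @ S))"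
    unfolding n(1) by (simp only: sum_nlists_append)
  also have "\<dots> \<le> (\<Sum>L\<in>nlists V (i + 2). \<Sum>R\<in>nlists V r.
      (if ?M L then 1 else 0) * ((if \<forall>k\<in>Z1. (L @ R) ! k = a k then wd (L @ R) else 0) * (Q * Q * b ^ card Z2)))"
  proof (intro sum_mono)
    fix L R assume L: "L \<in> nlists V (i + 2)" and R: "R \<in> nlists V r"
    define T where "T = L @ R"
    have lenT: "length T = Suc (t + 2 * m)" unfolding T_def using L R n(2) by (simp add: nlists_def)
    have lenL: "length L = i + 2" using L by (simp add: nlists_def)
    have "(\<Sum>S\<in>nlists V (t - 1). f (T @ S)) \<le> (\<Sum>S\<in>nlists V (t - 1).
      (if ?M L then 1 else 0) * ((if \<forall>k\<in>Z1. T ! k = a k then wd T else 0) *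
        (Q * (if \<forall>k\<in>Z2. (T @ S) ! k = a k then closing S (last T) else 0))))"
    proof (rule sum_mono)
      fix S
      have nth1: "(T @ S) ! k = T ! k" if "k < Suc (t + 2 * m)" for k using that lenT by (simp add: nth_append)
      have nth2: "T ! k = L ! k" if "k < i + 2" for k using that lenL unfolding T_def by (simp add: nth_append)
      have M: "?M (T @ S) \<longleftrightarrow> ?M L" using nth1[of i] nth1[of "Suc i"] nth2[of i] nth2[of "Suc i"] i by simp
      have "\<forall>k\<in>Z1. (T @ S) ! k = T ! k" using nth1 n(2) unfolding Z1_def by auto
      then have *: "(\<forall>k\<in>Z. (T @ S) ! k = a k) \<longleftrightarrow> (\<forall>k\<in>Z1. T ! k = a k) \<and> (\<forall>k\<in>Z2. (T @ S) ! k = a k)"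
        unfolding ZZ(1) by (auto simp: ball_Un)
      have "f (T @ S) \<le> (if ?M L \<and> (\<forall>k\<in>Z1. T ! k = a k) \<and> (\<forall>k\<in>Z2. (T @ S) ! k = a k) then Q * wd T * closing S (last T) else 0)"
        unfolding f_def M * using mu_append_le[OF lenT, of S] by auto
      then show "f (T @ S) \<le> (if ?M L then 1 else 0) * ((if \<forall>k\<in>Z1. T ! k = a k then wd T else 0) *
        (Q * (if \<forall>k\<in>Z2. (T @ S) ! k = a k then closing S (last T) else 0)))"
        by (auto simp: mult_ac split: if_splits)
    qed
    also have "\<dots> = (if ?M L then 1 else 0) * ((if \<forall>k\<in>Z1. T ! k = a k then wd T else 0) *
        (Q * (\<Sum>S\<in>nlists V (t - 1). if \<forall>k\<in>Z2. (T @ S) ! k = a k then closing S (last T) else 0)))"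
      by (simp only: sum_distrib_left)
    also have "\<dots> \<le> (if ?M L then 1 else 0) * ((if \<forall>k\<in>Z1. T ! k = a k then wd T else 0) * (Q * (Q * b ^ card Z2)))"
      by (intro mult_left_mono closing_sum_le[OF lenT]) (use Q_ge wd_nonneg in \<open>auto simp: Z2_def\<close>)
    finally show "(\<Sum>S\<in>nlists V (t - 1). f ((L @ R) @ S)) \<le> (if ?M L then 1 else 0) *
      ((if \<forall>k\<in>Z1. (L @ R) ! k = a k then wd (L @ R) else 0) * (Q * Q * b ^ card Z2))"
      unfolding T_def by (simp add: mult_ac)
  qed
  also have "\<dots> = (\<Sum>L\<in>nlists V (i + 2). (if ?M L then 1 else 0) *
      ((\<Sum>R\<in>nlists V r. if \<forall>k\<in>Z1. (L @ R) ! k = a k then wd (L @ R) else 0) * (Q * Q * b ^ card Z2)))"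
    by (simp only: sum_distrib_left sum_distrib_right)
  also have "\<dots> \<le> (\<Sum>L\<in>nlists V (i + 2). (if ?M L then 1 else 0) *
      ((wd L * (\<Prod>k\<in>Z1. Q * cst k)) * (Q * Q * b ^ card Z2)))"
  proof (intro sum_mono mult_left_mono mult_right_mono)
    fix L assume L: "L \<in> nlists V (i + 2)"
    show "(\<Sum>R\<in>nlists V r. if \<forall>k\<in>Z1. (L @ R) ! k = a k then wd (L @ R) else 0) \<le> wd L * (\<Prod>k\<in>Z1. Q * cst k)"
    proof (rule chain_sum[OF finite_V L])
      show "Z1 \<subseteq> {i + 2..<i + 2 + r}" unfolding Z1_def by auto
      show "\<And>L. 0 \<le> wd L" by (rule wd_nonneg)
      show "\<And>k. 0 \<le> Q * cst k" using Q_ge cst_nonneg by simp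
      show "\<And>L. i + 2 \<le> length L \<Longrightarrow> set L \<subseteq> V \<Longrightarrow> (\<Sum>v\<in>V. wd (L @ [v])) \<le> wd L" by (rule wd_sub) auto
      show "\<And>L v. i + 2 \<le> length L \<Longrightarrow> length L < i + 2 + r \<Longrightarrow> wd (L @ [v]) \<le> Q * cst (length L) * wd L"
        using n(2) by (intro wd_cost) auto
    qed
  qed (use b_pos Q_ge in auto)
  also have "\<dots> = (\<Sum>L\<in>nlists V (i + 2). if ?M L then wd L else 0) * ((\<Prod>k\<in>Z1. Q * cst k) * (Q * Q * b ^ card Z2))"
    unfolding sum_distrib_right by (rule sum.cong) auto
  also have "\<dots> = rho i e0 e1 * ((\<Prod>k\<in>Z1. Q * cst k) * (Q * Q * b ^ card Z2))" unfolding rho_def by simp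
  also have "\<dots> \<le> rho i e0 e1 * ((\<Prod>k\<in>Z1. Q * cst k) * (Q * Q * (\<Prod>k\<in>Z2. Q * cst k)))"
    by (intro mult_left_mono Z2c prod_nonneg rho_nonneg) (use Q_ge cst_nonneg in auto)
  finally show ?thesis unfolding f_def pr by (simp add: mult_ac)
qed

text \<open>The exact law of an initial segment with more than \<open>t\<close> entries, in contrast
  to the dominating \<open>wd\<close>.\<close>

definition wP :: "'a list \<Rightarrow> real" where
  "wP L = (if take (Suc t) L \<in> P then 1 else 0) / card P * (\<Prod>k\<in>{t..<length L - 1}. kap k (L ! k) (L ! Suc k))"

text \<open>Excludes the default value of division by zero: a vertex reached with positive weight
  has positive degree on its side, so the next \<open>kap\<close> row sums to exactly 1.\<close>

lemma wP_support:
  assumes "length L = Suc (t + s)" "wP L \<noteq> 0"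
  shows "if even s then nY (L ! (t + s)) \<noteq> 0 else nZ (L ! (t + s)) \<noteq> 0"
proof (cases s)
  case 0
  then have "L \<in> P" using assms by (auto simp: wP_def split: if_splits)
  then have "L \<in> {p \<in> P. p ! t = L ! t}" by auto
  then have "nY (L ! t) \<noteq> 0" unfolding nY_def using finite_P by auto
  then show ?thesis using 0 by simp
next
  case (Suc r)
  have "kap (t + r) (L ! (t + r)) (L ! Suc (t + r)) \<noteq> 0"
    using assms Suc unfolding wP_def by auto
  then have "if even r then om (L ! (t + s)) (L ! (t + r)) \<noteq> 0 else om (L ! (t + r)) (L ! (t + s)) \<noteq> 0"
    unfolding kap_def using Suc by (auto split: if_splits)
  then show ?thesis using Suc om_le_nY om_le_nZ om_nonneg nY_nonneg nZ_nonneg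
    by (metis even_Suc order_antisym)
qed

lemma sum_wP: "(\<Sum>L\<in>nlists V (Suc (t + s)). wP L) = 1"
proof (induction s)
  case 0
  have "(\<Sum>L\<in>nlists V (Suc t). wP L) = (\<Sum>L\<in>nlists V (Suc t). if L \<in> P then 1 / card P else 0)"
    by (rule sum.cong) (auto simp: wP_def nlists_def)
  also have "\<dots> = (\<Sum>L\<in>P. 1 / card P)"
    using P_walks walks_subset_nlists[of t x] finite_nlists[OF finite_V]
    by (simp add: sum.inter_restrict[symmetric] Int_absorb1)
  finally show ?case using card_P_pos by simp
next
  case (Suc s)
  have "(\<Sum>L\<in>nlists V (Suc (Suc (t + s))). wP L) = (\<Sum>L\<in>nlists V (Suc (t + s)). \<Sum>v\<in>V. wP (L @ [v]))"
    by (rule sum_nlists_snoc)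
  also have "\<dots> = (\<Sum>L\<in>nlists V (Suc (t + s)). wP L)"
  proof (rule sum.cong[OF refl])
    fix L assume "L \<in> nlists V (Suc (t + s))"
    then have len: "length L = Suc (t + s)" by (simp add: nlists_def)
    have "wP (L @ [v]) = wP L * kap (t + s) (L ! (t + s)) v" for v
    proof -
      have "(\<Prod>i\<in>{t..<Suc (t + s)}. kap i ((L @ [v]) ! i) ((L @ [v]) ! Suc i)) =
          (\<Prod>i\<in>{t..<t + s}. kap i ((L @ [v]) ! i) ((L @ [v]) ! Suc i)) * kap (t + s) ((L @ [v]) ! (t + s)) ((L @ [v]) ! Suc (t + s))"
        by (simp add: prod.atLeastLessThan_Suc)
      also have "(\<Prod>i\<in>{t..<t + s}. kap i ((L @ [v]) ! i) ((L @ [v]) ! Suc i)) = (\<Prod>i\<in>{t..<t + s}. kap i (L ! i) (L ! Suc i))"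
        using len by (intro prod.cong) (auto simp: nth_append)
      also have "(L @ [v]) ! (t + s) = L ! (t + s)" using len by (simp add: nth_append)
      also have "(L @ [v]) ! Suc (t + s) = v" using len by (metis nth_append_length)
      finally show ?thesis unfolding wP_def using len by simp
    qed
    then have "(\<Sum>v\<in>V. wP (L @ [v])) = wP L * (\<Sum>v\<in>V. kap (t + s) (L ! (t + s)) v)"
      by (simp add: sum_distrib_left)
    also have "\<dots> = wP L"
      using wP_support[OF len] unfolding sum_kap by (cases "wP L = 0") (auto split: if_splits)
    finally show "(\<Sum>v\<in>V. wP (L @ [v])) = wP L" .
  qed
  finally show ?case using Suc by simp
qed

lemma sum_mu: "(\<Sum>u\<in>nlists V n2. mu u) = 1"
proof -
  have n: "n2 = Suc (t + 2 * m) + (t - 1)" unfolding n2_def using t_ge by simp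
  have "(\<Sum>u\<in>nlists V n2. mu u) = (\<Sum>L\<in>nlists V (Suc (t + 2 * m)). \<Sum>R\<in>nlists V (t - 1). mu (L @ R))"
    unfolding n by (rule sum_nlists_append)
  also have "\<dots> = (\<Sum>L\<in>nlists V (Suc (t + 2 * m)). wP L)"
  proof (rule sum.cong[OF refl])
    fix L assume "L \<in> nlists V (Suc (t + 2 * m))"
    then have len: "length L = Suc (t + 2 * m)" by (simp add: nlists_def)
    define y where "y = L ! (t + 2 * m)"
    have dr: "drop (t + 2 * m) L = [y]" using len unfolding y_def
      by (metis Cons_nth_drop_Suc drop_all lessI order_refl)
    have eq: "mu (L @ R) = wP L * closing R y" for R
    proof -
      have "(\<Prod>k\<in>{t..<t + 2 * m}. kap k ((L @ R) ! k) ((L @ R) ! Suc k)) = (\<Prod>k\<in>{t..<t + 2 * m}. kap k (L ! k) (L ! Suc k))"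
        using len by (intro prod.cong) (auto simp: nth_append)
      moreover have "(L @ R) ! (t + 2 * m) = y" using len unfolding y_def by (simp add: nth_append)
      moreover have "take (Suc t) (L @ R) = take (Suc t) L" using len by simp
      ultimately show ?thesis unfolding mu_def wP_def closing_def using dr len by auto
    qed
    show "(\<Sum>R\<in>nlists V (t - 1). mu (L @ R)) = wP L"
    proof (cases "wP L = 0")
      case True
      then show ?thesis unfolding eq by simp
    next
      case False
      then have ny: "nY y \<noteq> 0" using wP_support[OF len] unfolding y_def by simp
      have "(\<Sum>R\<in>nlists V (t - 1). closing R y) = (\<Sum>R | R \<in> nlists V (t - 1) \<and> x # rev R @ [y] \<in> P. 1 / nY y)"
        unfolding sum.inter_filter[OF finite_nlists[OF finite_V]] closing_def by (rule sum.cong) auto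
      also have "\<dots> = (\<Sum>p | p \<in> P \<and> p ! t = y. 1 / nY y)"
      proof (rule sum.reindex_bij_witness[where j="\<lambda>R. x # rev R @ [y]" and i="\<lambda>p. rev (tl (butlast p))"])
        fix R assume "R \<in> {R. R \<in> nlists V (t - 1) \<and> x # rev R @ [y] \<in> P}"
        then have R: "length R = t - 1" "x # rev R @ [y] \<in> P" by (auto simp: nlists_def)
        then show "x # rev R @ [y] \<in> {p. p \<in> P \<and> p ! t = y}" using P_len(4)[OF R(2)] by simp
      next
        fix p assume "p \<in> {p. p \<in> P \<and> p ! t = y}"
        then have p: "p \<in> P" "p ! t = y" by auto
        have ly: "last p = y" using P_len(4) p by auto
        obtain c q where q: "p = c # q" "length q = t" using P_len(1)[OF p(1)] by (metis length_Suc_conv)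
        have "c = x" using P_len(3)[OF p(1)] q by simp
        have "q \<noteq> []" using q t_ge by auto
        then have "butlast p = x # butlast q" "q = butlast q @ [y]" 
          using append_butlast_last_id[of q] q ly \<open>c = x\<close> by auto
        then show eqp: "x # rev (rev (tl (butlast p))) @ [y] = p" using q \<open>c = x\<close> by simp
        have "set (butlast q) \<subseteq> V" using P_len(2)[OF p(1)] q by (auto dest: in_set_butlastD)
        then show "rev (tl (butlast p)) \<in> {R. R \<in> nlists V (t - 1) \<and> x # rev R @ [y] \<in> P}"
          using eqp p q \<open>butlast p = x # butlast q\<close> by (simp add: nlists_def)
      qed (auto)
      also have "\<dots> = 1" using ny by (simp add: nY_def)
      finally show ?thesis unfolding eq by (simp flip: sum_distrib_left)
    qed
  qed
  also have "\<dots> = 1" by (rule sum_wP)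
  finally show ?thesis .
qed

definition rv :: "'a list \<Rightarrow> 'a list" where "rv u = hd u # rev (tl u)"

lemma rv_props:
  assumes "u \<in> nlists V n2"
  shows "rv u \<in> nlists V n2" "rv (rv u) = u" "rv u ! 0 = u ! 0"
    "1 \<le> k \<Longrightarrow> k < n2 \<Longrightarrow> rv u ! k = u ! (n2 - k)"
proof -
  have len: "length u = n2" "set u \<subseteq> V" using assms by (auto simp: nlists_def)
  have "u \<noteq> []" using len t_ge by (auto simp: n2_def)
  then obtain h w where hw: "u = h # w" by (cases u) auto
  show "rv u \<in> nlists V n2" "rv (rv u) = u" "rv u ! 0 = u ! 0" using len hw by (auto simp: rv_def nlists_def)
  show "rv u ! k = u ! (n2 - k)" if "1 \<le> k" "k < n2"
  proof -
    define k' where "k' = k - 1"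
    have k': "k = Suc k'" using that(1) unfolding k'_def by simp
    have lw: "n2 = Suc (length w)" using hw len by simp
    have "n2 - k = Suc (length w - Suc k')" using k' lw that by simp
    moreover have "rev w ! k' = w ! (length w - Suc k')" using k' lw that by (intro rev_nth) auto
    ultimately show ?thesis unfolding rv_def hw k' by simp
  qed
qed

lemma sum_rv: "(\<Sum>u\<in>nlists V n2. f (rv u)) = (\<Sum>u\<in>nlists V n2. f u)"
  by (rule sum.reindex_bij_witness[where i=rv and j=rv]) (auto simp: rv_props)

text \<open>Grouping the factors by vertex rather than by step gives a form that is visibly
  symmetric under reversal: every \<open>Y\<close> vertex, both ends included, is divided by
  once.\<close>

lemma prod_kap:
  "(\<Prod>k\<in>{t..<t + 2 * r}. kap k (u ! k) (u ! Suc k)) / nY (u ! (t + 2 * r)) =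
   (\<Prod>s<r. om (u ! (t + 2 * s + 1)) (u ! (t + 2 * s)) * om (u ! (t + 2 * s + 1)) (u ! (t + 2 * s + 2)) / nZ (u ! (t + 2 * s + 1)))
   / (\<Prod>s<Suc r. nY (u ! (t + 2 * s)))"
proof (induction r)
  case 0
  then show ?case by simp
next
  case (Suc r)
  have "(\<Prod>k\<in>{t..<t + 2 * Suc r}. kap k (u ! k) (u ! Suc k)) = (\<Prod>k\<in>{t..<t + 2 * r}. kap k (u ! k) (u ! Suc k)) *
     (kap (t + 2 * r) (u ! (t + 2 * r)) (u ! Suc (t + 2 * r)) * kap (Suc (t + 2 * r)) (u ! Suc (t + 2 * r)) (u ! Suc (Suc (t + 2 * r))))"
    by (simp add: prod.atLeastLessThan_Suc)
  also have "\<dots> = (\<Prod>k\<in>{t..<t + 2 * r}. kap k (u ! k) (u ! Suc k)) / nY (u ! (t + 2 * r)) *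
     (om (u ! (t + 2 * r + 1)) (u ! (t + 2 * r)) * om (u ! (t + 2 * r + 1)) (u ! (t + 2 * r + 2)) / nZ (u ! (t + 2 * r + 1)))"
    by (simp add: kap_def Suc_diff_le)
  finally show ?case unfolding Suc.IH by (simp add: mult_ac)
qed

text \<open>Reversal exchanges the outgoing and the returning path of \<open>P\<close> and reverses
  the zigzag, whose weight is symmetric by \<open>prod_kap\<close>.\<close>

lemma mu_rv:
  assumes u: "u \<in> nlists V n2" shows "mu (rv u) = mu u"
proof (cases "u ! 0 = x")
  case False
  have "take (Suc t) v \<notin> P" if "v ! 0 \<noteq> x" for v
  proof
    assume "take (Suc t) v \<in> P"
    from P_len(3)[OF this] show False using that by simp
  qed
  then show ?thesis unfolding mu_def using False rv_props(3)[OF u] by simp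
next
  case True
  have len: "length u = n2" "length (rv u) = n2" using u rv_props(1)[OF u] by (auto simp: nlists_def)
  have drop_rv: "take (Suc t) (rv v) = x # rev (drop (t + 2 * m) v)" if v: "v \<in> nlists V n2" "v ! 0 = x" for v
  proof (rule nth_equalityI)
    have lv: "length v = n2" "length (rv v) = n2" using v(1) rv_props(1)[OF v(1)] by (auto simp: nlists_def)
    show "length (take (Suc t) (rv v)) = length (x # rev (drop (t + 2 * m) v))" using lv t_ge by (simp add: n2_def)
    fix i assume "i < length (take (Suc t) (rv v))"
    then have i: "i \<le> t" by simp
    show "take (Suc t) (rv v) ! i = (x # rev (drop (t + 2 * m) v)) ! i"
    proof (cases i)
      case 0
      then show ?thesis using rv_props(3)[OF v(1)] v(2) by simp
    next
      case (Suc j)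
      have "take (Suc t) (rv v) ! i = v ! (n2 - i)"
        using i Suc t_ge rv_props(4)[OF v(1), of i] by (simp add: n2_def)
      moreover have "rev (drop (t + 2 * m) v) ! j = drop (t + 2 * m) v ! (t - Suc j)"
        using i Suc lv by (subst rev_nth) (auto simp: n2_def)
      moreover have "drop (t + 2 * m) v ! (t - Suc j) = v ! (n2 - i)"
        using i Suc lv by (subst nth_drop) (auto simp: n2_def intro!: arg_cong[where f="nth v"])
      ultimately show ?thesis using Suc by simp
    qed
  qed
  have 1: "take (Suc t) (rv u) = x # rev (drop (t + 2 * m) u)" by (rule drop_rv[OF u True])
  have 2: "x # rev (drop (t + 2 * m) (rv u)) = take (Suc t) u"
    using drop_rv[OF rv_props(1)[OF u]] rv_props(2,3)[OF u] True by simp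
  have nth: "rv u ! k = u ! (n2 - k)" if "t \<le> k" "k \<le> t + 2 * m" for k
    using that t_ge by (intro rv_props(4)[OF u]) (auto simp: n2_def)
  have A: "(\<Prod>s<Suc m. nY (rv u ! (t + 2 * s))) = (\<Prod>s<Suc m. nY (u ! (t + 2 * s)))"
  proof -
    have "(\<Prod>s<Suc m. nY (rv u ! (t + 2 * s))) = (\<Prod>s<Suc m. nY (u ! (t + 2 * (Suc m - Suc s))))"
      by (rule prod.cong) (auto simp: nth n2_def intro!: arg_cong[where f="\<lambda>k. nY (u ! k)"])
    also have "\<dots> = (\<Prod>s<Suc m. nY (u ! (t + 2 * s)))"
      by (rule prod.nat_diff_reindex[of "\<lambda>s. nY (u ! (t + 2 * s))" "Suc m"])
    finally show ?thesis .
  qed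
  define g where "g v s = om (v ! (t + 2 * s + 1)) (v ! (t + 2 * s)) * om (v ! (t + 2 * s + 1)) (v ! (t + 2 * s + 2)) / nZ (v ! (t + 2 * s + 1))" for v s
  have B: "(\<Prod>s<m. g (rv u) s) = (\<Prod>s<m. g u s)"
  proof -
    have "(\<Prod>s<m. g (rv u) s) = (\<Prod>s<m. g u (m - Suc s))"
    proof (rule prod.cong[OF refl])
      fix s assume "s \<in> {..<m}"
      then have s: "s < m" by simp
      have "rv u ! (t + 2 * s) = u ! (t + 2 * (m - Suc s) + 2)" "rv u ! (t + 2 * s + 1) = u ! (t + 2 * (m - Suc s) + 1)"
        "rv u ! (t + 2 * s + 2) = u ! (t + 2 * (m - Suc s))"
        using s by (subst nth; auto simp: n2_def intro!: arg_cong[where f="nth u"])+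
      then show "g (rv u) s = g u (m - Suc s)" unfolding g_def by (simp add: mult.commute)
    qed
    also have "\<dots> = (\<Prod>s<m. g u s)" by (rule prod.nat_diff_reindex)
    finally show ?thesis .
  qed
  have "(\<Prod>k\<in>{t..<t + 2 * m}. kap k (rv u ! k) (rv u ! Suc k)) / nY (rv u ! (t + 2 * m)) =
     (\<Prod>k\<in>{t..<t + 2 * m}. kap k (u ! k) (u ! Suc k)) / nY (u ! (t + 2 * m))"
    unfolding prod_kap A B[unfolded g_def] ..
  then show ?thesis unfolding mu_def 1 2 by (simp only: conj_commute flip: times_divide_eq_right)
qed

text \<open>Half of the zigzag steps and the whole return run against the arcs, so adjacency holds
  only up to direction.\<close>

lemma mu_adjacent:
  assumes u: "u \<in> nlists V n2" and mu: "mu u \<noteq> 0" and k: "k < n2"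
  shows "u ! (Suc k mod n2) \<in> out (u ! k) \<or> u ! k \<in> out (u ! (Suc k mod n2))"
proof -
  have p: "take (Suc t) u \<in> P" "x # rev (drop (t + 2 * m) u) \<in> P" using mu unfolding mu_def by (auto split: if_splits)
  have len: "length u = n2" using u by (simp add: nlists_def)
  have early: "v ! Suc j \<in> out (v ! j)" if "j < t" "take (Suc t) v \<in> P" for j v
  proof -
    have "take (Suc t) v \<in> walks t x" using that P_walks by auto
    then have "take (Suc t) v ! Suc j \<in> out (take (Suc t) v ! j)" using that by (auto simp: walks_def)
    then show ?thesis using that by simp
  qed
  have x0: "u ! 0 = x" using P_len(3)[OF p(1)] by simp
  consider "k < t" | "t \<le> k" "k < t + 2 * m" | "t + 2 * m \<le> k" by linarith
  then show ?thesis
  proof cases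
    case 1
    then have "Suc k mod n2 = Suc k" using t_ge by (simp add: n2_def)
    then show ?thesis using early[OF 1 p(1)] by simp
  next
    case 2
    then have md: "Suc k mod n2 = Suc k" using t_ge by (simp add: n2_def)
    have "kap k (u ! k) (u ! Suc k) \<noteq> 0" using mu 2 unfolding mu_def by auto
    then have "om (u ! k) (u ! Suc k) \<noteq> 0 \<or> om (u ! Suc k) (u ! k) \<noteq> 0" unfolding kap_def by (auto split: if_splits)
    moreover have "y \<in> out z" if "om z y \<noteq> 0" for z y
    proof -
      have "{p \<in> P. p ! (t - 1) = z \<and> p ! t = y} \<noteq> {}" using that unfolding om_def by (metis card.empty of_nat_0)
      then obtain p where p: "p \<in> P" "p ! (t - 1) = z" "p ! t = y" by auto
      then have "p \<in> walks t x" using P_walks by auto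
      then have "\<forall>i<t. p ! Suc i \<in> out (p ! i)" by (auto simp: walks_def)
      then have "p ! Suc (t - 1) \<in> out (p ! (t - 1))" using t_ge by (metis Suc_le_lessD diff_less less_numeral_extra(1) numeral_2_eq_2 order_less_trans zero_less_Suc)
      then show ?thesis using p t_ge by simp
    qed
    ultimately show ?thesis unfolding md by auto
  next
    case 3
    define j where "j = n2 - Suc k"
    have j: "j < t" "k = n2 - Suc j" using 3 k unfolding j_def n2_def by auto
    have "take (Suc t) (rv u) \<in> P"
      using mu mu_rv[OF u] unfolding mu_def by (auto split: if_splits)
    from early[OF j(1) this] have *: "rv u ! Suc j \<in> out (rv u ! j)" .
    have "rv u ! Suc j = u ! k" using rv_props(4)[OF u, of "Suc j"] j t_ge by (simp add: n2_def)
    moreover have "rv u ! j = u ! (Suc k mod n2)"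
    proof (cases j)
      case 0
      then have "Suc k = n2" using k unfolding j_def by simp
      then show ?thesis using rv_props(3)[OF u] 0 by simp
    next
      case (Suc i)
      then have "Suc k < n2" "n2 - j = Suc k" using k unfolding j_def by auto
      then show ?thesis using rv_props(4)[OF u, of j] Suc j t_ge by (simp add: n2_def)
    qed
    ultimately show ?thesis using * by simp
  qed
qed

end

section \<open>Cycles avoiding a sparse family of edge sets\<close>

definition cyc_edge :: "'a list \<Rightarrow> nat \<Rightarrow> 'a set" where
  "cyc_edge u k = {u ! k, u ! (Suc k mod length u)}"

definition cyc_edges :: "'a list \<Rightarrow> 'a set set" where
  "cyc_edges u = cyc_edge u ` {..<length u}"

lemma inj_on_cyc_edge:
  assumes "distinct u" "3 \<le> length u"
  shows "inj_on (cyc_edge u) {..<length u}"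
proof (rule inj_onI)
  fix i j assume ij: "i \<in> {..<length u}" "j \<in> {..<length u}" "cyc_edge u i = cyc_edge u j"
  define n where "n = length u"
  have n: "i < n" "j < n" "3 \<le> n" using ij assms unfolding n_def by auto
  then have sn: "Suc i mod n < n" "Suc j mod n < n" by (simp_all add: mod_less_divisor)
  have Sm: "Suc i mod n = (if Suc i = n then 0 else Suc i)" "Suc j mod n = (if Suc j = n then 0 else Suc j)"
    using n by (auto simp: mod_Suc)
  have inj: "u ! a = u ! c \<Longrightarrow> a < n \<Longrightarrow> c < n \<Longrightarrow> a = c" for a c
    using assms(1) unfolding n_def by (simp add: nth_eq_iff_index_eq)
  have "u ! i = u ! j \<or> u ! i = u ! (Suc j mod n) \<and> u ! (Suc i mod n) = u ! j"
    using ij(3) unfolding cyc_edge_def n_def[symmetric] doubleton_eq_iff by auto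
  then have "i = j \<or> i = Suc j mod n \<and> Suc i mod n = j" 
    using inj[of i j] inj[of i "Suc j mod n"] inj[of "Suc i mod n" j] n sn by blast
  \<comment> \<open>Edges that agree with swapped ends would be successors of each other, impossible
    in length at least 3.\<close>
  moreover have "i = j" if "i = Suc j mod n" "Suc i mod n = j"
    using that n unfolding Sm by (simp split: if_splits)
  ultimately show "i = j" by auto
qed

section \<open>Union bound over edge patterns and coincidences\<close>

context zigzag
begin

lemma n2_ge: "4 \<le> n2" using t_ge by (simp add: n2_def)

text \<open>The edge at \<open>i\<close> is summed out by \<open>rho\<close>; a member of
  \<open>F\<close> through it is one of at most \<open>K\<close>; the vertex at each position of
  \<open>Z\<close> is one of the at most \<open>2 * n2\<close> vertices covered by that member, and
  prescribing it costs \<open>Q * cst k\<close>.\<close>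

lemma pattern_base:
  fixes K :: real
  assumes I: "I \<subseteq> {..<n2}" and iI: "i \<in> I" and i: "i < t + 2 * m" and Z: "Z \<subseteq> {i + 2..<n2}"
    and ZI: "\<And>k. k \<in> Z \<Longrightarrow> k \<in> I \<or> (1 \<le> k \<and> k - 1 \<in> I)"
    and F2: "\<And>J e. J \<in> F \<Longrightarrow> e \<in> J \<Longrightarrow> card e \<le> 2"
    and K: "\<And>e. finite {J \<in> F. card J = card I \<and> e \<in> J} \<and> real (card {J \<in> F. card J = card I \<and> e \<in> J}) \<le> K"
  shows "(\<Sum>u\<in>nlists V n2. if cyc_edge u ` I \<in> F \<and> card (cyc_edge u ` I) = card I then mu u else 0)
    \<le> K * real (2 * n2) ^ n2 * (Q * Q) * (\<Prod>k\<in>Z. Q * cst k)"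
proof -
  have K0: "0 \<le> K" by (rule order_trans[OF of_nat_0_le_iff conjunct2[OF K[of undefined]]])
  have finI: "finite I" using I finite_subset by blast
  have finZ: "finite Z" using Z finite_subset by blast
  have cI: "card I \<le> n2" "1 \<le> card I" using card_mono[OF _ I] iI finI by (auto simp: Suc_le_eq card_gt_0_iff)
  define FF where "FF e = {J \<in> F. card J = card I \<and> {fst e, snd e} \<in> J}" for e :: "'a \<times> 'a"
  define AA where "AA J = (PiE Z (\<lambda>_. \<Union>J))" for J :: "'a set set"
  have finFF: "finite (FF e)" for e unfolding FF_def using K by blast
  have J: "finite (\<Union>J)" "card (\<Union>J) \<le> 2 * n2" if "J \<in> FF e" "\<And>e. e \<in> J \<Longrightarrow> finite e" for e J
  proof -
    have fJ: "finite J" using that cI unfolding FF_def by (auto intro: card_ge_0_finite)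
    show "finite (\<Union>J)" using fJ that(2) by auto
    have "card (\<Union>J) \<le> (\<Sum>e\<in>J. card e)" by (rule card_Union_le_sum_card)
    also have "\<dots> \<le> (\<Sum>e\<in>J. 2)" by (rule sum_mono) (use F2 that FF_def in auto)
    finally show "card (\<Union>J) \<le> 2 * n2" using that cI unfolding FF_def by auto
  qed
  \<comment> \<open>The bound \<open>card e \<le> 2\<close> admits infinite \<open>e\<close>, whose
    \<open>card\<close> is 0. Members of \<open>F\<close> with such an edge are discarded; they
    never arise from a walk.\<close>
  define FF' where "FF' e = {J \<in> FF e. \<forall>e\<in>J. finite e}" for e
  have finFF': "finite (FF' e)" for e unfolding FF'_def using finFF by simp
  have cFF': "real (card (FF' e)) \<le> K" for e
  proof -
    have "card (FF' e) \<le> card (FF e)" unfolding FF'_def using finFF by (intro card_mono) auto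
    moreover have "real (card (FF e)) \<le> K" unfolding FF_def using K by blast
    ultimately show ?thesis by linarith
  qed
  have finAA: "finite (AA J)" "card (AA J) \<le> (2 * n2) ^ n2" if "J \<in> FF' e" for e J
  proof -
    have f: "finite (\<Union>J)" "card (\<Union>J) \<le> 2 * n2" using J[of J e] that unfolding FF'_def by auto
    show "finite (AA J)" unfolding AA_def using f finZ by (intro finite_PiE) auto
    have "card (AA J) = card (\<Union>J) ^ card Z" unfolding AA_def using finZ by (simp add: card_PiE)
    also have "\<dots> \<le> (2 * n2) ^ card Z" using f by (intro power_mono) auto
    also have "\<dots> \<le> (2 * n2) ^ n2"
    proof (rule power_increasing)
      have "card Z \<le> card {i + 2..<n2}" using Z by (intro card_mono) auto
      then show "card Z \<le> n2" by simp
    qed (use n2_ge in auto)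
    finally show "card (AA J) \<le> (2 * n2) ^ n2" .
  qed
  define T where "T = (SIGMA e:V \<times> V. SIGMA J:FF' e. AA J)"
  have finT: "finite T" unfolding T_def using finite_V finFF' finAA by (intro finite_SigmaI) auto
  define g where "g u = (\<lambda>(e, J::'a set set, a). if u ! i = fst e \<and> u ! Suc i = snd e \<and> (\<forall>k\<in>Z. u ! k = a k) then mu u else 0)" for u
  have g0: "0 \<le> g u \<tau>" for u \<tau> unfolding g_def using mu_nonneg by (auto split: prod.splits)
  have "(\<Sum>u\<in>nlists V n2. if cyc_edge u ` I \<in> F \<and> card (cyc_edge u ` I) = card I then mu u else 0)
    \<le> (\<Sum>u\<in>nlists V n2. \<Sum>\<tau>\<in>T. g u \<tau>)"
  proof (rule sum_mono)
    fix u assume u: "u \<in> nlists V n2"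
    show "(if cyc_edge u ` I \<in> F \<and> card (cyc_edge u ` I) = card I then mu u else 0) \<le> (\<Sum>\<tau>\<in>T. g u \<tau>)"
    proof (cases "cyc_edge u ` I \<in> F \<and> card (cyc_edge u ` I) = card I")
      case False
      then show ?thesis using g0 by (auto intro: sum_nonneg)
    next
      case True
      define Ju where "Ju = cyc_edge u ` I"
      have len: "length u = n2" "set u \<subseteq> V" using u by (auto simp: nlists_def)
      have Si: "Suc i < n2" using i t_ge by (simp add: n2_def)
      have e: "cyc_edge u i = {u ! i, u ! Suc i}" using Si len by (simp add: cyc_edge_def)
      then have "{u ! i, u ! Suc i} \<in> Ju" unfolding Ju_def using iI by force
      then have JF: "Ju \<in> FF' (u ! i, u ! Suc i)"
        using True unfolding FF'_def FF_def Ju_def by (auto simp: cyc_edge_def)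
      define a where "a = restrict (\<lambda>k. u ! k) Z"
      have "u ! k \<in> \<Union>Ju" if "k \<in> Z" for k
        using ZI[OF that]
      proof
        assume "k \<in> I"
        then show ?thesis unfolding Ju_def cyc_edge_def by auto
      next
        assume k: "1 \<le> k \<and> k - 1 \<in> I"
        have "Suc (k - 1) mod n2 = k" using k Z that by auto
        then have "u ! k \<in> cyc_edge u (k - 1)" unfolding cyc_edge_def len by simp
        then show ?thesis unfolding Ju_def using k by auto
      qed
      then have "a \<in> AA Ju" unfolding AA_def a_def by auto
      moreover have "u ! i \<in> V" "u ! Suc i \<in> V" using len Si nth_mem[of i u] nth_mem[of "Suc i" u] by auto
      ultimately have "((u ! i, u ! Suc i), Ju, a) \<in> T" unfolding T_def using JF by auto
      moreover have "g u ((u ! i, u ! Suc i), Ju, a) = mu u" unfolding g_def a_def by simp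
      ultimately have "mu u \<le> (\<Sum>\<tau>\<in>T. g u \<tau>)" using member_le_sum[of _ T "g u"] finT g0 by metis
      then show ?thesis using True by simp
    qed
  qed
  also have "\<dots> = (\<Sum>\<tau>\<in>T. \<Sum>u\<in>nlists V n2. g u \<tau>)" by (rule sum.swap)
  also have "\<dots> \<le> (\<Sum>(e, J, a)\<in>T. Q * Q * rho i (fst e) (snd e) * (\<Prod>k\<in>Z. Q * cst k))"
  proof (rule sum_mono)
    fix \<tau> assume "\<tau> \<in> T"
    obtain e J a where \<tau>: "\<tau> = (e, J, a)" by (cases \<tau>) auto
    show "(\<Sum>u\<in>nlists V n2. g u \<tau>) \<le> (case \<tau> of (e, J, a) \<Rightarrow> Q * Q * rho i (fst e) (snd e) * (\<Prod>k\<in>Z. Q * cst k))"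
      unfolding \<tau> g_def using spread[OF i Z, of "fst e" "snd e" a] by simp
  qed
  also have "\<dots> = (\<Sum>e\<in>V \<times> V. \<Sum>J\<in>FF' e. \<Sum>a\<in>AA J. Q * Q * rho i (fst e) (snd e) * (\<Prod>k\<in>Z. Q * cst k))"
  proof -
    have "(\<Sum>e\<in>V \<times> V. \<Sum>J\<in>FF' e. \<Sum>a\<in>AA J. Q * Q * rho i (fst e) (snd e) * (\<Prod>k\<in>Z. Q * cst k))
      = (\<Sum>e\<in>V \<times> V. \<Sum>(J, a)\<in>(SIGMA J:FF' e. AA J). Q * Q * rho i (fst e) (snd e) * (\<Prod>k\<in>Z. Q * cst k))"
      by (intro sum.cong refl sum.Sigma) (use finFF' finAA in auto)
    also have "\<dots> = (\<Sum>(e, J, a)\<in>T. Q * Q * rho i (fst e) (snd e) * (\<Prod>k\<in>Z. Q * cst k))"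
      unfolding T_def by (subst sum.Sigma) (use finite_V finFF' finAA in \<open>auto simp: split_def\<close>)
    finally show ?thesis by simp
  qed
  also have "\<dots> \<le> (\<Sum>e\<in>V \<times> V. K * real (2 * n2) ^ n2 * (Q * Q * rho i (fst e) (snd e) * (\<Prod>k\<in>Z. Q * cst k)))"
  proof (rule sum_mono)
    fix e
    define c where "c = Q * Q * rho i (fst e) (snd e) * (\<Prod>k\<in>Z. Q * cst k)"
    have c0: "0 \<le> c" unfolding c_def using Q_ge rho_nonneg cst_nonneg by (auto intro!: mult_nonneg_nonneg prod_nonneg)
    have "(\<Sum>J\<in>FF' e. \<Sum>a\<in>AA J. c) \<le> (\<Sum>J\<in>FF' e. real (2 * n2) ^ n2 * c)"
    proof (rule sum_mono)
      fix J assume "J \<in> FF' e"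
      from finAA(2)[OF this] have "real (card (AA J)) \<le> real ((2 * n2) ^ n2)" by (rule of_nat_mono)
      then show "(\<Sum>a\<in>AA J. c) \<le> real (2 * n2) ^ n2 * c" using c0 by (simp add: mult_right_mono)
    qed
    also have "\<dots> \<le> K * (real (2 * n2) ^ n2 * c)"
      using cFF'[of e] c0 by (simp add: mult_right_mono)
    finally show "(\<Sum>J\<in>FF' e. \<Sum>a\<in>AA J. c) \<le> K * real (2 * n2) ^ n2 * c" by (simp add: mult_ac)
  qed
  also have "\<dots> = (K * real (2 * n2) ^ n2 * (Q * Q) * (\<Prod>k\<in>Z. Q * cst k)) * (\<Sum>e\<in>V \<times> V. rho i (fst e) (snd e))"
    unfolding sum_distrib_left by (rule sum.cong) (auto simp: mult_ac)
  also have "\<dots> \<le> (K * real (2 * n2) ^ n2 * (Q * Q) * (\<Prod>k\<in>Z. Q * cst k)) * 1"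
  proof (rule mult_left_mono)
    show "(\<Sum>e\<in>V \<times> V. rho i (fst e) (snd e)) \<le> 1"
      using sum_rho_le[of i] by (simp add: sum.cartesian_product split_def)
    show "0 \<le> K * real (2 * n2) ^ n2 * (Q * Q) * (\<Prod>k\<in>Z. Q * cst k)"
      using K0 Q_ge cst_nonneg by (auto intro!: mult_nonneg_nonneg prod_nonneg)
  qed
  finally show ?thesis by simp
qed

lemma prod_cst_le:
  assumes "finite Z" shows "(\<Prod>k\<in>Z. Q * cst k) \<le> (Q * b) ^ card Z"
proof -
  have "(\<Prod>k\<in>Z. Q * cst k) \<le> (\<Prod>k\<in>Z. Q * b)"
    using Q_ge cst_nonneg cst_le by (intro prod_mono) (auto intro: mult_left_mono)
  then show ?thesis by simp
qed

text \<open>Beyond the edge at 0, the full cycle has \<open>t - 1\<close> outgoing positions at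
  price \<open>1 / \<delta>\<close>, \<open>t - 1\<close> returning ones at price \<open>b\<close>,
  and \<open>m\<close> double steps paying both.\<close>

lemma prod_cst_full: "(\<Prod>k\<in>{2..<n2}. Q * cst k) = Q ^ (n2 - 2) * (b / \<delta>) ^ (t + m - 1)"
proof -
  have mid: "(\<Prod>k\<in>{Suc t..<Suc t + 2 * r}. cst k) = (b / \<delta>) ^ r" if "r \<le> m" for r
    using that
  proof (induction r)
    case (Suc r)
    have "cst (Suc t + 2 * r) = b" "cst (Suc (Suc t + 2 * r)) = 1 / \<delta>"
      using Suc.prems unfolding cst_def by (auto simp: Suc_diff_le)
    then show ?case using Suc by (simp add: prod.atLeastLessThan_Suc)
  qed simp
  have 1: "(\<Prod>k\<in>{2..<Suc t}. cst k) = (1 / \<delta>) ^ (t - 1)"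
  proof -
    have "(\<Prod>k\<in>{2..<Suc t}. cst k) = (\<Prod>k\<in>{2..<Suc t}. 1 / real \<delta>)" by (rule prod.cong) (auto simp: cst_def)
    then show ?thesis using t_ge by (simp add: Suc_diff_le numeral_2_eq_2)
  qed
  have 3: "(\<Prod>k\<in>{Suc t + 2 * m..<n2}. cst k) = b ^ (t - 1)"
  proof -
    have "(\<Prod>k\<in>{Suc t + 2 * m..<n2}. cst k) = (\<Prod>k\<in>{Suc t + 2 * m..<n2}. b)"
      by (rule prod.cong) (auto simp: cst_def)
    then show ?thesis using t_ge by (simp add: n2_def)
  qed
  have "(\<Prod>k\<in>{2..<n2}. cst k) = (\<Prod>k\<in>{2..<Suc t}. cst k) * (\<Prod>k\<in>{Suc t..<Suc t + 2 * m}. cst k) * (\<Prod>k\<in>{Suc t + 2 * m..<n2}. cst k)"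
  proof -
    have "(\<Prod>k\<in>{2..<Suc t}. cst k) * (\<Prod>k\<in>{Suc t..<Suc t + 2 * m}. cst k) = (\<Prod>k\<in>{2..<Suc t + 2 * m}. cst k)"
      by (rule prod.atLeastLessThan_concat) (use t_ge in auto)
    moreover have "(\<Prod>k\<in>{2..<Suc t + 2 * m}. cst k) * (\<Prod>k\<in>{Suc t + 2 * m..<n2}. cst k) = (\<Prod>k\<in>{2..<n2}. cst k)"
      by (rule prod.atLeastLessThan_concat) (use t_ge in \<open>auto simp: n2_def\<close>)
    ultimately show ?thesis by simp
  qed
  also have "\<dots> = (1 / \<delta>) ^ (t - 1) * (b / \<delta>) ^ m * b ^ (t - 1)" using 1 3 mid[of m] by simp
  also have "\<dots> = (b / \<delta>) ^ (t - 1) * (b / \<delta>) ^ m" by (simp add: power_divide mult_ac)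
  also have "\<dots> = (b / \<delta>) ^ (t + m - 1)" using t_ge by (simp flip: power_add)
  finally show ?thesis by (simp add: prod.distrib)
qed

lemma cyc_edge_rv:
  assumes u: "u \<in> nlists V n2" and k: "k < n2"
  shows "cyc_edge (rv u) k = cyc_edge u (n2 - 1 - k)"
proof -
  have len: "length u = n2" "length (rv u) = n2" using u rv_props(1)[OF u] by (auto simp: nlists_def)
  have n: "4 \<le> n2" by (rule n2_ge)
  have a: "rv u ! k = u ! (Suc (n2 - 1 - k) mod n2)"
  proof (cases "k = 0")
    case True
    then show ?thesis using rv_props(3)[OF u] n by simp
  next
    case False
    then have "Suc (n2 - 1 - k) = n2 - k" "n2 - k < n2" using k by auto
    then show ?thesis using rv_props(4)[OF u, of k] False k by simp
  qed
  have c: "rv u ! (Suc k mod n2) = u ! (n2 - 1 - k)"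
  proof (cases "Suc k = n2")
    case True
    then have "n2 - 1 - k = 0" by simp
    then show ?thesis using rv_props(3)[OF u] True by simp
  next
    case False
    then have "Suc k < n2" using k by simp
    then show ?thesis using rv_props(4)[OF u, of "Suc k"] by simp
  qed
  show ?thesis unfolding cyc_edge_def len a c by auto
qed

text \<open>Patterns that can be explored in the given direction starting from their first edge; all others
  become forward when the cycle is reversed.\<close>

definition forward :: "nat set \<Rightarrow> bool" where
  "forward I \<longleftrightarrow> Min I < t + 2 * m \<and> (0 \<in> I \<or> n2 - 1 \<notin> I)"

text \<open>If \<open>I\<close> contains \<open>n2 - 1\<close> but not 0, its reversal contains 0.
  Otherwise \<open>I\<close> begins at or after \<open>t + 2 * m\<close>, inside the returning path;
  reversal makes this the outgoing path, and as 0 is not in \<open>I\<close> the reversal avoids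
  \<open>n2 - 1\<close>.\<close>

lemma forward_reverse:
  assumes I: "I \<subseteq> {..<n2}" "I \<noteq> {}" and nf: "\<not> forward I"
  shows "forward ((\<lambda>k. n2 - 1 - k) ` I)"
proof -
  let ?I = "(\<lambda>k. n2 - 1 - k) ` I"
  have finI: "finite I" using I finite_subset by blast
  have Mi: "Min I \<in> I" "\<And>k. k \<in> I \<Longrightarrow> Min I \<le> k" using finI I by auto
  show ?thesis
  proof (cases "0 \<notin> I \<and> n2 - 1 \<in> I")
    case True
    then have "n2 - 1 - (n2 - 1) \<in> ?I" by blast
    then have z: "0 \<in> ?I" by simp
    then have "Min ?I = 0" using finI by (metis Min_le finite_imageI le_zero_eq)
    then show ?thesis unfolding forward_def using z t_ge by simp
  next
    case False
    then have big: "t + 2 * m \<le> Min I" using nf unfolding forward_def by auto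
    have "Min ?I \<in> ?I" using finI I by (intro Min_in) auto
    then obtain k where k: "k \<in> I" "Min ?I = n2 - 1 - k" by auto
    have "t + 2 * m \<le> k" using big Mi(2)[OF k(1)] by simp
    then have "Min ?I < t + 2 * m" using k t_ge by (simp add: n2_def)
    moreover have "n2 - 1 \<notin> ?I"
    proof
      assume "n2 - 1 \<in> ?I"
      then obtain k where k: "k \<in> I" "n2 - 1 = n2 - 1 - k" by auto
      then have "k = 0" using I n2_ge by auto
      then show False using Mi(2)[OF k(1)] big t_ge by simp
    qed
    ultimately show ?thesis unfolding forward_def by simp
  qed
qed

text \<open>A pattern short of the full cycle forces at least one new vertex for each edge after the
  first, so the prices compensate \<open>\<beta> ^ (card I - 1)\<close> vertex by vertex. The full
  cycle forces one vertex less and relies on the separate hypothesis about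
  \<open>(b / \<delta>) ^ (t + m - 1)\<close>. In both cases at least one factor
  \<open>1 / M\<close> is left over.\<close>

lemma forward_pattern:
  fixes K M \<beta> :: real
  assumes I: "I \<subseteq> {..<n2}" and cI: "2 \<le> card I" and fw: "forward I"
    and F2: "\<And>J e. J \<in> F \<Longrightarrow> e \<in> J \<Longrightarrow> card e \<le> 2"
    and K: "\<And>e. finite {J \<in> F. card J = card I \<and> e \<in> J} \<and>
      real (card {J \<in> F. card J = card I \<and> e \<in> J}) \<le> K / (M * \<beta>) ^ (card I - 1)"
    and \<beta>: "b \<le> \<beta>" "(b / \<delta>) ^ (t + m - 1) \<le> \<beta> ^ (n2 - 1)" and M: "Q \<le> M" and K0: "0 \<le> K"
  shows "(\<Sum>u\<in>nlists V n2. if cyc_edge u ` I \<in> F \<and> card (cyc_edge u ` I) = card I then mu u else 0)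
    \<le> K * real (2 * n2) ^ n2 * Q ^ n2 / M"
proof -
  have finI: "finite I" using I finite_subset by blast
  have ne: "I \<noteq> {}" using cI by auto
  define i where "i = Min I"
  have iI: "i \<in> I" and imin: "\<And>k. k \<in> I \<Longrightarrow> i \<le> k" unfolding i_def using finI ne by auto
  have i: "i < t + 2 * m" using fw unfolding forward_def i_def by simp
  have pos: "0 < \<beta>" "0 < M" "0 < Q" using \<beta> b_pos M Q_ge by auto
  have cn: "card I \<le> n2" using card_mono[OF _ I] by simp
  define j where "j = card I"
  define C where "C = K * real (2 * n2) ^ n2"
  have C0: "0 \<le> C" unfolding C_def using K0 by simp
  show ?thesis
  proof (cases "I = {..<n2}")
    case True
    have "i = 0" using imin[of 0] True n2_ge by simp
    have "(\<Sum>u\<in>nlists V n2. if cyc_edge u ` I \<in> F \<and> card (cyc_edge u ` I) = card I then mu u else 0)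
      \<le> K / (M * \<beta>) ^ (card I - 1) * real (2 * n2) ^ n2 * (Q * Q) * (\<Prod>k\<in>{2..<n2}. Q * cst k)"
      by (rule pattern_base[OF I iI i _ _ _ K]) (use \<open>i = 0\<close> True F2 in auto)
    also have "\<dots> = C / (M * \<beta>) ^ (n2 - 1) * (Q * Q) * (Q ^ (n2 - 2) * (b / \<delta>) ^ (t + m - 1))"
      unfolding prod_cst_full C_def True by simp
    also have "\<dots> = C * (Q ^ n2 * (b / \<delta>) ^ (t + m - 1) / (M * \<beta>) ^ (n2 - 1))"
    proof -
      have "n2 = Suc (Suc (n2 - 2))" using n2_ge by simp
      then have "Q ^ n2 = Q * Q * Q ^ (n2 - 2)" by (metis power_Suc mult.assoc)
      then show ?thesis by simp
    qed
    also have "\<dots> \<le> C * (Q ^ n2 * \<beta> ^ (n2 - 1) / (M * \<beta>) ^ (n2 - 1))"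
      using \<beta> pos C0 by (intro mult_left_mono divide_right_mono) auto
    also have "\<dots> = C * (Q ^ n2 / M ^ (n2 - 1))" using pos by (simp add: power_mult_distrib)
    also have "\<dots> \<le> C * (Q ^ n2 / M)"
    proof -
      have "M ^ 1 \<le> M ^ (n2 - 1)" using M Q_ge n2_ge by (intro power_increasing) auto
      then show ?thesis using pos C0 by (intro mult_left_mono divide_left_mono) auto
    qed
    finally show ?thesis unfolding C_def by simp
  next
    case False
    \<comment> \<open>A missing edge \<open>g\<close> at which to cut the cycle. If the pattern does
      not start at 0, the last edge is missing and is chosen, so that nothing lies behind the
      cut.\<close>
    have "\<exists>g. g \<notin> I \<and> g < n2 \<and> (i = 0 \<or> g = n2 - 1)"
    proof (cases "n2 - 1 \<in> I")
      case True
      then have "0 \<in> I" using fw unfolding forward_def by auto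
      then have "i = 0" using imin by force
      then show ?thesis using False I by auto
    next
      case False
      then show ?thesis using n2_ge by auto
    qed
    then obtain g where g: "g \<notin> I" "g < n2" "i = 0 \<or> g = n2 - 1" by auto
    \<comment> \<open>Each edge is charged to its endpoint facing the cut: the far one before
      \<open>g\<close>, the near one after \<open>g\<close>. Because edge \<open>g\<close> is absent
      these endpoints are distinct, and they avoid positions \<open>i\<close> and
      \<open>Suc i\<close>.\<close>
    define h where "h k = (if k < g then Suc k else k)" for k
    define Z where "Z = h ` (I - {i})"
    have inj: "inj_on h (I - {i})"
    proof (rule inj_onI)
      fix k k' assume "k \<in> I - {i}" "k' \<in> I - {i}" "h k = h k'"
      then show "k = k'" using g(1) unfolding h_def by (cases "k < g"; cases "k' < g") (auto, (metis less_Suc_eq not_less_eq)+)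
    qed
    have cZ: "card Z = j - 1" unfolding Z_def card_image[OF inj] j_def using iI finI by simp
    have Z: "Z \<subseteq> {i + 2..<n2}"
    proof
      fix z assume "z \<in> Z"
      then obtain k where k: "k \<in> I" "k \<noteq> i" "z = h k" unfolding Z_def by auto
      have ki: "i < k" using imin[OF k(1)] k(2) by simp
      have kg: "k \<noteq> g" "k < n2" using k(1) g(1) I by auto
      show "z \<in> {i + 2..<n2}"
      proof (cases "k < g")
        case True
        then show ?thesis using k(3) ki g(2) unfolding h_def by simp
      next
        case False
        then have gk: "g < k" using kg by simp
        then have "i = 0" using g kg by auto
        then have "g \<noteq> 0" using g(1) iI by (metis)
        then show ?thesis using k(3) gk kg False \<open>i = 0\<close> unfolding h_def by simp
      qed
    qed
    have finZ: "finite Z" unfolding Z_def using finI by simp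
    have "(\<Sum>u\<in>nlists V n2. if cyc_edge u ` I \<in> F \<and> card (cyc_edge u ` I) = card I then mu u else 0)
      \<le> K / (M * \<beta>) ^ (card I - 1) * real (2 * n2) ^ n2 * (Q * Q) * (\<Prod>k\<in>Z. Q * cst k)"
      by (rule pattern_base[OF I iI i Z _ _ K]) (use F2 in \<open>auto simp: Z_def h_def split: if_splits\<close>)
    also have "\<dots> = C / (M * \<beta>) ^ (j - 1) * (Q * Q) * (\<Prod>k\<in>Z. Q * cst k)"
      unfolding C_def j_def by simp
    also have "\<dots> \<le> C / (M * \<beta>) ^ (j - 1) * (Q * Q) * (Q * b) ^ (j - 1)"
      using prod_cst_le[OF finZ] C0 pos unfolding cZ by (intro mult_left_mono) auto
    also have "\<dots> \<le> C / (M * \<beta>) ^ (j - 1) * (Q * Q) * (Q * \<beta>) ^ (j - 1)"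
      using \<beta> C0 pos b_pos by (intro mult_left_mono power_mono) auto
    also have "\<dots> = C * (Q * Q * (Q / M) ^ (j - 1))"
      using pos by (simp add: power_mult_distrib power_divide)
    also have "\<dots> \<le> C * (Q * Q * (Q / M))"
    proof -
      have "(Q / M) ^ (j - 1) \<le> (Q / M) ^ 1"
        using pos M cI unfolding j_def by (intro power_decreasing) auto
      then show ?thesis using C0 pos by (intro mult_left_mono) auto
    qed
    also have "\<dots> = C * (Q ^ 3 / M)" by (simp add: power3_eq_cube)
    also have "\<dots> \<le> C * (Q ^ n2 / M)"
    proof -
      have "Q ^ 3 \<le> Q ^ n2" using Q_ge n2_ge by (intro power_increasing) auto
      then show ?thesis using pos C0 by (intro mult_left_mono divide_right_mono) auto
    qed
    finally show ?thesis unfolding C_def by simp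
  qed
qed

text \<open>A pattern that is not forward becomes so when the closed walk is reversed, which
  preserves \<open>mu\<close>.\<close>

lemma pattern_bound:
  fixes K M \<beta> :: real
  assumes I: "I \<subseteq> {..<n2}" and cI: "2 \<le> card I"
    and F2: "\<And>J e. J \<in> F \<Longrightarrow> e \<in> J \<Longrightarrow> card e \<le> 2"
    and K: "\<And>e. finite {J \<in> F. card J = card I \<and> e \<in> J} \<and>
      real (card {J \<in> F. card J = card I \<and> e \<in> J}) \<le> K / (M * \<beta>) ^ (card I - 1)"
    and \<beta>: "b \<le> \<beta>" "(b / \<delta>) ^ (t + m - 1) \<le> \<beta> ^ (n2 - 1)" and M: "Q \<le> M" and K0: "0 \<le> K"
  shows "(\<Sum>u\<in>nlists V n2. if cyc_edge u ` I \<in> F \<and> card (cyc_edge u ` I) = card I then mu u else 0)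
    \<le> K * real (2 * n2) ^ n2 * Q ^ n2 / M"
proof (cases "forward I")
  case True
  then show ?thesis using F2 by (intro forward_pattern[OF I cI _ _ K \<beta> M K0]) auto
next
  case False
  let ?r = "\<lambda>k. n2 - 1 - k"
  have inj: "inj_on ?r I" 
  proof (rule inj_onI)
    fix k k' assume "k \<in> I" "k' \<in> I" "n2 - 1 - k = n2 - 1 - k'"
    moreover from this have "k < n2" "k' < n2" using I by auto
    ultimately show "k = k'" by simp
  qed
  have c: "card (?r ` I) = card I" by (rule card_image[OF inj])
  have I': "?r ` I \<subseteq> {..<n2}" using n2_ge by auto
  have fw: "forward (?r ` I)" by (rule forward_reverse[OF I _ False]) (use cI in auto)
  have "(\<Sum>u\<in>nlists V n2. if cyc_edge u ` I \<in> F \<and> card (cyc_edge u ` I) = card I then mu u else 0)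
    = (\<Sum>u\<in>nlists V n2. if cyc_edge (rv u) ` I \<in> F \<and> card (cyc_edge (rv u) ` I) = card I then mu (rv u) else 0)"
    by (rule sum_rv[symmetric])
  also have "\<dots> = (\<Sum>u\<in>nlists V n2. if cyc_edge u ` (?r ` I) \<in> F \<and> card (cyc_edge u ` (?r ` I)) = card (?r ` I) then mu u else 0)"
  proof (rule sum.cong[OF refl])
    fix u assume u: "u \<in> nlists V n2"
    have "cyc_edge (rv u) ` I = cyc_edge u ` (?r ` I)"
      unfolding image_image using cyc_edge_rv[OF u] I by (intro image_cong) auto
    then show "(if cyc_edge (rv u) ` I \<in> F \<and> card (cyc_edge (rv u) ` I) = card I then mu (rv u) else 0) =
      (if cyc_edge u ` (?r ` I) \<in> F \<and> card (cyc_edge u ` (?r ` I)) = card (?r ` I) then mu u else 0)"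
      using mu_rv[OF u] c by simp
  qed
  also have "\<dots> \<le> K * real (2 * n2) ^ n2 * Q ^ n2 / M"
    by (rule forward_pattern[OF I' _ fw _ _ \<beta> M K0]) (use K cI c F2 in auto)
  finally show ?thesis .
qed

text \<open>A coincidence is a special prescription: given the edge at \<open>i\<close>, position
  \<open>k\<close> must carry its first vertex.\<close>

lemma collision_forward:
  assumes "i < t + 2 * m" "i + 2 \<le> k" "k < n2"
  shows "(\<Sum>u\<in>nlists V n2. if u ! i = u ! k then mu u else 0) \<le> Q ^ 3 * b"
proof -
  have "(\<Sum>u\<in>nlists V n2. if u ! i = u ! k then mu u else 0) \<le>
    (\<Sum>u\<in>nlists V n2. \<Sum>e\<in>V \<times> V. if u ! i = fst e \<and> u ! Suc i = snd e \<and> (\<forall>k'\<in>{k}. u ! k' = fst e) then mu u else 0)"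
  proof (rule sum_mono)
    fix u assume u: "u \<in> nlists V n2"
    then have len: "length u = n2" "set u \<subseteq> V" by (auto simp: nlists_def)
    then have V: "(u ! i, u ! Suc i) \<in> V \<times> V" using assms nth_mem[of i u] nth_mem[of "Suc i" u] by auto
    let ?f = "\<lambda>e. if u ! i = fst e \<and> u ! Suc i = snd e \<and> (\<forall>k'\<in>{k}. u ! k' = fst e) then mu u else 0"
    have "?f (u ! i, u ! Suc i) \<le> (\<Sum>e\<in>V \<times> V. ?f e)"
      by (rule member_le_sum[OF V]) (use mu_nonneg finite_V in auto)
    then show "(if u ! i = u ! k then mu u else 0) \<le> (\<Sum>e\<in>V \<times> V. ?f e)"
      by (auto split: if_splits intro: sum_nonneg mu_nonneg)
  qed
  also have "\<dots> = (\<Sum>e\<in>V \<times> V. \<Sum>u\<in>nlists V n2. if u ! i = fst e \<and> u ! Suc i = snd e \<and> (\<forall>k'\<in>{k}. u ! k' = fst e) then mu u else 0)"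
    by (rule sum.swap)
  also have "\<dots> \<le> (\<Sum>e\<in>V \<times> V. Q * Q * rho i (fst e) (snd e) * (\<Prod>k\<in>{k}. Q * cst k))"
  proof (rule sum_mono)
    fix e :: "'a \<times> 'a"
    show "(\<Sum>u\<in>nlists V n2. if u ! i = fst e \<and> u ! Suc i = snd e \<and> (\<forall>k'\<in>{k}. u ! k' = fst e) then mu u else 0)
      \<le> Q * Q * rho i (fst e) (snd e) * (\<Prod>k\<in>{k}. Q * cst k)"
      by (rule spread[where a="\<lambda>_. fst e"]) (use assms in auto)
  qed
  also have "\<dots> = Q * Q * Q * cst k * (\<Sum>e\<in>V \<times> V. rho i (fst e) (snd e))"
    unfolding sum_distrib_left by (rule sum.cong) (auto simp: mult_ac)
  also have "\<dots> \<le> Q * Q * Q * cst k * 1"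
    using sum_rho_le[of i] Q_ge cst_nonneg by (intro mult_left_mono) (auto simp: sum.cartesian_product split_def)
  also have "\<dots> \<le> Q ^ 3 * b" using cst_le[of k] Q_ge by (simp add: power3_eq_cube mult_left_mono)
  finally show ?thesis .
qed

lemma collision:
  assumes ik: "i + 2 \<le> k" "k < n2"
  shows "(\<Sum>u\<in>nlists V n2. if u ! i = u ! k then mu u else 0) \<le> Q ^ 3 * b"
proof (cases "i < t + 2 * m")
  case True
  then show ?thesis using collision_forward assms by blast
next
  case False
  have "(\<Sum>u\<in>nlists V n2. if u ! i = u ! k then mu u else 0) = (\<Sum>u\<in>nlists V n2. if rv u ! i = rv u ! k then mu (rv u) else 0)"
    by (rule sum_rv[symmetric])
  also have "\<dots> = (\<Sum>u\<in>nlists V n2. if u ! (n2 - k) = u ! (n2 - i) then mu u else 0)"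
  proof (rule sum.cong[OF refl])
    fix u assume u: "u \<in> nlists V n2"
    show "(if rv u ! i = rv u ! k then mu (rv u) else 0) = (if u ! (n2 - k) = u ! (n2 - i) then mu u else 0)"
      using rv_props(4)[OF u, of i] rv_props(4)[OF u, of k] False assms t_ge mu_rv[OF u] by auto
  qed
  also have "\<dots> \<le> Q ^ 3 * b"
    by (rule collision_forward) (use False assms t_ge in \<open>auto simp: n2_def\<close>)
  finally show ?thesis .
qed

text \<open>The last two conditions on \<open>M\<close> make the mass of walks meeting
  \<open>F\<close> and the mass of walks with a coincidence at most \<open>1 / 4\<close> each: there
  are at most \<open>2 ^ n2\<close> patterns and \<open>n2 ^ 2\<close> pairs of positions.
  Consecutive positions cannot coincide by \<open>irr\<close>.\<close>

theorem avoiding_cycle: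
  fixes K M \<beta> :: real
  assumes F2: "\<And>J e. J \<in> F \<Longrightarrow> e \<in> J \<Longrightarrow> card e \<le> 2"
    and K: "\<And>j e. 2 \<le> j \<Longrightarrow> j \<le> n2 \<Longrightarrow> finite {J \<in> F. card J = j \<and> e \<in> J} \<and>
      real (card {J \<in> F. card J = j \<and> e \<in> J}) \<le> K / (M * \<beta>) ^ (j - 1)"
    and \<beta>: "b \<le> \<beta>" "(b / \<delta>) ^ (t + m - 1) \<le> \<beta> ^ (n2 - 1)" "M * \<beta> \<le> 1" and K0: "0 \<le> K"
    and M: "Q \<le> M" "4 * 2 ^ n2 * (K * real (2 * n2) ^ n2 * Q ^ n2) \<le> M" "4 * real n2 ^ 2 * Q ^ 3 \<le> M"
    and irr: "\<And>v. v \<in> V \<Longrightarrow> v \<notin> out v"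
  shows "\<exists>u\<in>nlists V n2. distinct u \<and> mu u \<noteq> 0 \<and> (\<forall>J\<subseteq>cyc_edges u. 2 \<le> card J \<longrightarrow> J \<notin> F)"
proof (rule ccontr)
  assume contra: "\<not> ?thesis"
  have Mpos: "0 < M" using M Q_ge by linarith
  have \<beta>pos: "0 < \<beta>" using \<beta> b_pos by simp
  define \<I> where "\<I> = {I. I \<subseteq> {..<n2} \<and> 2 \<le> card I}"
  define \<D> where "\<D> = {(i, k). i + 2 \<le> k \<and> k < n2}"
  have fin\<I>: "finite \<I>" "card \<I> \<le> 2 ^ n2"
  proof -
    have "\<I> \<subseteq> Pow {..<n2}" unfolding \<I>_def by auto
    then show "finite \<I>" "card \<I> \<le> 2 ^ n2"
      using finite_subset[of \<I> "Pow {..<n2}"] card_mono[of "Pow {..<n2}" \<I>] by (auto simp: card_Pow)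
  qed
  have fin\<D>: "finite \<D>" "card \<D> \<le> n2 ^ 2"
  proof -
    have "\<D> \<subseteq> {..<n2} \<times> {..<n2}" unfolding \<D>_def by auto
    then show "finite \<D>" "card \<D> \<le> n2 ^ 2"
      using finite_subset[of \<D> "{..<n2} \<times> {..<n2}"] card_mono[of "{..<n2} \<times> {..<n2}" \<D>]
      by (auto simp: power2_eq_square)
  qed
  define f where "f I u = (if cyc_edge u ` I \<in> F \<and> card (cyc_edge u ` I) = card I then mu u else 0)" for I u
  define g where "g = (\<lambda>(i, k) u. if u ! i = u ! k then mu u else 0)"
  have f0: "0 \<le> f I u" and g0: "0 \<le> g d u" for I d u unfolding f_def g_def using mu_nonneg by (auto split: prod.splits)
  have key: "mu u \<le> (\<Sum>I\<in>\<I>. f I u) + (\<Sum>d\<in>\<D>. g d u)" if u: "u \<in> nlists V n2" for u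
  proof (cases "mu u = 0")
    case True
    then show ?thesis using f0 g0 by (simp add: sum_nonneg)
  next
    case False
    have len: "length u = n2" "set u \<subseteq> V" using u by (auto simp: nlists_def)
    show ?thesis
    proof (cases "distinct u")
      case True
      then obtain J where J: "J \<subseteq> cyc_edges u" "2 \<le> card J" "J \<in> F" using contra u False by blast
      have inj: "inj_on (cyc_edge u) {..<n2}" using inj_on_cyc_edge[OF True] len n2_ge by auto
      obtain I where I: "I \<subseteq> {..<n2}" "J = cyc_edge u ` I"
        using J(1) len unfolding cyc_edges_def by (metis subset_imageE)
      have "card J = card I" unfolding I(2) by (rule card_image) (use inj I(1) inj_on_subset in blast)
      then have "I \<in> \<I>" "f I u = mu u" using J I unfolding \<I>_def f_def by auto
      then have "mu u \<le> (\<Sum>I\<in>\<I>. f I u)" using member_le_sum[of I \<I> "\<lambda>I. f I u"] f0 fin\<I> by auto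
      then show ?thesis using g0 by (simp add: sum_nonneg add_increasing2)
    next
      case nd: False
      then obtain i k where ik: "i < k" "k < n2" "u ! i = u ! k"
        unfolding distinct_conv_nth len by (metis nat_neq_iff)
      have "k \<noteq> Suc i"
      proof
        assume "k = Suc i"
        then have "Suc i mod n2 = k" using ik by simp
        then have "u ! k \<in> out (u ! i) \<or> u ! i \<in> out (u ! k)" using mu_adjacent[OF u False, of i] ik by simp
        moreover have "u ! k \<in> V" using len ik nth_mem[of k u] by auto
        ultimately show False using irr ik(3) by auto
      qed
      then have "(i, k) \<in> \<D>" using ik unfolding \<D>_def by auto
      moreover have "g (i, k) u = mu u" unfolding g_def using ik by simp
      ultimately have "mu u \<le> (\<Sum>d\<in>\<D>. g d u)" using member_le_sum[of "(i, k)" \<D> "\<lambda>d. g d u"] g0 fin\<D> by auto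
      then show ?thesis using f0 by (simp add: sum_nonneg add_increasing)
    qed
  qed
  have "1 = (\<Sum>u\<in>nlists V n2. mu u)" using sum_mu by simp
  also have "\<dots> \<le> (\<Sum>u\<in>nlists V n2. (\<Sum>I\<in>\<I>. f I u) + (\<Sum>d\<in>\<D>. g d u))" by (rule sum_mono) (rule key)
  also have "\<dots> = (\<Sum>I\<in>\<I>. \<Sum>u\<in>nlists V n2. f I u) + (\<Sum>d\<in>\<D>. \<Sum>u\<in>nlists V n2. g d u)"
    unfolding sum.distrib by (simp only: sum.swap[of _ \<I>] sum.swap[of _ \<D>])
  also have "\<dots> \<le> (\<Sum>I\<in>\<I>. K * real (2 * n2) ^ n2 * Q ^ n2 / M) + (\<Sum>d\<in>\<D>. Q ^ 3 * b)"
  proof (intro add_mono sum_mono)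
    fix I assume "I \<in> \<I>"
    then have I: "I \<subseteq> {..<n2}" "2 \<le> card I" "card I \<le> n2"
      unfolding \<I>_def using card_mono[of "{..<n2}" I] by auto
    show "(\<Sum>u\<in>nlists V n2. f I u) \<le> K * real (2 * n2) ^ n2 * Q ^ n2 / M"
      unfolding f_def by (rule pattern_bound[OF I(1,2) _ K[OF I(2,3)] \<beta>(1,2) M(1) K0]) (use F2 in auto)
  next
    fix d assume "d \<in> \<D>"
    then show "(\<Sum>u\<in>nlists V n2. g d u) \<le> Q ^ 3 * b"
      unfolding \<D>_def g_def using collision by auto
  qed
  also have "\<dots> \<le> 2 ^ n2 * (K * real (2 * n2) ^ n2 * Q ^ n2 / M) + real n2 ^ 2 * (Q ^ 3 * b)"
  proof -
    have "real (card \<I>) \<le> 2 ^ n2" "real (card \<D>) \<le> real n2 ^ 2"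
      using fin\<I>(2) fin\<D>(2) by (metis of_nat_le_iff of_nat_numeral of_nat_power)+
    then have "real (card \<I>) * (K * real (2 * n2) ^ n2 * Q ^ n2 / M) \<le> 2 ^ n2 * (K * real (2 * n2) ^ n2 * Q ^ n2 / M)"
      "real (card \<D>) * (Q ^ 3 * b) \<le> real n2 ^ 2 * (Q ^ 3 * b)"
      using K0 Q_ge Mpos b_pos by (intro mult_right_mono; simp)+
    then show ?thesis by simp
  qed
  also have "\<dots> \<le> 1 / 4 + 1 / 4"
  proof (rule add_mono)
    show "2 ^ n2 * (K * real (2 * n2) ^ n2 * Q ^ n2 / M) \<le> 1 / 4"
      using M(2) Mpos by (simp add: field_simps)
    have "b \<le> 1 / M" using \<beta> Mpos by (metis mult.commute order_trans pos_le_divide_eq mult_left_mono less_imp_le)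
    then have "real n2 ^ 2 * (Q ^ 3 * b) \<le> real n2 ^ 2 * (Q ^ 3 * (1 / M))"
      using Q_ge by (intro mult_left_mono) auto
    also have "\<dots> \<le> 1 / 4" using M(3) Mpos by (simp add: field_simps)
    finally show "real n2 ^ 2 * (Q ^ 3 * b) \<le> 1 / 4" .
  qed
  finally show False by simp
qed

end

text \<open>Equals \<open>16 / \<epsilon> 0\<close> for the thresholds \<open>\<epsilon>\<close> in
  \<open>exists_zigzag\<close>; as these increase, it dominates \<open>16 / \<epsilon> t\<close> for
  whichever length \<open>t\<close> is selected there.\<close>

definition spread_const :: "nat \<Rightarrow> real" where "spread_const l = 32 * (8 * real l ^ 2) ^ l"

lemma spread_const_ge: assumes "2 \<le> l" shows "1 \<le> spread_const l"
proof -
  have "1 \<le> 8 * real l ^ 2" using assms by (simp add: power2_eq_square mult_ge1_I)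
  then have "1 \<le> (8 * real l ^ 2) ^ l" by (rule one_le_power)
  then show ?thesis unfolding spread_const_def by simp
qed

section \<open>Concentrated walks of least length\<close>

context out_regular
begin

lemma Nw_1_le: "Nw 1 a y \<le> 1"
proof -
  have "{L \<in> walks 1 a. last L = y} \<subseteq> {[a, y]}"
    unfolding walks_def by (auto simp: length_Suc_conv numeral_2_eq_2)
  then have "card {L \<in> walks 1 a. last L = y} \<le> card {[a, y]}" by (intro card_mono) auto
  then show ?thesis unfolding Nw_def by simp
qed

lemma butlast_walk:
  assumes "L \<in> walks (Suc s) a" shows "butlast L \<in> walks s a"
proof -
  have len: "length L = Suc (Suc s)" using assms by (simp add: walks_def)
  have nth: "butlast L ! i = L ! i" if "i \<le> s" for i using that len by (simp add: nth_butlast)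
  have "set (butlast L) \<subseteq> V" using assms by (auto simp: walks_def dest: in_set_butlastD)
  moreover have "butlast L ! Suc i \<in> out (butlast L ! i)" if "i < s" for i
    using that nth[of i] nth[of "Suc i"] assms by (simp add: walks_def)
  ultimately show ?thesis using len nth[of 0] assms by (simp add: walks_def)
qed

text \<open>If each of the \<open>s - 1\<close> interior vertices of a walk is spread at scale
  \<open>b\<close>, about b^(1-s) walks join its ends; a pair is heavy when it has at least half as
  many.\<close>

definition heavy :: "real \<Rightarrow> nat \<Rightarrow> 'a \<Rightarrow> 'a \<Rightarrow> bool" where
  "heavy b s a y \<longleftrightarrow> 1 / 2 \<le> real (Nw s a y) * b ^ (s - 1)"

text \<open>By the choice of \<open>b\<close>, the number b^(1-l) is
  \<open>\<delta> ^ l / N\<close>. An endpoint that is not heavy receives at most half of that, and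
  there are at most \<open>N\<close> endpoints, so these absorb at most half of all walks.\<close>

lemma card_heavy_walks_ge:
  fixes b N :: real
  assumes "x \<in> V" "0 < b" "real (card V) \<le> N" "b ^ (l - 1) = N / real \<delta> ^ l"
  shows "real \<delta> ^ l / 2 \<le> real (card {L \<in> walks l x. heavy b l x (last L)})"
proof -
  have Npos: "0 < N" using assms finite_V by (metis card_gt_0_iff empty_iff less_le_trans of_nat_0_less_iff)
  have \<delta>p: "0 < real \<delta> ^ l" using \<delta>_pos by simp
  have light: "real (Nw l x y) \<le> real \<delta> ^ l / (2 * N)" if "\<not> heavy b l x y" for y
  proof -
    have "real (Nw l x y) * (N / real \<delta> ^ l) < 1 / 2" using that assms(4) unfolding heavy_def by simp
    then show ?thesis using Npos \<delta>p by (simp add: field_simps)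
  qed
  have g: "(\<Sum>y\<in>W. real (Nw l x y)) = real (card {L \<in> walks l x. last L \<in> W})" if "W \<subseteq> V" for W
  proof -
    have "(\<Sum>y\<in>W. sum (\<lambda>_. 1) {L \<in> {L \<in> walks l x. last L \<in> W}. last L = y}) = sum (\<lambda>_. 1::real) {L \<in> walks l x. last L \<in> W}"
      by (rule sum.group) (use finite_walks that finite_V finite_subset in auto)
    moreover have "{L \<in> {L \<in> walks l x. last L \<in> W}. last L = y} = {L \<in> walks l x. last L = y}" if "y \<in> W" for y
      using that by auto
    ultimately show ?thesis by (simp add: Nw_def)
  qed
  define W where "W = {y \<in> V. heavy b l x y}"
  define W' where "W' = {y \<in> V. \<not> heavy b l x y}"
  have "(\<Sum>y\<in>W. real (Nw l x y)) + (\<Sum>y\<in>W'. real (Nw l x y)) = (\<Sum>y\<in>V. real (Nw l x y))"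
  proof -
    have "W \<union> W' = V" "W \<inter> W' = {}" unfolding W_def W'_def by auto
    then show ?thesis using finite_V by (metis finite_Un sum.union_disjoint)
  qed
  also have "\<dots> = real \<delta> ^ l" using sum_Nw[OF assms(1), of l] by (metis of_nat_power of_nat_sum)
  finally have tot: "(\<Sum>y\<in>W. real (Nw l x y)) + (\<Sum>y\<in>W'. real (Nw l x y)) = real \<delta> ^ l" .
  have "(\<Sum>y\<in>W'. real (Nw l x y)) \<le> (\<Sum>y\<in>W'. real \<delta> ^ l / (2 * N))"
    by (rule sum_mono) (use light in \<open>auto simp: W'_def\<close>)
  also have "\<dots> = real (card W') * (real \<delta> ^ l / (2 * N))" by simp
  also have "\<dots> \<le> N * (real \<delta> ^ l / (2 * N))"
  proof (rule mult_right_mono)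
    have "card W' \<le> card V" unfolding W'_def using finite_V by (intro card_mono) auto
    then show "real (card W') \<le> N" using assms(3) by linarith
  qed (use Npos \<delta>p in auto)
  also have "\<dots> = real \<delta> ^ l / 2" using Npos by simp
  finally have "real \<delta> ^ l / 2 \<le> (\<Sum>y\<in>W. real (Nw l x y))" using tot by simp
  also have "\<dots> = real (card {L \<in> walks l x. last L \<in> W})" by (rule g) (auto simp: W_def)
  also have "{L \<in> walks l x. last L \<in> W} = {L \<in> walks l x. heavy b l x (last L)}"
    unfolding W_def using last_walk_in by auto
  finally show ?thesis .
qed

text \<open>By minimality of \<open>t\<close>, walks with a heavy shorter window are rare and can be
  deleted. \<open>peel_fibres\<close> then restores many extensions of each prefix and many paths to
  each endpoint. Spread is a comparison of counts: light windows allow few walks through prescribed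
  vertices, while a heavy endpoint keeps many paths.\<close>

lemma exists_zigzag:
  fixes b N :: real
  assumes l: "2 \<le> l" and "V \<noteq> {}" and b: "0 < b" and N: "real (card V) \<le> N" and bl: "b ^ (l - 1) = N / real \<delta> ^ l"
  shows "\<exists>t x P. 2 \<le> t \<and> t \<le> l \<and> zigzag V out \<delta> x t P b (spread_const l)"
proof -
  \<comment> \<open>Each further step multiplies the threshold by \<open>8 * l ^ 2\<close>. As there
    are at most \<open>l ^ 2\<close> windows, deleting all walks with a heavy shorter window costs
    at most the proportion \<open>\<epsilon> t / 8\<close>.\<close>
  define \<epsilon> where "\<epsilon> s = 1 / 2 * (1 / (8 * real l ^ 2)) ^ (l - s)" for s
  define q where "q = 8 * real l ^ 2"
  have q: "1 \<le> q" unfolding q_def using l by (simp add: power2_eq_square mult_ge1_I)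
  have \<epsilon>0: "0 < \<epsilon> s" for s unfolding \<epsilon>_def using l by simp
  have \<epsilon>Q: "16 \<le> spread_const l * \<epsilon> s" for s
  proof -
    have "spread_const l * \<epsilon> s = 16 * (q ^ l / q ^ (l - s))" unfolding spread_const_def \<epsilon>_def q_def by (simp add: power_divide)
    moreover have "q ^ (l - s) \<le> q ^ l" using q by (intro power_increasing) auto
    moreover have "0 < q ^ (l - s)" using q by simp
    ultimately show ?thesis by (simp add: field_simps)
  qed
  have \<epsilon>s: "\<epsilon> s \<le> \<epsilon> t / q" if "s < t" "t \<le> l" for s t
  proof -
    have "(1 / q) ^ (l - s) \<le> (1 / q) ^ Suc (l - t)" using q that by (intro power_decreasing) auto
    then show ?thesis unfolding \<epsilon>_def q_def[symmetric] by (simp add: mult.commute)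
  qed
  define H where "H s a = {L \<in> walks s a. heavy b s a (last L)}" for s a
  define good where "good t \<longleftrightarrow> 2 \<le> t \<and> (\<exists>x\<in>V. \<epsilon> t * real \<delta> ^ t \<le> real (card (H t x)))" for t
  have "good l"
  proof -
    obtain x where "x \<in> V" using assms(2) by auto
    then show ?thesis unfolding good_def H_def using card_heavy_walks_ge[OF _ b N bl] l by (auto simp: \<epsilon>_def)
  qed
  define t where "t = (LEAST t. good t)"
  have gt: "good t" unfolding t_def using \<open>good l\<close> by (rule LeastI)
  have tl: "t \<le> l" unfolding t_def using \<open>good l\<close> by (rule Least_le)
  have t2: "2 \<le> t" using gt unfolding good_def by simp
  obtain x where x: "x \<in> V" and Hx: "\<epsilon> t * real \<delta> ^ t \<le> real (card (H t x))" using gt unfolding good_def by auto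
  have small: "real (card (H s a)) \<le> \<epsilon> t / q * real \<delta> ^ s" if "2 \<le> s" "s < t" "a \<in> V" for s a
  proof -
    have "\<not> good s" using that(2) unfolding t_def by (rule not_less_Least)
    then have "real (card (H s a)) \<le> \<epsilon> s * real \<delta> ^ s" using that unfolding good_def by force
    also have "\<dots> \<le> \<epsilon> t / q * real \<delta> ^ s" using \<epsilon>s[OF that(2) tl] by (intro mult_right_mono) auto
    finally show ?thesis .
  qed
  define W where "W = {(i, s). 2 \<le> s \<and> s < t \<and> i + s \<le> t}"
  define Bd where "Bd = (\<lambda>(i, s). {L \<in> walks t x. heavy b s (L ! i) (L ! (i + s))})"
  define P0 where "P0 = H t x - (\<Union>w\<in>W. Bd w)"
  have W: "finite W" "card W \<le> l ^ 2"
  proof -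
    have sub: "W \<subseteq> {..<t} \<times> {..<t}" unfolding W_def by auto
    show "finite W" using finite_subset[OF sub] by simp
    have "card W \<le> t * t" using card_mono[OF _ sub] by simp
    also have "\<dots> \<le> l * l" using tl by (intro mult_mono) auto
    finally show "card W \<le> l ^ 2" by (simp add: power2_eq_square)
  qed
  have \<delta>t: "0 < real \<delta> ^ t" using \<delta>_pos by simp
  have cB: "real (card (\<Union>w\<in>W. Bd w)) \<le> \<epsilon> t / 8 * real \<delta> ^ t"
  proof -
    have "card (\<Union>w\<in>W. Bd w) \<le> (\<Sum>w\<in>W. card (Bd w))" by (rule card_UN_le[OF W(1)])
    then have "real (card (\<Union>w\<in>W. Bd w)) \<le> (\<Sum>w\<in>W. real (card (Bd w)))" by (metis of_nat_le_iff of_nat_sum)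
    also have "\<dots> \<le> (\<Sum>w\<in>W. \<epsilon> t / q * real \<delta> ^ t)"
    proof (rule sum_mono)
      fix w assume "w \<in> W"
      then obtain i s where w: "w = (i, s)" "2 \<le> s" "s < t" "i + s \<le> t" unfolding W_def by auto
      show "real (card (Bd w)) \<le> \<epsilon> t / q * real \<delta> ^ t"
        unfolding Bd_def w(1) prod.case
        using card_walks_filter_le[OF x w(4), of "heavy b s" "\<epsilon> t / q"] small[OF w(2,3)] by (simp add: H_def)
    qed
    also have "\<dots> = real (card W) * (\<epsilon> t / q * real \<delta> ^ t)" by simp
    also have "\<dots> \<le> real l ^ 2 * (\<epsilon> t / q * real \<delta> ^ t)"
    proof (rule mult_right_mono)
      show "real (card W) \<le> real l ^ 2" using W(2) by (metis of_nat_le_iff of_nat_power)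
      show "0 \<le> \<epsilon> t / q * real \<delta> ^ t" using \<epsilon>0[of t] q by simp
    qed
    also have "\<dots> = \<epsilon> t / 8 * real \<delta> ^ t" unfolding q_def using l by simp
    finally show ?thesis .
  qed
  have finH: "finite (H t x)" unfolding H_def using finite_walks by simp
  have cP0: "7 / 8 * (\<epsilon> t * real \<delta> ^ t) \<le> real (card P0)"
  proof -
    have "finite (\<Union>w\<in>W. Bd w)" using W(1) by (auto simp: Bd_def finite_walks)
    then have "card (H t x) - card (\<Union>w\<in>W. Bd w) \<le> card P0" unfolding P0_def by (rule diff_card_le_card_Diff)
    then have "real (card (H t x)) \<le> real (card P0) + real (card (\<Union>w\<in>W. Bd w))" by linarith
    then show ?thesis using Hx cB by linarith
  qed
  have P0w: "P0 \<subseteq> walks t x" unfolding P0_def H_def by auto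
  have finP0: "finite P0" using P0w finite_walks finite_subset by blast
  \<comment> \<open>Peeling costs at most \<open>\<epsilon> t / 8\<close> of all walks on either
    side: there are at most \<open>\<delta> ^ (t - 1)\<close> prefixes, and the numbers
    \<open>Nw t x y\<close> add up to \<open>\<delta> ^ t\<close>. So
    \<open>7 / 8 - 2 / 8 = 5 / 8\<close> of the proportion \<open>\<epsilon> t\<close>
    survives.\<close>
  obtain P where P: "P \<subseteq> P0"
    and Pf: "\<And>p. p \<in> P \<Longrightarrow> \<epsilon> t / 8 * \<delta> \<le> card {y \<in> P. butlast y = butlast p} \<and>
      \<epsilon> t / 8 * Nw t x (last p) \<le> card {y \<in> P. last y = last p}"
    and Pc: "real (card P0) - (\<Sum>v\<in>butlast ` P0. \<epsilon> t / 8 * \<delta>) - (\<Sum>y\<in>last ` P0. \<epsilon> t / 8 * Nw t x y) \<le> real (card P)"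
    using peel_fibres[OF finP0, of "\<lambda>_. \<epsilon> t / 8 * \<delta>" "\<lambda>y. \<epsilon> t / 8 * Nw t x y" butlast last] \<epsilon>0[of t]
    by (auto simp: less_imp_le)
  have s1: "(\<Sum>v\<in>butlast ` P0. \<epsilon> t / 8 * \<delta>) \<le> \<epsilon> t / 8 * real \<delta> ^ t"
  proof -
    have "butlast ` P0 \<subseteq> walks (t - 1) x" using P0w butlast_walk[of _ "t - 1" x] t2 by auto
    then have "card (butlast ` P0) \<le> \<delta> ^ (t - 1)" using card_mono[OF finite_walks] card_walks[OF x] by metis
    then have "real (card (butlast ` P0)) \<le> real \<delta> ^ (t - 1)" by (metis of_nat_le_iff of_nat_power)
    then have "real (card (butlast ` P0)) * (\<epsilon> t / 8 * \<delta>) \<le> real \<delta> ^ (t - 1) * (\<epsilon> t / 8 * \<delta>)"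
      using \<epsilon>0[of t] by (intro mult_right_mono) auto
    also have "\<dots> = \<epsilon> t / 8 * (real \<delta> * real \<delta> ^ (t - 1))" by simp
    also have "real \<delta> * real \<delta> ^ (t - 1) = real \<delta> ^ t" using t2 by (metis Suc_diff_1 less_le_trans power_Suc zero_less_numeral)
    finally show ?thesis by simp
  qed
  have s2: "(\<Sum>y\<in>last ` P0. \<epsilon> t / 8 * Nw t x y) \<le> \<epsilon> t / 8 * real \<delta> ^ t"
  proof -
    have "last ` P0 \<subseteq> V" using P0w last_walk_in by auto
    then have "(\<Sum>y\<in>last ` P0. \<epsilon> t / 8 * Nw t x y) \<le> (\<Sum>y\<in>V. \<epsilon> t / 8 * Nw t x y)"
      using finite_V \<epsilon>0[of t] by (intro sum_mono2) auto
    also have "\<dots> = \<epsilon> t / 8 * real (\<Sum>y\<in>V. Nw t x y)" by (simp add: sum_distrib_left)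
    finally show ?thesis using sum_Nw[OF x, of t] by simp
  qed
  have cP: "5 / 8 * (\<epsilon> t * real \<delta> ^ t) \<le> real (card P)" using Pc s1 s2 cP0 by linarith
  have Qpos: "0 < spread_const l" using spread_const_ge[OF l] by simp
  have "zigzag V out \<delta> x t P b (spread_const l)"
  proof (unfold_locales)
    show "2 \<le> t" "x \<in> V" "0 < b" "1 \<le> spread_const l" "P \<subseteq> walks t x" using t2 x b spread_const_ge[OF l] P P0w by auto
    show "P \<noteq> {}" using cP mult_pos_pos[OF \<epsilon>0[of t] \<delta>t] by auto
    \<comment> \<open>Out-neighbours lie in \<open>V\<close>, so \<open>\<delta> \<le> N\<close> and
      \<open>b ^ (l - 1) = N / \<delta> ^ l \<ge> (1 / \<delta>) ^ (l - 1)\<close>.\<close>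
    show "1 / real \<delta> \<le> b"
    proof (rule power_le_imp_le_base)
      have l1: "l = Suc (l - 1)" using l by simp
      have "card (out x) \<le> card V" using out_subset[OF x] finite_V by (intro card_mono) auto
      then have "real \<delta> \<le> N" using N card_out[OF x] by simp
      moreover have "real \<delta> ^ l = real \<delta> * real \<delta> ^ (l - 1)" using l1 by (metis power_Suc)
      ultimately have "(1 / real \<delta>) ^ (l - 1) \<le> N / real \<delta> ^ l"
        using \<delta>_pos by (simp add: power_divide field_simps)
      then show "(1 / real \<delta>) ^ Suc (l - 2) \<le> b ^ Suc (l - 2)" using bl l by (simp add: Suc_diff_Suc numeral_2_eq_2)
    qed (use b in auto)
    show "real \<delta> ^ t \<le> spread_const l * card P"
    proof -
      have "real \<delta> ^ t \<le> (spread_const l * \<epsilon> t) * (5 / 8 * real \<delta> ^ t)"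
      proof -
        have "16 * (5 / 8 * real \<delta> ^ t) \<le> (spread_const l * \<epsilon> t) * (5 / 8 * real \<delta> ^ t)"
          using \<epsilon>Q[of t] \<delta>t by (intro mult_right_mono) auto
        then show ?thesis using \<delta>t by linarith
      qed
      also have "\<dots> = spread_const l * (5 / 8 * (\<epsilon> t * real \<delta> ^ t))" by simp
      also have "\<dots> \<le> spread_const l * card P" using cP Qpos by (intro mult_left_mono) auto
      finally show ?thesis .
    qed
    show "real \<delta> \<le> spread_const l * card {q \<in> P. butlast q = butlast p}" if "p \<in> P" for p
    proof -
      have "16 * (1 / 8 * real \<delta>) \<le> (spread_const l * \<epsilon> t) * (1 / 8 * real \<delta>)"
        using \<epsilon>Q[of t] by (intro mult_right_mono) auto
      then have "real \<delta> \<le> spread_const l * (\<epsilon> t / 8 * \<delta>)" by simp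
      also have "\<dots> \<le> spread_const l * card {q \<in> P. butlast q = butlast p}"
        using Pf[OF that] Qpos by (intro mult_left_mono) auto
      finally show ?thesis .
    qed
    fix Z y a assume Z: "Z \<subseteq> {1..<t}" "Z \<noteq> {}"
    let ?S = "{p \<in> P. last p = y \<and> (\<forall>k\<in>Z. p ! k = a k)}"
    show "real (card ?S) \<le> spread_const l * b ^ card Z * card {p \<in> P. last p = y}"
    proof (cases "?S = {}")
      case True
      show ?thesis unfolding True using b Qpos by simp
    next
      case False
      \<comment> \<open>As \<open>p\<close> survived the deletion, every pair of its positions other
        than the two ends is light. Hence so are all pairs of prescribed vertices, since they lie on
        \<open>p\<close>.\<close>
      then obtain p where p: "p \<in> P" "last p = y" "\<And>k. k \<in> Z \<Longrightarrow> p ! k = a k" by auto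
      have pw: "p \<in> walks t x" using p P P0w by auto
      have p0: "p ! 0 = x" "last p = p ! t" using pw last_walk by (auto simp: walks_def)
      have pP0: "p \<in> P0" using p P by auto
      have light: "real (Nw (j - i) (p ! i) (p ! j)) * b ^ (j - i - 1) \<le> 1"
        if ij: "i < j" "j \<le> t" "(i, j) \<noteq> (0, t)" for i j
      proof (cases "j - i = 1")
        case True
        then show ?thesis using Nw_1_le[of "p ! i" "p ! j"] by simp
      next
        case False
        then have "(i, j - i) \<in> W" unfolding W_def using ij by auto
        then have "p \<notin> Bd (i, j - i)" using pP0 unfolding P0_def by auto
        then have "\<not> heavy b (j - i) (p ! i) (p ! j)" unfolding Bd_def using pw ij by auto
        then show ?thesis unfolding heavy_def by linarith
      qed
      have "real (card {L \<in> walks t (p ! 0). last L = p ! t \<and> (\<forall>k\<in>Z. L ! k = p ! k)}) * b ^ (t - 1 - card Z) \<le> 1"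
      proof (rule card_walks_through_le[OF b Z(1)])
        show "1 \<le> t" using t2 by simp
        fix i j assume "i \<in> insert 0 Z" "j \<in> insert t Z" "i < j" "Z = {} \<or> (i, j) \<noteq> (0, t)"
        then show "real (Nw (j - i) (p ! i) (p ! j)) * b ^ (j - i - 1) \<le> 1"
          using Z by (intro light) auto
      qed
      moreover have "card ?S \<le> card {L \<in> walks t (p ! 0). last L = p ! t \<and> (\<forall>k\<in>Z. L ! k = p ! k)}"
        using p p0 P P0w by (intro card_mono) (auto simp: finite_walks)
      ultimately have S1: "real (card ?S) * b ^ (t - 1 - card Z) \<le> 1"
        using b by (meson less_imp_le mult_right_mono of_nat_le_iff order_trans zero_le_power)
      have "card Z \<le> card {1..<t}" using Z by (intro card_mono) auto
      then have "t - 1 = (t - 1 - card Z) + card Z" by simp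
      then have pw: "b ^ (t - 1) = b ^ (t - 1 - card Z) * b ^ card Z" by (metis power_add)
      have "heavy b t x y" using pP0 p(2) unfolding P0_def H_def by auto
      then have "1 / 2 \<le> real (Nw t x y) * b ^ (t - 1)" unfolding heavy_def .
      then have "1 / 2 * (\<epsilon> t / 8) \<le> (\<epsilon> t / 8 * Nw t x y) * b ^ (t - 1)"
        using \<epsilon>0[of t] by (simp add: field_simps)
      also have "\<dots> \<le> card {p \<in> P. last p = y} * b ^ (t - 1)"
        using Pf[OF p(1)] p(2) b by (intro mult_right_mono) auto
      finally have "\<epsilon> t \<le> 16 * (card {p \<in> P. last p = y} * b ^ (t - 1))" by simp
      then have "spread_const l * \<epsilon> t \<le> spread_const l * (16 * (card {p \<in> P. last p = y} * b ^ (t - 1)))"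
        using Qpos by (intro mult_left_mono) auto
      then have "1 \<le> spread_const l * (card {p \<in> P. last p = y} * b ^ (t - 1))" using \<epsilon>Q[of t] by linarith
      then have "real (card ?S) * b ^ (t - 1 - card Z) \<le> spread_const l * (card {p \<in> P. last p = y} * b ^ (t - 1))" using S1 by linarith
      also have "\<dots> = (spread_const l * b ^ card Z * card {p \<in> P. last p = y}) * b ^ (t - 1 - card Z)" unfolding pw by simp
      finally show ?thesis using b by (simp add: mult_le_cancel_right)
    qed
  qed
  then show ?thesis using t2 tl by blast
qed

text \<open>With \<open>m = l - t\<close> double steps the closed walk has \<open>2 * l\<close>
  vertices whatever \<open>t\<close> turns out to be. \<open>N\<close> may exceed
  \<open>card V\<close>: in the application the walk lives in a subgraph, while \<open>b\<close> is
  computed from the whole vertex set.\<close>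

theorem robust_cycle:
  fixes K M \<beta> b N :: real
  assumes l: "2 \<le> l" and "V \<noteq> {}" and b: "0 < b" and N: "real (card V) \<le> N" and bl: "b ^ (l - 1) = N / real \<delta> ^ l"
    and F2: "\<And>J e. J \<in> F \<Longrightarrow> e \<in> J \<Longrightarrow> card e \<le> 2"
    and K: "\<And>j e. 2 \<le> j \<Longrightarrow> j \<le> 2 * l \<Longrightarrow> finite {J \<in> F. card J = j \<and> e \<in> J} \<and>
      real (card {J \<in> F. card J = j \<and> e \<in> J}) \<le> K / (M * \<beta>) ^ (j - 1)"
    and \<beta>: "b \<le> \<beta>" "(b / \<delta>) ^ (l - 1) \<le> \<beta> ^ (2 * l - 1)" "M * \<beta> \<le> 1" and K0: "0 \<le> K"
    and M: "spread_const l \<le> M" "4 * 2 ^ (2 * l) * (K * real (4 * l) ^ (2 * l) * spread_const l ^ (2 * l)) \<le> M"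
      "4 * real (2 * l) ^ 2 * spread_const l ^ 3 \<le> M"
    and irr: "\<And>v. v \<in> V \<Longrightarrow> v \<notin> out v"
  shows "\<exists>u\<in>nlists V (2 * l). distinct u \<and>
    (\<forall>k<2 * l. u ! (Suc k mod (2 * l)) \<in> out (u ! k) \<or> u ! k \<in> out (u ! (Suc k mod (2 * l)))) \<and>
    (\<forall>J\<subseteq>cyc_edges u. 2 \<le> card J \<longrightarrow> J \<notin> F)"
proof -
  obtain t x P where t: "2 \<le> t" "t \<le> l" and z: "zigzag V out \<delta> x t P b (spread_const l)"
    using exists_zigzag[OF l assms(2) b N bl] by blast
  define m where "m = l - t"
  interpret zigzag V out \<delta> x t m P b "spread_const l" by (rule z)
  have n2: "n2 = 2 * l" unfolding n2_def using t by (simp add: m_def)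
  have tm: "t + m = l" unfolding m_def using t by simp
  have "\<exists>u\<in>nlists V n2. distinct u \<and> mu u \<noteq> 0 \<and> (\<forall>J\<subseteq>cyc_edges u. 2 \<le> card J \<longrightarrow> J \<notin> F)"
    by (rule avoiding_cycle[where K=K and M=M and \<beta>=\<beta>, OF _ _ \<beta>(1) _ \<beta>(3) K0 M(1)])
      (use assms in \<open>auto simp: n2 tm\<close>)
  then show ?thesis using mu_adjacent n2 by metis
qed

end

section \<open>Balanced families of graph cycles\<close>

text \<open>Maximise the number of edges inside \<open>W\<close> minus
  \<open>\<delta> * card W\<close>. Removing a vertex from a maximiser gains nothing, so every
  degree is at least \<open>\<delta>\<close>; the maximum is positive, so \<open>W\<close> is
  nonempty.\<close>

lemma min_degree_subgraph:
  fixes \<delta> :: nat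
  assumes "finite V" and E: "\<And>e. e \<in> E \<Longrightarrow> e \<subseteq> V \<and> card e = 2" and big: "card V * \<delta> < card E"
  shows "\<exists>W\<subseteq>V. W \<noteq> {} \<and> (\<forall>v\<in>W. \<delta> \<le> card {w \<in> W. w \<noteq> v \<and> {v, w} \<in> E})"
proof -
  have finE: "finite E" using big by (intro card_ge_0_finite) simp
  define \<Phi> where "\<Phi> W = int (card {e \<in> E. e \<subseteq> W}) - int (\<delta> * card W)" for W
  have "Max (\<Phi> ` Pow V) \<in> \<Phi> ` Pow V" using assms(1) by (intro Max_in) auto
  then obtain W where W: "W \<subseteq> V" and eq: "\<Phi> W = Max (\<Phi> ` Pow V)" by auto
  have max: "\<Phi> T \<le> \<Phi> W" if "T \<subseteq> V" for T unfolding eq using assms(1) that by simp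
  have finW: "finite W" using W assms(1) finite_subset by blast
  have "{e \<in> E. e \<subseteq> V} = E" using E by auto
  then have "0 < \<Phi> V" unfolding \<Phi>_def using big by (simp add: mult.commute flip: of_nat_mult)
  then have pos: "0 < \<Phi> W" using max[of V] by simp
  have "W \<noteq> {}"
  proof
    assume "W = {}"
    then have e0: "{e \<in> E. e \<subseteq> W} = {}" using E by force
    have "0 \<le> int (\<delta> * card W)" by (rule of_nat_0_le_iff)
    then show False using pos unfolding \<Phi>_def e0 card.empty by linarith
  qed
  moreover have "\<delta> \<le> card {w \<in> W. w \<noteq> v \<and> {v, w} \<in> E}" if v: "v \<in> W" for v
  proof -
    have "{e \<in> E. e \<subseteq> W} = {e \<in> E. e \<subseteq> W - {v}} \<union> {e \<in> E. e \<subseteq> W \<and> v \<in> e}" by auto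
    moreover have "{e \<in> E. e \<subseteq> W - {v}} \<inter> {e \<in> E. e \<subseteq> W \<and> v \<in> e} = {}" by auto
    ultimately have c1: "card {e \<in> E. e \<subseteq> W} = card {e \<in> E. e \<subseteq> W - {v}} + card {e \<in> E. e \<subseteq> W \<and> v \<in> e}"
      using finE by (simp add: card_Un_disjoint)
    have "{e \<in> E. e \<subseteq> W \<and> v \<in> e} \<subseteq> (\<lambda>w. {v, w}) ` {w \<in> W. w \<noteq> v \<and> {v, w} \<in> E}"
    proof
      fix e assume e: "e \<in> {e \<in> E. e \<subseteq> W \<and> v \<in> e}"
      then obtain a c where ac: "e = {a, c}" "a \<noteq> c" using E by (metis (no_types, lifting) card_2_iff mem_Collect_eq)
      then consider "v = a" | "v = c" using e by auto
      then show "e \<in> (\<lambda>w. {v, w}) ` {w \<in> W. w \<noteq> v \<and> {v, w} \<in> E}"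
      proof cases
        case 1 then show ?thesis using e ac by auto
      next
        case 2 then show ?thesis using e ac by (intro image_eqI[of _ _ a]) (auto simp: insert_commute)
      qed
    qed
    then have c2: "card {e \<in> E. e \<subseteq> W \<and> v \<in> e} \<le> card {w \<in> W. w \<noteq> v \<and> {v, w} \<in> E}"
      using finW by (intro surj_card_le) auto
    have c3: "card W = Suc (card (W - {v}))" using finW v by (metis card_Suc_Diff1)
    have "\<Phi> (W - {v}) \<le> \<Phi> W" using max[of "W - {v}"] W by auto
    then have "\<delta> \<le> card {e \<in> E. e \<subseteq> W \<and> v \<in> e}" unfolding \<Phi>_def c1 c3 by simp
    then show ?thesis using c2 by linarith
  qed
  ultimately show ?thesis using W by blast
qed

text \<open>The sum of the three lower bounds that \<open>robust_cycle\<close> demands of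
  \<open>M\<close> when \<open>K = 2 * 2 ^ (2 * l)\<close>.\<close>

definition cap_const :: "nat \<Rightarrow> real" where
  "cap_const l = spread_const l + 4 * 2 ^ (2 * l) * (2 * 2 ^ (2 * l) * real (4 * l) ^ (2 * l) * spread_const l ^ (2 * l)) + 4 * real (2 * l) ^ 2 * spread_const l ^ 3"

lemma cap_const_ge: assumes "2 \<le> l"
  shows "1 \<le> cap_const l" "spread_const l \<le> cap_const l"
    "4 * 2 ^ (2 * l) * (2 * 2 ^ (2 * l) * real (4 * l) ^ (2 * l) * spread_const l ^ (2 * l)) \<le> cap_const l"
    "4 * real (2 * l) ^ 2 * spread_const l ^ 3 \<le> cap_const l"
proof -
  have "0 \<le> 4 * 2 ^ (2 * l) * (2 * 2 ^ (2 * l) * real (4 * l) ^ (2 * l) * spread_const l ^ (2 * l))"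
    "0 \<le> 4 * real (2 * l) ^ 2 * spread_const l ^ 3" "1 \<le> spread_const l" using spread_const_ge[OF assms] by auto
  then show "1 \<le> cap_const l" "spread_const l \<le> cap_const l"
    "4 * 2 ^ (2 * l) * (2 * 2 ^ (2 * l) * real (4 * l) ^ (2 * l) * spread_const l ^ (2 * l)) \<le> cap_const l"
    "4 * real (2 * l) ^ 2 * spread_const l ^ 3 \<le> cap_const l" unfolding cap_const_def by linarith+
qed

text \<open>Saturation with caps forming a geometric progression of ratio \<open>1 / B\<close>.
  Saturated single edges are deleted first; they number less than \<open>card V * \<delta>\<close>,
  so enough edges remain for minimum degree \<open>\<delta>\<close>. The cap on single edges then
  limits the saturated \<open>j\<close>-sets at an edge to a constant times
  \<open>D 1 / D j\<close>, the form that \<open>robust_cycle\<close> asks for.\<close>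

theorem balanced_graph_cycles:
  fixes V :: "'a set" and b \<beta> :: real
  assumes l: "2 \<le> l" and "finite V" and E: "\<And>e. e \<in> E \<Longrightarrow> e \<subseteq> V \<and> card e = 2"
    and \<delta>: "0 < \<delta>" and big: "2 * card V * \<delta> \<le> card E"
    and b: "0 < b" "b ^ (l - 1) = real (card V) / real \<delta> ^ l" "b \<le> \<beta>"
    and \<beta>: "real (card V) / real \<delta> ^ (2 * l - 1) \<le> \<beta> ^ (2 * l - 1)" "cap_const l * \<beta> \<le> 1"
  shows "\<exists>S. S \<noteq> {} \<and> finite S \<and> (\<forall>C\<in>S. \<exists>u. distinct u \<and> length u = 2 * l \<and> C = cyc_edges u \<and> C \<subseteq> E) \<and>
    (\<forall>J. card J \<in> {1..2 * l} \<longrightarrow> real (cdeg S J) \<le>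
      2 * 2 ^ (2 * l) * real (card S) / (real (card V) * \<delta>) * (cap_const l * \<beta>) ^ (card J - 1))"
proof -
  have finE: "finite E" using E assms(2) by (meson PowI finite_Pow_iff finite_subset subsetI)
  define B where "B = cap_const l * \<beta>"
  have B: "0 < B" "B \<le> 1" unfolding B_def using cap_const_ge(1)[OF l] b \<beta> by (auto intro!: mult_pos_pos)
  define n where "n = card V"
  have npos: "0 < n"
  proof (rule ccontr)
    assume "\<not> 0 < n"
    then have "b ^ (l - 1) = 0" using b(2) unfolding n_def by simp
    then show False using b(1) by simp
  qed
  define D where "D j = (1 / B) ^ (2 * l - j)" for j
  have D1: "1 \<le> D j" for j unfolding D_def using B by (intro one_le_power) auto
  have Dj: "D 1 = D j * (1 / B) ^ (j - 1)" if "j \<in> {1..2 * l}" for j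
  proof -
    have "2 * l - 1 = (2 * l - j) + (j - 1)" using that by auto
    then show ?thesis unfolding D_def by (metis power_add)
  qed
  define U where "U = {C. C \<subseteq> E \<and> (\<exists>u. distinct u \<and> length u = 2 * l \<and> C = cyc_edges u)}"
  have U: "finite C \<and> card C = 2 * l" if "C \<in> U" for C
  proof -
    obtain u where u: "distinct u" "length u = 2 * l" "C = cyc_edges u" using \<open>C \<in> U\<close> unfolding U_def by auto
    then show ?thesis unfolding cyc_edges_def using card_image[OF inj_on_cyc_edge[OF u(1)]] l by simp
  qed
  define Nn where "Nn = real n * \<delta> * D 1 / (2 * 2 ^ (2 * l))"
  have "\<exists>S\<subseteq>U. (\<forall>J. card J \<in> {1..2 * l} \<longrightarrow> real (cdeg S J) \<le> D (card J)) \<and> Nn \<le> real (card S)"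
  proof (rule saturation)
    show "finite U" unfolding U_def using finE by simp
    show "\<And>C. C \<in> U \<Longrightarrow> finite C \<and> card C = 2 * l" by (rule U)
    show "1 \<le> 2 * l" using l by simp
    show "\<And>j. 1 \<le> D j" by (rule D1)
    show "D (2 * l) = 1" unfolding D_def by simp
    fix S assume S: "S \<subseteq> U" and cap: "\<And>J. card J \<in> {1..2 * l} \<Longrightarrow> real (cdeg S J) \<le> D (card J)"
      and small: "real (card S) < Nn"
    have finS: "finite S" using S finE unfolding U_def by (auto intro: finite_subset[of _ "Pow E"])
    have SU: "finite C \<and> card C = 2 * l" if "C \<in> S" for C using U S that by auto
    define X where "X = {e \<in> E. D 1 < real (cdeg S {e}) + 1}"
    have "card ((\<lambda>e. {e}) ` X) = card X" by (rule card_image) (simp add: inj_on_def)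
    moreover have "real (card ((\<lambda>e. {e}) ` X)) * D 1 \<le> 2 * 2 ^ (2 * l) * real (card S)"
      by (rule card_saturated_le[OF _ finS SU]) (use finE D1 in \<open>auto simp: X_def\<close>)
    ultimately have "real (card X) * D 1 \<le> 2 * 2 ^ (2 * l) * real (card S)" by simp
    also have "\<dots> < 2 * 2 ^ (2 * l) * Nn" using small by simp
    also have "\<dots> = real (n * \<delta>) * D 1" unfolding Nn_def by simp
    finally have "real (card X) < real (n * \<delta>)" using D1[of 1] mult_less_cancel_right_pos[of "D 1"] by auto
    then have cX: "card X < n * \<delta>" by (rule of_nat_less_imp_less)
    have "X \<subseteq> E" unfolding X_def by auto
    then have "card (E - X) = card E - card X" using finE by (meson card_Diff_subset finite_subset)
    then have "card V * \<delta> < card (E - X)" using cX big unfolding n_def by linarith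
    then obtain W where W: "W \<subseteq> V" "W \<noteq> {}" "\<And>v. v \<in> W \<Longrightarrow> \<delta> \<le> card {w \<in> W. w \<noteq> v \<and> {v, w} \<in> E - X}"
      using min_degree_subgraph[OF assms(2), of "E - X" \<delta>] E by blast
    \<comment> \<open>Neighbourhoods are cut down to exactly \<open>\<delta>\<close> vertices, so
      that all walks of one length are equally likely.\<close>
    have "\<exists>T. T \<subseteq> {w \<in> W. w \<noteq> v \<and> {v, w} \<in> E - X} \<and> card T = \<delta>" if "v \<in> W" for v
      using W(3)[OF that] by (meson obtain_subset_with_card_n)
    then have "\<forall>v\<in>W. \<exists>T. T \<subseteq> {w \<in> W. w \<noteq> v \<and> {v, w} \<in> E - X} \<and> card T = \<delta>" by blast
    from bchoice[OF this] obtain out where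
      out: "\<And>v. v \<in> W \<Longrightarrow> out v \<subseteq> {w \<in> W. w \<noteq> v \<and> {v, w} \<in> E - X} \<and> card (out v) = \<delta>" by blast
    interpret out_regular W out \<delta>
    proof
      show "finite W" using W(1) assms(2) by (rule finite_subset)
      show "out v \<subseteq> W" "card (out v) = \<delta>" if "v \<in> W" for v using out[OF that] by auto
      show "0 < \<delta>" by (rule \<delta>)
    qed
    define F where "F = {J. J \<subseteq> E \<and> D (card J) < real (cdeg S J) + 1}"
    have "\<exists>u\<in>nlists W (2 * l). distinct u \<and>
      (\<forall>k<2 * l. u ! (Suc k mod (2 * l)) \<in> out (u ! k) \<or> u ! k \<in> out (u ! (Suc k mod (2 * l)))) \<and>
      (\<forall>J\<subseteq>cyc_edges u. 2 \<le> card J \<longrightarrow> J \<notin> F)"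
    proof (rule robust_cycle[where M="cap_const l" and K="2 * 2 ^ (2 * l)"])
      show "real (card W) \<le> real n" unfolding n_def using W(1) assms(2) by (simp add: card_mono)
      show "b ^ (l - 1) = real n / real \<delta> ^ l" unfolding n_def by (rule b(2))
      show "\<And>J e. J \<in> F \<Longrightarrow> e \<in> J \<Longrightarrow> card e \<le> 2" unfolding F_def using E by fastforce
      show "(b / real \<delta>) ^ (l - 1) \<le> \<beta> ^ (2 * l - 1)"
      proof -
        have "l + (l - 1) = 2 * l - 1" using l by simp
        then have "(b / real \<delta>) ^ (l - 1) = real (card V) / real \<delta> ^ (2 * l - 1)"
          unfolding power_divide b(2) by (simp flip: power_add)
        then show ?thesis using \<beta>(1) by simp
      qed
      fix j e assume j: "2 \<le> j" "j \<le> 2 * l"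
      define Y where "Y = {J \<in> F. card J = j \<and> e \<in> J}"
      have finY: "finite Y" unfolding Y_def F_def using finE by (auto intro: finite_subset[of _ "Pow E"])
      have "real (card Y) * D j \<le> 2 * 2 ^ (2 * l) * real (cdeg S {e})"
        by (rule card_saturated_containing_le[OF finY finS SU]) (use D1 in \<open>auto simp: Y_def F_def\<close>)
      also have "\<dots> \<le> 2 * 2 ^ (2 * l) * D 1" using cap[of "{e}"] l by simp
      also have "\<dots> = 2 * 2 ^ (2 * l) / B ^ (j - 1) * D j" using Dj[of j] j by (simp add: power_divide)
      finally have "real (card Y) \<le> 2 * 2 ^ (2 * l) / B ^ (j - 1)"
        by (rule mult_right_le_imp_le) (use D1[of j] in linarith)
      then show "finite {J \<in> F. card J = j \<and> e \<in> J} \<and>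
          real (card {J \<in> F. card J = j \<and> e \<in> J}) \<le> 2 * 2 ^ (2 * l) / (cap_const l * \<beta>) ^ (j - 1)"
        using finY unfolding Y_def B_def by simp
    next
      fix v assume "v \<in> W"
      then show "v \<notin> out v" using out[of v] by auto
    qed (use l W b \<beta> cap_const_ge[OF l] in auto)
    then obtain u where u: "u \<in> nlists W (2 * l)" "distinct u"
      "\<And>k. k < 2 * l \<Longrightarrow> u ! (Suc k mod (2 * l)) \<in> out (u ! k) \<or> u ! k \<in> out (u ! (Suc k mod (2 * l)))"
      "\<And>J. J \<subseteq> cyc_edges u \<Longrightarrow> 2 \<le> card J \<Longrightarrow> J \<notin> F" by blast
    have lenu: "length u = 2 * l" "set u \<subseteq> W" using u(1) by (auto simp: nlists_def)
    have sub: "cyc_edges u \<subseteq> E - X"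
    proof
      fix e assume "e \<in> cyc_edges u"
      then obtain k where k: "k < 2 * l" "e = {u ! k, u ! (Suc k mod (2 * l))}"
        unfolding cyc_edges_def cyc_edge_def lenu by auto
      have "Suc k mod (2 * l) < 2 * l" using l by simp
      then have "u ! k \<in> W" "u ! (Suc k mod (2 * l)) \<in> W" using k lenu nth_mem by (metis subsetD)+
      moreover have "{v, w} \<in> E - X" if "v \<in> W" "w \<in> out v" for v w using out[OF that(1)] that(2) by auto
      ultimately show "e \<in> E - X" using u(3)[OF k(1)] unfolding k(2) by (metis insert_commute)
    qed
    show "\<exists>C\<in>U. \<forall>J\<subseteq>C. J \<noteq> {} \<longrightarrow> real (cdeg S J) + 1 \<le> D (card J)"
    proof (intro bexI allI impI)
      show "cyc_edges u \<in> U" unfolding U_def using sub u lenu by auto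
      fix J assume J: "J \<subseteq> cyc_edges u" "J \<noteq> {}"
      have finJ: "finite J" using J unfolding cyc_edges_def by (auto intro: finite_subset)
      show "real (cdeg S J) + 1 \<le> D (card J)"
      proof (cases "2 \<le> card J")
        case True
        then have "J \<notin> F" using u(4) J by auto
        then show ?thesis using J(1) sub unfolding F_def by auto
      next
        case False
        then have "card J = 1" using J finJ by (metis One_nat_def card_0_eq less_2_cases not_less)
        then obtain e where "J = {e}" by (metis card_1_singletonE)
        then show ?thesis using J sub unfolding X_def by auto
      qed
    qed
  qed
  then obtain S where S: "S \<subseteq> U" "\<And>J. card J \<in> {1..2 * l} \<Longrightarrow> real (cdeg S J) \<le> D (card J)" "Nn \<le> real (card S)" by blast
  have nd: "0 < real n * \<delta>" using npos \<delta> by simp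
  have "0 < Nn" unfolding Nn_def using nd D1[of 1] by simp
  then have "S \<noteq> {}" using S(3) by auto
  moreover have "finite S" using S(1) finE unfolding U_def by (auto intro: finite_subset[of _ "Pow E"])
  moreover have "\<forall>C\<in>S. \<exists>u. distinct u \<and> length u = 2 * l \<and> C = cyc_edges u \<and> C \<subseteq> E" using S(1) unfolding U_def by auto
  moreover have "real (cdeg S J) \<le> 2 * 2 ^ (2 * l) * real (card S) / (real n * \<delta>) * B ^ (card J - 1)"
    if J: "card J \<in> {1..2 * l}" for J
  proof -
    have "real (cdeg S J) \<le> D (card J)" by (rule S(2)[OF J])
    also have "\<dots> = D 1 * B ^ (card J - 1)" using Dj[OF J] B by (simp add: power_divide)
    also have "D 1 = 2 * 2 ^ (2 * l) * Nn / (real n * \<delta>)" unfolding Nn_def using npos \<delta> by simp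
    also have "\<dots> * B ^ (card J - 1) \<le> 2 * 2 ^ (2 * l) * real (card S) / (real n * \<delta>) * B ^ (card J - 1)"
      using S(3) nd B by (intro mult_right_mono divide_right_mono mult_left_mono) auto
    finally show ?thesis .
  qed
  ultimately show ?thesis unfolding n_def B_def by blast
qed

section \<open>Expansion to linear cycles\<close>

definition extenders :: "'a set set \<Rightarrow> 'a set \<Rightarrow> 'a set" where
  "extenders H f = {w. w \<notin> f \<and> insert w f \<in> H}"

text \<open>Under independent uniform choices, an event on which the coordinates in \<open>G\<close>
  are functions of the others is at most as likely as guessing them: restriction to
  \<open>A - G\<close> is injective on \<open>X\<close>.\<close>

lemma card_PiE_restrict_le:
  assumes "finite A" "\<And>f. f \<in> A \<Longrightarrow> finite (B f) \<and> B f \<noteq> {}" "G \<subseteq> A" "X \<subseteq> PiE A B"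
    and det: "\<And>w w'. w \<in> X \<Longrightarrow> w' \<in> X \<Longrightarrow> (\<And>f. f \<in> A - G \<Longrightarrow> w f = w' f) \<Longrightarrow> (\<And>f. f \<in> G \<Longrightarrow> w f = w' f)"
  shows "real (card X) * (\<Prod>f\<in>A. 1 / real (card (B f))) \<le> (\<Prod>f\<in>G. 1 / real (card (B f)))"
proof -
  have "card X \<le> card (PiE (A - G) B)"
  proof (rule card_inj_on_le[where f="\<lambda>w. restrict w (A - G)"])
    show "inj_on (\<lambda>w. restrict w (A - G)) X"
    proof (rule inj_onI)
      fix w w' assume w: "w \<in> X" "w' \<in> X" and e: "restrict w (A - G) = restrict w' (A - G)"
      have 1: "w f = w' f" if "f \<in> A - G" for f using fun_cong[OF e, of f] that by simp
      have 2: "w f = w' f" if "f \<in> G" for f using det[OF w] 1 that by blast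
      show "w = w'"
        by (rule PiE_ext[of w A B]) (use w assms(4) 1 2 in auto)
    qed
    show "(\<lambda>w. restrict w (A - G)) ` X \<subseteq> PiE (A - G) B" using assms(4) by fastforce
    show "finite (PiE (A - G) B)" using assms by (intro finite_PiE) auto
  qed
  also have "\<dots> = (\<Prod>f\<in>A - G. card (B f))" using assms by (simp add: card_PiE)
  finally have "real (card X) \<le> (\<Prod>f\<in>A - G. real (card (B f)))" by (metis of_nat_le_iff of_nat_prod)
  then have "real (card X) * (\<Prod>f\<in>A. 1 / real (card (B f))) \<le> (\<Prod>f\<in>A - G. real (card (B f))) * (\<Prod>f\<in>A. 1 / real (card (B f)))"
    by (intro mult_right_mono prod_nonneg) auto
  also have "\<dots> = (\<Prod>f\<in>A - G. real (card (B f))) * ((\<Prod>f\<in>A - G. 1 / real (card (B f))) * (\<Prod>f\<in>G. 1 / real (card (B f))))"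
    using prod.subset_diff[OF assms(3,1), of "\<lambda>f. 1 / real (card (B f))"] by simp
  also have "(\<Prod>f\<in>A - G. real (card (B f))) * ((\<Prod>f\<in>A - G. 1 / real (card (B f))) * (\<Prod>f\<in>G. 1 / real (card (B f))))
    = (\<Prod>f\<in>A - G. real (card (B f)) * (1 / real (card (B f)))) * (\<Prod>f\<in>G. 1 / real (card (B f)))"
    by (simp only: prod.distrib mult.assoc)
  also have "(\<Prod>f\<in>A - G. real (card (B f)) * (1 / real (card (B f)))) = 1"
    using assms(2) by (intro prod.neutral) auto
  finally show ?thesis by simp
qed

definition valid_ext :: "'a set set \<Rightarrow> 'a list \<Rightarrow> ('a set \<Rightarrow> 'a) set" where
  "valid_ext H u = {w \<in> PiE (cyc_edges u) (extenders H). inj_on w (cyc_edges u) \<and> (\<forall>f\<in>cyc_edges u. w f \<notin> set u)}"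

lemma cyc_edges_subset: "f \<in> cyc_edges u \<Longrightarrow> f \<subseteq> set u"
  unfolding cyc_edges_def cyc_edge_def by (auto intro!: nth_mem mod_less_divisor)

lemma finite_cyc_edges: "finite (cyc_edges u)" unfolding cyc_edges_def by simp

lemma card_cyc_edges: "distinct u \<Longrightarrow> 3 \<le> length u \<Longrightarrow> card (cyc_edges u) = length u"
  unfolding cyc_edges_def using card_image[OF inj_on_cyc_edge] by auto

text \<open>A bad choice has two equal third vertices or one on the cycle: at most
  \<open>4 * l ^ 2\<close> events of either kind, each of probability at most \<open>1 / d\<close>.
  For \<open>d \<ge> 24 * l ^ 2\<close> these add up to at most \<open>1 / 3\<close>.\<close>

lemma valid_ext_mass:
  fixes d :: real
  assumes u: "distinct u" "length u = 2 * l" "2 \<le> l"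
    and d: "24 * real l ^ 2 \<le> d" "\<And>f. f \<in> cyc_edges u \<Longrightarrow> finite (extenders H f) \<and> d \<le> real (card (extenders H f))"
  shows "2 / 3 \<le> real (card (valid_ext H u)) * (\<Prod>f\<in>cyc_edges u. 1 / real (card (extenders H f)))"
proof -
  define A where "A = cyc_edges u"
  define p where "p = (\<Prod>f\<in>A. 1 / real (card (extenders H f)))"
  have dpos: "0 < d" using d(1) u(3) by (smt (verit) of_nat_0_less_iff zero_less_power zero_less_numeral less_le_trans)
  have finA: "finite A" unfolding A_def by (rule finite_cyc_edges)
  have cA: "card A = 2 * l" unfolding A_def using card_cyc_edges[OF u(1)] u by simp
  have B: "finite (extenders H f) \<and> extenders H f \<noteq> {}" if "f \<in> A" for f
    using d(2)[of f] that dpos unfolding A_def by auto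
  have inv: "1 / real (card (extenders H f)) \<le> 1 / d" if "f \<in> A" for f
    using d(2)[of f] that dpos unfolding A_def by (intro divide_left_mono) (auto intro: mult_pos_pos)
  have p0: "0 \<le> p" unfolding p_def by (intro prod_nonneg) auto
  define X where "X = (\<lambda>(f, g). {w \<in> PiE A (extenders H). w f = w g})"
  define Y where "Y = (\<lambda>(f, k). {w \<in> PiE A (extenders H). w f = u ! k})"
  define I where "I = {(f, g). f \<in> A \<and> g \<in> A \<and> f \<noteq> g}"
  have one: "real (card Z) * p \<le> 1 / d" if "f \<in> A" "Z \<subseteq> PiE A (extenders H)"
    "\<And>w w'. w \<in> Z \<Longrightarrow> w' \<in> Z \<Longrightarrow> (\<And>f'. f' \<in> A - {f} \<Longrightarrow> w f' = w' f') \<Longrightarrow> w f = w' f" for f Z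
  proof -
    have "real (card Z) * p \<le> (\<Prod>f\<in>{f}. 1 / real (card (extenders H f)))"
      unfolding p_def by (rule card_PiE_restrict_le[OF finA B]) (use that in blast)+
    then show ?thesis using inv[OF that(1)] by simp
  qed
  have XI: "real (card (X i)) * p \<le> 1 / d" if iI: "i \<in> I" for i
  proof -
    obtain f g where i: "i = (f, g)" "f \<in> A" "g \<in> A" "f \<noteq> g" using iI unfolding I_def by auto
    show ?thesis
    proof (rule one[OF i(2)])
      show "X i \<subseteq> PiE A (extenders H)" unfolding X_def i by auto
      fix w w' assume "w \<in> X i" "w' \<in> X i" "\<And>f'. f' \<in> A - {f} \<Longrightarrow> w f' = w' f'"
      then show "w f = w' f" unfolding X_def i(1) using i by auto
    qed
  qed
  have YI: "real (card (Y i)) * p \<le> 1 / d" if iI: "i \<in> A \<times> {..<2 * l}" for i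
  proof -
    obtain f k where i: "i = (f, k)" "f \<in> A" using iI by auto
    show ?thesis
    proof (rule one[OF i(2)])
      show "Y i \<subseteq> PiE A (extenders H)" unfolding Y_def i by auto
    qed (auto simp: Y_def i)
  qed
  have finP: "finite (PiE A (extenders H))" using finA B by (intro finite_PiE) auto
  have "I \<subseteq> A \<times> A" unfolding I_def by auto
  then have I: "finite I" "card I \<le> (2 * l) * (2 * l)"
    using finA cA card_mono[of "A \<times> A" I] finite_subset[of I "A \<times> A"] by (auto simp: card_cartesian_product)
  have "PiE A (extenders H) \<subseteq> valid_ext H u \<union> ((\<Union>i\<in>I. X i) \<union> (\<Union>i\<in>A \<times> {..<2 * l}. Y i))"
  proof
    fix w assume w: "w \<in> PiE A (extenders H)"
    show "w \<in> valid_ext H u \<union> ((\<Union>i\<in>I. X i) \<union> (\<Union>i\<in>A \<times> {..<2 * l}. Y i))"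
    proof (cases "inj_on w A")
      case False
      then obtain f g where "f \<in> A" "g \<in> A" "f \<noteq> g" "w f = w g" unfolding inj_on_def by auto
      then have "(f, g) \<in> I" "w \<in> X (f, g)" using w unfolding I_def X_def by auto
      then show ?thesis by blast
    next
      case True
      show ?thesis
      proof (cases "\<forall>f\<in>A. w f \<notin> set u")
        case True
        then show ?thesis using w \<open>inj_on w A\<close> unfolding valid_ext_def A_def by auto
      next
        case False
        then obtain f k where "f \<in> A" "k < 2 * l" "w f = u ! k" using u(2) by (metis in_set_conv_nth)
        then have "(f, k) \<in> A \<times> {..<2 * l}" "w \<in> Y (f, k)" using w unfolding Y_def by auto
        then show ?thesis by blast
      qed
    qed
  qed
  moreover have fv: "finite (valid_ext H u)" unfolding valid_ext_def using finP A_def by auto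
  moreover have fx: "finite (\<Union>i\<in>I. X i)" "finite (\<Union>i\<in>A \<times> {..<2 * l}. Y i)"
    using I finA finP by (auto simp: X_def Y_def)
  ultimately have "card (PiE A (extenders H)) \<le> card (valid_ext H u \<union> ((\<Union>i\<in>I. X i) \<union> (\<Union>i\<in>A \<times> {..<2 * l}. Y i)))"
    by (intro card_mono) auto
  also have "\<dots> \<le> card (valid_ext H u) + (card (\<Union>i\<in>I. X i) + card (\<Union>i\<in>A \<times> {..<2 * l}. Y i))"
    by (meson add_left_mono card_Un_le order_trans)
  also have "\<dots> \<le> card (valid_ext H u) + ((\<Sum>i\<in>I. card (X i)) + (\<Sum>i\<in>A \<times> {..<2 * l}. card (Y i)))"
    using I(1) finA by (intro add_mono card_UN_le) auto
  finally have "real (card (PiE A (extenders H))) \<le> real (card (valid_ext H u) + ((\<Sum>i\<in>I. card (X i)) + (\<Sum>i\<in>A \<times> {..<2 * l}. card (Y i))))"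
    by (rule of_nat_mono)
  then have "real (card (PiE A (extenders H))) * p \<le> (real (card (valid_ext H u)) + ((\<Sum>i\<in>I. real (card (X i))) + (\<Sum>i\<in>A \<times> {..<2 * l}. real (card (Y i))))) * p"
    using p0 by (intro mult_right_mono) auto
  also have "\<dots> = real (card (valid_ext H u)) * p + ((\<Sum>i\<in>I. real (card (X i)) * p) + (\<Sum>i\<in>A \<times> {..<2 * l}. real (card (Y i)) * p))"
    by (simp add: sum_distrib_right ring_distribs)
  also have "\<dots> \<le> real (card (valid_ext H u)) * p + ((\<Sum>i\<in>I. 1 / d) + (\<Sum>i\<in>A \<times> {..<2 * l}. 1 / d))"
    by (intro add_mono sum_mono XI YI order_refl)
  also have "\<dots> = real (card (valid_ext H u)) * p + (real (card I) + real (2 * l * (2 * l))) / d"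
    using cA by (simp add: card_cartesian_product add_divide_distrib)
  also have "\<dots> \<le> real (card (valid_ext H u)) * p + 1 / 3"
  proof -
    have "real (card I) \<le> real (2 * l * (2 * l))" using I(2) by (rule of_nat_mono)
    then have "real (card I) + real (2 * l * (2 * l)) \<le> 8 * real l ^ 2" by (simp add: power2_eq_square)
    also have "\<dots> \<le> d / 3" using d(1) by simp
    finally have "(real (card I) + real (2 * l * (2 * l))) / d \<le> (d / 3) / d" using dpos by (intro divide_right_mono) auto
    then show ?thesis using dpos by simp
  qed
  also have "real (card (PiE A (extenders H))) * p = 1"
  proof -
    have "real (card (PiE A (extenders H))) * p = (\<Prod>f\<in>A. real (card (extenders H f)) * (1 / real (card (extenders H f))))"
      unfolding p_def prod.distrib using finA by (simp add: card_PiE)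
    also have "\<dots> = 1" using B by (intro prod.neutral) auto
    finally show ?thesis .
  qed
  finally show ?thesis unfolding p_def A_def by simp
qed

definition expand :: "'a list \<Rightarrow> ('a set \<Rightarrow> 'a) \<Rightarrow> 'a set set" where
  "expand u w = (\<lambda>f. insert (w f) f) ` cyc_edges u"

text \<open>Third vertices lie off the cycle, so a hyperedge gives back its pair as its intersection
  with \<open>set u\<close>.\<close>

lemma expand_inj:
  assumes "w \<in> valid_ext H u"
  shows "inj_on (\<lambda>f. insert (w f) f) (cyc_edges u)"
proof (rule inj_onI)
  fix f g assume fg: "f \<in> cyc_edges u" "g \<in> cyc_edges u" "insert (w f) f = insert (w g) g"
  have "insert (w f) f \<inter> set u = f" "insert (w g) g \<inter> set u = g"
    using fg cyc_edges_subset assms unfolding valid_ext_def by blast+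
  then show "f = g" using fg(3) by metis
qed

lemma expand_linear_cycle:
  assumes u: "distinct u" "length u = 2 * l" "2 \<le> l" and w: "w \<in> valid_ext H u"
  shows "expand u w \<in> linear_cycle_copies (2 * l) H"
proof -
  let ?m = "2 * l"
  \<comment> \<open>Even indices carry the cycle, odd ones the third vertices. Reduction modulo
    \<open>?m\<close> sends index \<open>2 * ?m\<close> to \<open>u ! 0\<close>, matching the
    convention that index 0 is read as the last one.\<close>
  define v where "v n = (if even n then u ! ((n div 2) mod ?m) else w (cyc_edge u (n div 2)))" for n
  have ce: "cyc_edge u i \<in> cyc_edges u" if "i < ?m" for i using that u unfolding cyc_edges_def by auto
  have ev: "v (2 * i) = u ! (i mod ?m)" for i unfolding v_def by simp
  have od: "v (2 * i + 1) = w (cyc_edge u i)" for i unfolding v_def by simp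
  have injw: "inj_on w (cyc_edges u)" and wu: "\<And>f. f \<in> cyc_edges u \<Longrightarrow> w f \<notin> set u"
    using w unfolding valid_ext_def by auto
  have inju: "inj_on (cyc_edge u) {..<?m}" using inj_on_cyc_edge[OF u(1)] u by simp
  have inu: "u ! (i mod ?m) \<in> set u" for i using u by (intro nth_mem) simp
  have inj: "inj_on v {1..2 * ?m}"
  proof (rule inj_onI)
    fix a c assume a: "a \<in> {1..2 * ?m}" and c: "c \<in> {1..2 * ?m}" and eq: "v a = v c"
    show "a = c"
    proof (cases "even a"; cases "even c")
      assume "even a" "even c"
      then obtain i j where ij: "a = 2 * i" "c = 2 * j" by (auto elim!: evenE)
      have "u ! (i mod ?m) = u ! (j mod ?m)" using eq unfolding ij ev .
      then have "i mod ?m = j mod ?m" using u by (simp add: nth_eq_iff_index_eq)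
      moreover have "1 \<le> i" "i \<le> ?m" "1 \<le> j" "j \<le> ?m" using a c ij by auto
      ultimately have "i = j" by (metis le_neq_implies_less mod_less mod_self not_one_le_zero)
      then show ?thesis using ij by simp
    next
      assume "odd a" "odd c"
      then obtain i j where ij: "a = 2 * i + 1" "c = 2 * j + 1" by (auto elim!: oddE)
      then have lt: "i < ?m" "j < ?m" using a c by auto
      have "w (cyc_edge u i) = w (cyc_edge u j)" using eq unfolding ij od .
      then have "cyc_edge u i = cyc_edge u j" using injw ce lt by (meson inj_onD)
      then have "i = j" using inju lt by (meson inj_onD lessThan_iff)
      then show ?thesis using ij by simp
    next
      assume "even a" "odd c"
      then obtain i j where ij: "a = 2 * i" "c = 2 * j + 1" by (auto elim!: evenE oddE)
      then have "j < ?m" using c by auto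
      then show ?thesis using eq wu[OF ce] inu[of i] unfolding ij ev od by metis
    next
      assume "odd a" "even c"
      then obtain i j where ij: "c = 2 * i" "a = 2 * j + 1" by (auto elim!: evenE oddE)
      then have "j < ?m" using a by auto
      then show ?thesis using eq wu[OF ce] inu[of i] unfolding ij ev od by metis
    qed
  qed
  have "(\<lambda>e. v ` e) ` linear_cycle ?m = expand u w"
  proof -
    have im: "v ` {if i = 1 then 2 * ?m else 2 * i - 2, 2 * i - 1, 2 * i} = insert (w (cyc_edge u (i - 1))) (cyc_edge u (i - 1))"
      if i: "i \<in> {1..?m}" for i
    proof -
      obtain k where k: "i = Suc k" using i by (cases i) auto
      have km: "k < ?m" using i k by auto
      have "v (if i = 1 then 2 * ?m else 2 * i - 2) = u ! k"
      proof (cases "k = 0")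
        case True then show ?thesis using ev[of ?m] k by simp
      next
        case False then show ?thesis using ev[of k] k km by simp
      qed
      moreover have "v (2 * i - 1) = w (cyc_edge u k)" using od[of k] k by simp
      moreover have "v (2 * i) = u ! (Suc k mod ?m)" using ev[of i] k by simp
      ultimately show ?thesis using k u(2) unfolding cyc_edge_def by auto
    qed
    have "(\<lambda>e. v ` e) ` linear_cycle ?m = (\<lambda>i. insert (w (cyc_edge u (i - 1))) (cyc_edge u (i - 1))) ` {1..?m}"
      unfolding linear_cycle_def image_image using im by (intro image_cong) auto
    also have "\<dots> = (\<lambda>k. insert (w (cyc_edge u k)) (cyc_edge u k)) ` ((\<lambda>i. i - 1) ` {1..?m})"
      by (simp only: image_image)
    also have "(\<lambda>i. i - 1) ` {1..?m} = {..<?m}"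
    proof
      show "{..<?m} \<subseteq> (\<lambda>i. i - 1) ` {1..?m}"
      proof
        fix k assume "k \<in> {..<?m}"
        then show "k \<in> (\<lambda>i. i - 1) ` {1..?m}" by (intro image_eqI[of _ _ "Suc k"]) auto
      qed
    qed auto
    finally show ?thesis unfolding expand_def cyc_edges_def image_image u(2) .
  qed
  moreover have "expand u w \<subseteq> H"
    unfolding expand_def using w unfolding valid_ext_def extenders_def by (auto dest: PiE_mem)
  ultimately show ?thesis unfolding linear_cycle_copies_def using inj by auto
qed

text \<open>A random cycle with a random valid extension has mass at least
  \<open>3 / 4 * 2 / 3 = 1 / 2\<close>, as \<open>weighted_saturation\<close> requires. For given
  hyperedges \<open>J\<close> one guesses which pair of each is the cycle edge, in at most
  \<open>3 ^ card J\<close> ways; the third vertices over these pairs are then forced, which gives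
  the product of reciprocal codegrees.\<close>

theorem expansion:
  fixes \<mu> :: "'a list \<Rightarrow> real" and d \<alpha> \<beta> :: real
  assumes l: "2 \<le> l" and H: "finite H" "\<And>e. e \<in> H \<Longrightarrow> card e = 3"
    and U: "finite U" "\<And>u. u \<in> U \<Longrightarrow> distinct u \<and> length u = 2 * l"
    and \<mu>: "\<And>u. u \<in> U \<Longrightarrow> 0 \<le> \<mu> u" "3 / 4 \<le> sum \<mu> U"
    and d: "24 * real l ^ 2 \<le> d" "\<And>u f. u \<in> U \<Longrightarrow> f \<in> cyc_edges u \<Longrightarrow> d \<le> real (card (extenders H f))"
    and \<alpha>: "0 < \<alpha>" "0 < \<beta>" "\<beta> \<le> 1"
    and spread: "\<And>J. card J \<in> {1..2 * l} \<Longrightarrow>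
      (\<Sum>u | u \<in> U \<and> J \<subseteq> cyc_edges u. \<mu> u) * (\<Prod>f\<in>J. 1 / real (card (extenders H f))) \<le> \<alpha> * \<beta> ^ (card J - 1)"
  shows "\<exists>S\<subseteq>linear_cycle_copies (2 * l) H. S \<noteq> {} \<and> (\<forall>J. card J \<in> {1..2 * l} \<longrightarrow>
    real (cdeg S J) \<le> 16 * real l * 12 ^ (2 * l) * real (card S) * \<alpha> * \<beta> ^ (card J - 1))"
proof -
  have dpos: "0 < d" using d(1) l by (smt (verit) of_nat_0_less_iff zero_less_power zero_less_numeral less_le_trans)
  have ext_fin: "finite (extenders H f) \<and> extenders H f \<noteq> {}" if "u \<in> U" "f \<in> cyc_edges u" for u f
  proof -
    have "0 < real (card (extenders H f))" using d(2)[OF that] dpos by linarith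
    then show ?thesis by (metis card.empty card.infinite of_nat_0 less_irrefl)
  qed
  define p where "p u = (\<Prod>f\<in>cyc_edges u. 1 / real (card (extenders H f)))" for u
  have p0: "0 \<le> p u" for u unfolding p_def by (intro prod_nonneg) auto
  define \<Omega> where "\<Omega> = (SIGMA u:U. valid_ext H u)"
  define \<nu> where "\<nu> = (\<lambda>(u, w::'a set \<Rightarrow> 'a). \<mu> u * p u)"
  define \<psi> where "\<psi> = (\<lambda>(u, w). expand u (w::'a set \<Rightarrow> 'a))"
  have finPi: "finite (PiE (cyc_edges u) (extenders H))" if "u \<in> U" for u
    using finite_cyc_edges ext_fin[OF that] by (intro finite_PiE) auto
  have finv: "finite (valid_ext H u)" if "u \<in> U" for u
    using finPi[OF that] unfolding valid_ext_def by auto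
  have fin\<Omega>: "finite \<Omega>" unfolding \<Omega>_def using U(1) finv by (rule finite_SigmaI)
  have \<nu>0: "0 \<le> \<nu> \<omega>" if "\<omega> \<in> \<Omega>" for \<omega> using that \<mu>(1) p0 unfolding \<Omega>_def \<nu>_def by auto
  have "sum \<nu> \<Omega> = (\<Sum>u\<in>U. \<Sum>w\<in>valid_ext H u. \<mu> u * p u)"
    unfolding \<Omega>_def \<nu>_def using U(1) finv by (subst sum.Sigma) auto
  also have "\<dots> = (\<Sum>u\<in>U. \<mu> u * (real (card (valid_ext H u)) * p u))" by (simp add: mult_ac)
  also have "\<dots> \<ge> (\<Sum>u\<in>U. \<mu> u * (2 / 3))"
    unfolding p_def using U(2) l d ext_fin \<mu>(1)
    by (intro sum_mono mult_left_mono valid_ext_mass[where d=d and l=l]) auto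
  finally have "sum \<mu> U * (2 / 3) \<le> sum \<nu> \<Omega>" unfolding sum_distrib_right .
  then have tot: "1 / 2 \<le> sum \<nu> \<Omega>" using \<mu>(2) by linarith
  have \<psi>: "finite (\<psi> \<omega>) \<and> card (\<psi> \<omega>) = 2 * l" if \<omega>in: "\<omega> \<in> \<Omega>" for \<omega>
  proof -
    obtain u w where \<omega>: "\<omega> = (u, w)" "u \<in> U" "w \<in> valid_ext H u" using \<omega>in unfolding \<Omega>_def by auto
    have "card (expand u w) = card (cyc_edges u)" unfolding expand_def by (rule card_image[OF expand_inj[OF \<omega>(3)]])
    then show ?thesis using U(2)[OF \<omega>(2)] card_cyc_edges[of u] l finite_cyc_edges[of u] unfolding \<psi>_def \<omega> expand_def by simp
  qed
  have sp: "(\<Sum>\<omega> | \<omega> \<in> \<Omega> \<and> J \<subseteq> \<psi> \<omega>. \<nu> \<omega>) \<le> (3 ^ (2 * l) * \<alpha>) * \<beta> ^ (card J - 1)" if J: "card J \<in> {1..2 * l}" for J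
  proof (cases "\<exists>\<omega>\<in>\<Omega>. J \<subseteq> \<psi> \<omega>")
    case False
    then have "{\<omega>. \<omega> \<in> \<Omega> \<and> J \<subseteq> \<psi> \<omega>} = {}" by auto
    then have "(\<Sum>\<omega> | \<omega> \<in> \<Omega> \<and> J \<subseteq> \<psi> \<omega>. \<nu> \<omega>) = 0" by (simp only: sum.empty)
    then show ?thesis using \<alpha> by simp
  next
    case True
    have finJ: "finite J" using J by (intro card_ge_0_finite) auto
    have card3: "card e = 3" if "e \<in> J" for e
    proof -
      obtain u w where uw: "u \<in> U" "w \<in> valid_ext H u" "J \<subseteq> expand u w" using True unfolding \<Omega>_def \<psi>_def by auto
      have "expand u w \<in> linear_cycle_copies (2 * l) H"
        using expand_linear_cycle[OF _ _ l uw(2)] U(2)[OF uw(1)] by blast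
      then have "J \<subseteq> H" using uw(3) unfolding linear_cycle_copies_def by auto
      then show ?thesis using H(2) that by auto
    qed
    define \<Phi> where "\<Phi> = PiE J (\<lambda>e. {f. f \<subseteq> e \<and> card f = 2})"
    have fin2: "finite {f. f \<subseteq> e \<and> card f = 2}" "card {f. f \<subseteq> e \<and> card f = 2} = 3" if "e \<in> J" for e
    proof -
      have fe: "finite e" using card3[OF that] by (intro card_ge_0_finite) auto
      then show "finite {f. f \<subseteq> e \<and> card f = 2}" by simp
      have "card {f. f \<subseteq> e \<and> card f = 2} = 3 choose 2" using n_subsets[OF fe, of 2] card3[OF that] by simp
      also have "(3::nat) choose 2 = 3" by (simp add: numeral_eq_Suc)
      finally show "card {f. f \<subseteq> e \<and> card f = 2} = 3" .
    qed
    have fin\<Phi>: "finite \<Phi>" unfolding \<Phi>_def using finJ fin2 by (intro finite_PiE) auto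
    have card\<Phi>: "card \<Phi> = 3 ^ card J" unfolding \<Phi>_def using finJ fin2 by (simp add: card_PiE)
    define \<Phi>' where "\<Phi>' = {\<phi> \<in> \<Phi>. inj_on \<phi> J}"
    have fin\<Phi>': "finite \<Phi>'" and card\<Phi>': "card \<Phi>' \<le> 3 ^ card J"
      unfolding \<Phi>'_def using fin\<Phi> card\<Phi> card_mono[OF fin\<Phi>, of "{\<phi> \<in> \<Phi>. inj_on \<phi> J}"] by auto
    define M where "M \<phi> = (\<lambda>(u, w). \<phi> ` J \<subseteq> cyc_edges u \<and> (\<forall>e\<in>J. insert (w (\<phi> e)) (\<phi> e) = e))" for \<phi> :: "'a set \<Rightarrow> 'a set"
    have exM: "\<exists>\<phi>\<in>\<Phi>'. M \<phi> \<omega>" if \<omega>J: "\<omega> \<in> \<Omega>" "J \<subseteq> \<psi> \<omega>" for \<omega>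
    proof -
      obtain u w where \<omega>: "\<omega> = (u, w)" "u \<in> U" "w \<in> valid_ext H u" using \<omega>J unfolding \<Omega>_def by auto
      have "\<forall>e\<in>J. \<exists>f. f \<in> cyc_edges u \<and> insert (w f) f = e" using \<omega>J(2) unfolding \<omega> \<psi>_def expand_def by auto
      then obtain \<phi>0 where \<phi>0: "\<And>e. e \<in> J \<Longrightarrow> \<phi>0 e \<in> cyc_edges u \<and> insert (w (\<phi>0 e)) (\<phi>0 e) = e" by metis
      define \<phi> where "\<phi> = restrict \<phi>0 J"
      have 1: "\<phi> e \<in> cyc_edges u" "insert (w (\<phi> e)) (\<phi> e) = e" if "e \<in> J" for e
        using \<phi>0[OF that] that unfolding \<phi>_def by auto
      have "card (\<phi> e) = 2" if "e \<in> J" for e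
      proof -
        have "w (\<phi> e) \<notin> \<phi> e" using \<omega>(3) 1(1)[OF that] unfolding valid_ext_def extenders_def by (auto dest: PiE_mem)
        moreover have "finite (\<phi> e)" using cyc_edges_subset[OF 1(1)[OF that]] by (rule finite_subset) simp
        ultimately show ?thesis using card3[OF that] 1(2)[OF that] by (metis card_insert_disjoint numeral_2_eq_2 numeral_3_eq_3 nat.inject)
      qed
      then have "\<phi> \<in> \<Phi>" unfolding \<Phi>_def using 1(2) by (auto simp: \<phi>_def)
      moreover have "inj_on \<phi> J" by (rule inj_on_inverseI[where g="\<lambda>f. insert (w f) f"]) (rule 1(2))
      ultimately have "\<phi> \<in> \<Phi>'" unfolding \<Phi>'_def by simp
      moreover have "M \<phi> \<omega>" unfolding M_def \<omega> using 1 by auto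
      ultimately show ?thesis by blast
    qed
    have "(\<Sum>\<omega> | \<omega> \<in> \<Omega> \<and> J \<subseteq> \<psi> \<omega>. \<nu> \<omega>) \<le> (\<Sum>\<omega>\<in>\<Omega>. \<Sum>\<phi>\<in>\<Phi>'. if M \<phi> \<omega> then \<nu> \<omega> else 0)"
      unfolding sum.inter_filter[OF fin\<Omega>]
    proof (rule sum_mono)
      fix \<omega> assume \<omega>: "\<omega> \<in> \<Omega>"
      show "(if J \<subseteq> \<psi> \<omega> then \<nu> \<omega> else 0) \<le> (\<Sum>\<phi>\<in>\<Phi>'. if M \<phi> \<omega> then \<nu> \<omega> else 0)"
      proof (cases "J \<subseteq> \<psi> \<omega>")
        case True
        then obtain \<phi> where "\<phi> \<in> \<Phi>'" "M \<phi> \<omega>" using exM[OF \<omega>] by blast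
        then show ?thesis using member_le_sum[of \<phi> \<Phi>' "\<lambda>\<phi>. if M \<phi> \<omega> then \<nu> \<omega> else 0"] fin\<Phi>' \<nu>0[OF \<omega>] True by auto
      next
        case False
        then show ?thesis using \<nu>0[OF \<omega>] by (auto intro: sum_nonneg)
      qed
    qed
    also have "\<dots> = (\<Sum>\<phi>\<in>\<Phi>'. \<Sum>\<omega>\<in>\<Omega>. if M \<phi> \<omega> then \<nu> \<omega> else 0)" by (rule sum.swap)
    also have "\<dots> \<le> (\<Sum>\<phi>\<in>\<Phi>'. \<alpha> * \<beta> ^ (card J - 1))"
    proof (rule sum_mono)
      fix \<phi> assume \<phi>: "\<phi> \<in> \<Phi>'"
      then have inj: "inj_on \<phi> J" unfolding \<Phi>'_def by auto
      define G where "G = \<phi> ` J"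
      have cG: "card G = card J" unfolding G_def by (rule card_image[OF inj])
      have "(\<Sum>\<omega>\<in>\<Omega>. if M \<phi> \<omega> then \<nu> \<omega> else 0) = (\<Sum>u\<in>U. \<Sum>w\<in>valid_ext H u. if M \<phi> (u, w) then \<mu> u * p u else 0)"
        unfolding \<Omega>_def \<nu>_def using U(1) finv by (subst sum.Sigma) (auto intro!: sum.cong)
      also have "\<dots> \<le> (\<Sum>u\<in>U. if G \<subseteq> cyc_edges u then \<mu> u * (\<Prod>f\<in>G. 1 / real (card (extenders H f))) else 0)"
      proof (rule sum_mono)
        fix u assume u: "u \<in> U"
        show "(\<Sum>w\<in>valid_ext H u. if M \<phi> (u, w) then \<mu> u * p u else 0) \<le>
            (if G \<subseteq> cyc_edges u then \<mu> u * (\<Prod>f\<in>G. 1 / real (card (extenders H f))) else 0)"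
        proof (cases "G \<subseteq> cyc_edges u")
          case False
          then have "\<not> M \<phi> (u, w)" for w unfolding M_def G_def by auto
          then show ?thesis using False by simp
        next
          case True
          define X where "X = {w \<in> valid_ext H u. M \<phi> (u, w)}"
          have "(\<Sum>w\<in>valid_ext H u. if M \<phi> (u, w) then \<mu> u * p u else 0) = (\<Sum>w\<in>X. \<mu> u * p u)"
            unfolding X_def using sum.inter_filter[OF finv[OF u], of "\<lambda>_. \<mu> u * p u"] by simp
          also have "\<dots> = \<mu> u * (real (card X) * p u)" by simp
          also have "\<dots> \<le> \<mu> u * (\<Prod>f\<in>G. 1 / real (card (extenders H f)))"
          proof (rule mult_left_mono)
            show "real (card X) * p u \<le> (\<Prod>f\<in>G. 1 / real (card (extenders H f)))"
              unfolding p_def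
            proof (rule card_PiE_restrict_le[OF finite_cyc_edges _ True])
              show "\<And>f. f \<in> cyc_edges u \<Longrightarrow> finite (extenders H f) \<and> extenders H f \<noteq> {}" using ext_fin[OF u] by blast
              show "X \<subseteq> PiE (cyc_edges u) (extenders H)" unfolding X_def valid_ext_def by auto
              fix w w' f assume w: "w \<in> X" "w' \<in> X" and "f \<in> G"
              then obtain e where e: "e \<in> J" "f = \<phi> e" unfolding G_def by auto
              have "insert (w f) f = e" "insert (w' f) f = e" using w e unfolding X_def M_def by auto
              moreover have "w f \<notin> f" "w' f \<notin> f"
                using w True \<open>f \<in> G\<close> unfolding X_def valid_ext_def extenders_def by (auto dest: PiE_mem)
              ultimately show "w f = w' f" by (metis insertE insertI1)
            qed
          qed (use \<mu>(1) u in auto)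
          finally show ?thesis using True by simp
        qed
      qed
      also have "\<dots> = (\<Sum>u | u \<in> U \<and> G \<subseteq> cyc_edges u. \<mu> u) * (\<Prod>f\<in>G. 1 / real (card (extenders H f)))"
        unfolding sum_distrib_right sum.inter_filter[OF U(1)] by (rule sum.cong) auto
      also have "\<dots> \<le> \<alpha> * \<beta> ^ (card J - 1)" using spread[of G] J cG by simp
      finally show "(\<Sum>\<omega>\<in>\<Omega>. if M \<phi> \<omega> then \<nu> \<omega> else 0) \<le> \<alpha> * \<beta> ^ (card J - 1)" .
    qed
    also have "\<dots> = real (card \<Phi>') * (\<alpha> * \<beta> ^ (card J - 1))" by simp
    also have "\<dots> \<le> 3 ^ (2 * l) * (\<alpha> * \<beta> ^ (card J - 1))"
    proof (rule mult_right_mono)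
      have "real (card \<Phi>') \<le> real (3 ^ card J)" using card\<Phi>' by (rule of_nat_mono)
      also have "\<dots> \<le> 3 ^ (2 * l)" using J power_increasing[of "card J" "2 * l" "3::real"] by simp
      finally show "real (card \<Phi>') \<le> 3 ^ (2 * l)" .
    qed (use \<alpha> in auto)
    finally show ?thesis by simp
  qed
  have "\<exists>S\<subseteq>\<psi> ` \<Omega>. S \<noteq> {} \<and> (\<forall>J. card J \<in> {1..2 * l} \<longrightarrow>
    real (cdeg S J) \<le> 8 * real (2 * l) * 2 ^ (2 * l) * real (card S) * (3 ^ (2 * l) * \<alpha>) * \<beta> ^ (card J - 1))"
    by (rule weighted_saturation[OF fin\<Omega> \<nu>0 tot \<psi> _ _ \<alpha>(2,3) sp]) (use l \<alpha> in auto)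
  then obtain S where S: "S \<subseteq> \<psi> ` \<Omega>" "S \<noteq> {}" "\<And>J. card J \<in> {1..2 * l} \<Longrightarrow>
    real (cdeg S J) \<le> 8 * real (2 * l) * 2 ^ (2 * l) * real (card S) * (3 ^ (2 * l) * \<alpha>) * \<beta> ^ (card J - 1)" by blast
  have "\<psi> ` \<Omega> \<subseteq> linear_cycle_copies (2 * l) H"
    unfolding \<Omega>_def \<psi>_def using expand_linear_cycle[OF _ _ l] U(2) by auto
  moreover have "8 * real (2 * l) * 2 ^ (2 * l) * real (card S) * (3 ^ (2 * l) * \<alpha>) * \<beta> ^ (card J - 1)
     \<le> 16 * real l * 12 ^ (2 * l) * real (card S) * \<alpha> * \<beta> ^ (card J - 1)" for J :: "'a set set"
  proof -
    have "(2::real) ^ (2 * l) * 3 ^ (2 * l) \<le> 12 ^ (2 * l)" by (simp add: power_mult_distrib[symmetric] power_mono)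
    then have "((2::real) ^ (2 * l) * 3 ^ (2 * l)) * (16 * real l * real (card S) * \<alpha> * \<beta> ^ (card J - 1)) \<le>
      12 ^ (2 * l) * (16 * real l * real (card S) * \<alpha> * \<beta> ^ (card J - 1))"
      using \<alpha> by (intro mult_right_mono) auto
    then show ?thesis by (simp add: mult_ac)
  qed
  ultimately show ?thesis using S by (meson order_trans)
qed

section \<open>Cores of prescribed codegree\<close>

definition shadow :: "'a set set \<Rightarrow> 'a set set" where
  "shadow H = {f. card f = 2 \<and> (\<exists>e\<in>H. f \<subseteq> e)}"

lemma card_extenders:
  assumes "\<And>e. e \<in> H \<Longrightarrow> card e = 3" "card f = 2"
  shows "card (extenders H f) = card {e \<in> H. f \<subseteq> e}"
proof -
  have "bij_betw (\<lambda>w. insert w f) (extenders H f) {e \<in> H. f \<subseteq> e}"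
  proof (rule bij_betwI')
    fix w w' assume "w \<in> extenders H f" "w' \<in> extenders H f"
    then show "(insert w f = insert w' f) = (w = w')" unfolding extenders_def by blast
  next
    fix w assume "w \<in> extenders H f"
    then show "insert w f \<in> {e \<in> H. f \<subseteq> e}" unfolding extenders_def by auto
  next
    fix e assume e: "e \<in> {e \<in> H. f \<subseteq> e}"
    have "card e = 3" using assms(1) e by simp
    then have fe: "finite e" by (intro card_ge_0_finite) simp
    have "f \<noteq> e" using \<open>card e = 3\<close> assms(2) by auto
    then obtain w where w: "w \<in> e" "w \<notin> f" using e by auto
    have "insert w f = e"
    proof (rule card_subset_eq[OF fe])
      show "insert w f \<subseteq> e" using w e by auto
      have "finite f" using assms(2) by (intro card_ge_0_finite) simp
      then show "card (insert w f) = card e" using w assms(2) \<open>card e = 3\<close> by simp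
    qed
    then show "\<exists>w\<in>extenders H f. e = insert w f" using w e unfolding extenders_def by auto
  qed
  then show ?thesis by (rule bij_betw_same_card)
qed

definition codeg_ge :: "real \<Rightarrow> 'a set set \<Rightarrow> bool" where
  "codeg_ge d H \<longleftrightarrow> (\<forall>f\<in>shadow H. d \<le> real (card {e \<in> H. f \<subseteq> e}))"

lemma finite_shadow:
  assumes "finite H" "\<And>e. e \<in> H \<Longrightarrow> card e = 3" shows "finite (shadow H)"
proof (rule finite_subset)
  show "shadow H \<subseteq> (\<Union>e\<in>H. Pow e)" unfolding shadow_def by auto
  show "finite (\<Union>e\<in>H. Pow e)" using assms by (auto intro: card_ge_0_finite)
qed

text \<open>Maximise \<open>card Y - d * card (shadow Y)\<close>. Deleting all edges over a shadow
  pair of the maximiser removes that pair from the shadow, so it must carry at least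
  \<open>d\<close> edges. Comparison with \<open>X\<close> itself gives the size.\<close>

lemma core_size:
  fixes d :: real
  assumes "finite X" "\<And>e. e \<in> X \<Longrightarrow> card e = 3" "0 \<le> d"
  shows "\<exists>Y\<subseteq>X. codeg_ge d Y \<and> real (card X) - d * real (card (shadow X)) \<le> real (card Y)"
proof -
  define \<Phi> where "\<Phi> Y = real (card Y) - d * real (card (shadow Y))" for Y :: "'a set set"
  have "Max (\<Phi> ` Pow X) \<in> \<Phi> ` Pow X" using assms(1) by (intro Max_in) auto
  then obtain Y where Y: "Y \<subseteq> X" and eq: "\<Phi> Y = Max (\<Phi> ` Pow X)" by auto
  have max: "\<Phi> T \<le> \<Phi> Y" if "T \<subseteq> X" for T unfolding eq using assms(1) that by simp
  have finY: "finite Y" using Y assms(1) finite_subset by blast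
  have finS: "finite (shadow Y)" by (rule finite_shadow[OF finY]) (use Y assms(2) in auto)
  have "d \<le> real (card {e \<in> Y. f \<subseteq> e})" if f: "f \<in> shadow Y" for f
  proof -
    define Y' where "Y' = {e \<in> Y. \<not> f \<subseteq> e}"
    have "Y = Y' \<union> {e \<in> Y. f \<subseteq> e}" "Y' \<inter> {e \<in> Y. f \<subseteq> e} = {}" unfolding Y'_def by auto
    then have c: "card Y = card Y' + card {e \<in> Y. f \<subseteq> e}"
      using finY by (metis (no_types, lifting) card_Un_disjoint finite_Un)
    have "shadow Y' \<subseteq> shadow Y - {f}" unfolding shadow_def Y'_def by auto
    then have "card (shadow Y') \<le> card (shadow Y) - 1"
      using card_mono[of "shadow Y - {f}" "shadow Y'"] finS f by simp
    moreover have "1 \<le> card (shadow Y)" using f finS by (metis One_nat_def Suc_leI card_gt_0_iff empty_iff)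
    ultimately have "real (card (shadow Y')) \<le> real (card (shadow Y)) - 1" by linarith
    then have "d * real (card (shadow Y')) \<le> d * (real (card (shadow Y)) - 1)" using assms(3) by (rule mult_left_mono)
    moreover have "\<Phi> Y' \<le> \<Phi> Y" using max[of Y'] Y unfolding Y'_def by auto
    ultimately show ?thesis unfolding \<Phi>_def c by (simp add: algebra_simps)
  qed
  then have "codeg_ge d Y" unfolding codeg_ge_def by blast
  moreover have "real (card X) - d * real (card (shadow X)) \<le> real (card Y)"
  proof -
    have "\<Phi> X \<le> \<Phi> Y" using max[of X] by simp
    moreover have "0 \<le> d * real (card (shadow Y))" using assms(3) by simp
    ultimately show ?thesis unfolding \<Phi>_def by linarith
  qed
  ultimately show ?thesis using Y by blast
qed

text \<open>Encoded as a union: the codegree condition survives unions, because a covered pair keeps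
  all edges of the subgraph that covers it.\<close>

definition core :: "'a set set \<Rightarrow> real \<Rightarrow> 'a set set" where
  "core E d = \<Union>{H. H \<subseteq> E \<and> codeg_ge d H}"

lemma core_subset: "core E d \<subseteq> E" unfolding core_def by auto

lemma core_greatest: "H \<subseteq> E \<Longrightarrow> codeg_ge d H \<Longrightarrow> H \<subseteq> core E d" unfolding core_def by auto

lemma codeg_ge_core: assumes "finite E" shows "codeg_ge d (core E d)"
  unfolding codeg_ge_def
proof
  fix f assume f: "f \<in> shadow (core E d)"
  then obtain e H where H: "e \<in> H" "f \<subseteq> e" "H \<subseteq> E" "codeg_ge d H" unfolding shadow_def core_def by auto
  then have "d \<le> real (card {e \<in> H. f \<subseteq> e})" using f unfolding codeg_ge_def shadow_def by auto
  also have "card {e \<in> H. f \<subseteq> e} \<le> card {e \<in> core E d. f \<subseteq> e}"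
    using core_greatest[OF H(3,4)] finite_subset[OF core_subset assms] by (intro card_mono) auto
  finally show "d \<le> real (card {e \<in> core E d. f \<subseteq> e})" by simp
qed

text \<open>The least \<open>I\<close> has \<open>2 ^ (I - 1) \<le> n\<close>. From
  \<open>ln 2 \<ge> 1 / 2\<close> follows \<open>I - 1 \<le> 2 * ln n\<close>, and
  \<open>1 \<le> ln n\<close> absorbs the last step; hence the constant 3.\<close>

lemma exists_pow2_log:
  assumes "3 \<le> n" shows "\<exists>I. 1 \<le> I \<and> n < 2 ^ I \<and> real I \<le> 3 * ln (real n)"
proof -
  have e3: "exp 1 \<le> (3::real)" using exp_bound[of 1] by simp
  define I where "I = (LEAST I. n < 2 ^ I)"
  have ex: "n < 2 ^ n" by (rule less_exp)
  have nI: "n < 2 ^ I" unfolding I_def using ex by (rule LeastI)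
  have "I \<noteq> 0" using nI assms by (intro notI) simp
  then obtain k where k: "I = Suc k" by (cases I) auto
  have "\<not> n < 2 ^ k" by (rule not_less_Least) (simp add: k flip: I_def)
  then have "real (2 ^ k) \<le> real n" by (intro of_nat_mono) simp
  then have "ln ((2::real) ^ k) \<le> ln (real n)" using assms by (subst ln_le_cancel_iff) auto
  then have "real k * ln 2 \<le> ln (real n)" by (simp add: ln_realpow)
  moreover have "real k * (1 / 2) \<le> real k * ln 2"
  proof (rule mult_left_mono)
    have "ln (exp 1) \<le> ln ((2::real) ^ 2)" using e3 by (subst ln_le_cancel_iff) auto
    also have "ln ((2::real) ^ 2) = 2 * ln 2" by (subst ln_realpow) auto
    finally show "1 / 2 \<le> ln (2::real)" by simp
  qed simp
  moreover have "1 \<le> ln (real n)"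
  proof -
    have "exp 1 \<le> real n" using e3 assms by linarith
    moreover have "0 < real n" using assms by simp
    ultimately show ?thesis using ln_ge_iff by blast
  qed
  ultimately have "real I \<le> 3 * ln (real n)" unfolding k by simp
  then show ?thesis using nI k by auto
qed

text \<open>The sizes of the cores at \<open>2 ^ i * t\<close> fall from
  \<open>t * n ^ 2 / 2\<close> or more to 0 in at most \<open>3 * ln n\<close> steps, so some step
  loses \<open>t * n ^ 2 / (6 * ln n)\<close> edges. By \<open>core_size\<close>, going from
  codegree \<open>d\<close> to \<open>2 * d\<close> loses at most \<open>2 * d\<close> edges per
  shadow pair, so a large loss forces a large shadow.\<close>

lemma core_pigeonhole:
  fixes t :: real
  assumes G: "three_graph V E" and n: "card V = n" "3 \<le> n" and E: "real (card E) = t * real n ^ 2" and t: "1 \<le> t"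
  shows "\<exists>H\<subseteq>E. \<exists>d. t \<le> d \<and> H \<noteq> {} \<and> (\<forall>f\<in>shadow H. d \<le> real (card (extenders H f))) \<and>
    t * real n ^ 2 / (6 * ln (real n)) \<le> real (card H) \<and>
    t * real n ^ 2 / (6 * ln (real n)) \<le> 2 * d * real (card (shadow H))"
proof -
  have V: "finite V" and EV: "\<And>e. e \<in> E \<Longrightarrow> e \<subseteq> V \<and> card e = 3" using G unfolding three_graph_def by auto
  have finE: "finite E" using V EV by (meson PowI finite_Pow_iff finite_subset subsetI)
  have E3: "\<And>e. e \<in> E \<Longrightarrow> card e = 3" using EV by blast
  obtain I where I: "1 \<le> I" "n < 2 ^ I" "real I \<le> 3 * ln (real n)" using exists_pow2_log[OF n(2)] by blast
  define g where "g i = real (card (core E (2 ^ i * t)))" for i :: nat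
  have sh: "real (card (shadow E)) \<le> real n ^ 2 / 2"
  proof -
    have "shadow E \<subseteq> {f. f \<subseteq> V \<and> card f = 2}" unfolding shadow_def using EV by blast
    then have "card (shadow E) \<le> card {f. f \<subseteq> V \<and> card f = 2}" using V by (intro card_mono) auto
    also have "\<dots> = n choose 2" using n_subsets[OF V, of 2] n by simp
    finally have "card (shadow E) * 2 \<le> n * (n - 1)" by (simp add: choose_two)
    then have "real (card (shadow E) * 2) \<le> real (n * (n - 1))" by (rule of_nat_mono)
    also have "\<dots> \<le> real n * real n" by (simp add: mult_left_mono)
    finally show ?thesis by (simp add: power2_eq_square)
  qed
  \<comment> \<open>There are at most \<open>n ^ 2 / 2\<close> pairs, so imposing codegree
    \<open>t\<close> deletes at most half of the edges.\<close>
  have g0: "t * real n ^ 2 / 2 \<le> g 0"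
  proof -
    obtain Y where Y: "Y \<subseteq> E" "codeg_ge t Y" "real (card E) - t * real (card (shadow E)) \<le> real (card Y)"
      using core_size[OF finE E3, of t] t by auto
    have "card Y \<le> card (core E t)"
      using core_greatest[OF Y(1,2)] finite_subset[OF core_subset finE] by (intro card_mono) auto
    moreover have "t * real (card (shadow E)) \<le> t * (real n ^ 2 / 2)" using sh t by (intro mult_left_mono) auto
    ultimately show ?thesis using Y(3) unfolding g_def E by simp
  qed
  \<comment> \<open>No codegree exceeds \<open>n\<close>, and \<open>2 ^ I * t > n\<close> because
    \<open>t \<ge> 1\<close>.\<close>
  have gI: "g I = 0"
  proof -
    have "core E (2 ^ I * t) = {}"
    proof (rule ccontr)
      assume "core E (2 ^ I * t) \<noteq> {}"
      then obtain e where e: "e \<in> core E (2 ^ I * t)" by auto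
      then have eE: "e \<in> E" using core_subset by blast
      have "2 \<le> card e" using E3[OF eE] by simp
      then obtain f where f: "f \<subseteq> e" "card f = 2" by (rule obtain_subset_with_card_n)
      then have "f \<in> shadow (core E (2 ^ I * t))" using e unfolding shadow_def by auto
      then have "2 ^ I * t \<le> real (card {e \<in> core E (2 ^ I * t). f \<subseteq> e})" using codeg_ge_core[OF finE] unfolding codeg_ge_def by blast
      also have "card {e \<in> core E (2 ^ I * t). f \<subseteq> e} = card (extenders (core E (2 ^ I * t)) f)"
        by (rule card_extenders[symmetric]) (use core_subset E3 f in auto)
      also have "card (extenders (core E (2 ^ I * t)) f) \<le> card V"
      proof (rule card_mono[OF V])
        show "extenders (core E (2 ^ I * t)) f \<subseteq> V"
          using EV core_subset[of E "2 ^ I * t"] unfolding extenders_def by blast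
      qed
      finally have "2 ^ I * t \<le> real n" using n by simp
      moreover have "2 ^ I * 1 \<le> 2 ^ I * t" using t by (intro mult_left_mono) auto
      moreover have "real n < 2 ^ I" using I(2) by (metis of_nat_less_iff of_nat_numeral of_nat_power)
      ultimately show False by linarith
    qed
    then show ?thesis unfolding g_def by simp
  qed
  define m where "m = t * real n ^ 2 / (6 * ln (real n))"
  have ln0: "0 < ln (real n)" using n by simp
  have "\<exists>i<I. m \<le> g i - g (Suc i)"
  proof (rule ccontr)
    assume "\<not> ?thesis"
    then have lt: "g i - g (Suc i) < m" if "i < I" for i using that by force
    have "g 0 - g I = (\<Sum>i<I. g i - g (Suc i))" by (simp add: sum_lessThan_telescope')
    also have "\<dots> < (\<Sum>i<I. m)" 
    proof (rule sum_strict_mono)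
      show "{..<I} \<noteq> {}" using I(1) by (auto simp: lessThan_empty_iff)
    qed (use lt in auto)
    also have "\<dots> = real I * m" by simp
    also have "\<dots> \<le> (3 * ln (real n)) * m" using I(3) ln0 t unfolding m_def by (intro mult_right_mono) auto
    also have "\<dots> = t * real n ^ 2 / 2" unfolding m_def using ln0 by simp
    finally show False using g0 gI by simp
  qed
  then obtain i where i: "m \<le> g i - g (Suc i)" by blast
  define d where "d = 2 ^ i * t"
  define H where "H = core E d"
  have td: "t \<le> d" unfolding d_def using t by (simp add: mult_le_cancel_right1)
  have HE: "H \<subseteq> E" unfolding H_def by (rule core_subset)
  have finH: "finite H" using HE finE finite_subset by blast
  have H3: "\<And>e. e \<in> H \<Longrightarrow> card e = 3" using HE E3 by auto
  have mpos: "0 < m" unfolding m_def using t n ln0 by simp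
  have gs0: "0 \<le> g (Suc i)" unfolding g_def by simp
  have cH: "m \<le> real (card H)" using i gs0 unfolding g_def H_def d_def by linarith
  then have Hne: "H \<noteq> {}" using mpos by auto
  have "\<forall>f\<in>shadow H. d \<le> real (card (extenders H f))"
  proof
    fix f assume f: "f \<in> shadow H"
    then have "card f = 2" unfolding shadow_def by auto
    then show "d \<le> real (card (extenders H f))"
      using codeg_ge_core[OF finE, of d] f card_extenders[OF H3] unfolding codeg_ge_def H_def by auto
  qed
  moreover have "m \<le> 2 * d * real (card (shadow H))"
  proof -
    obtain Y where Y: "Y \<subseteq> H" "codeg_ge (2 * d) Y" "real (card H) - 2 * d * real (card (shadow H)) \<le> real (card Y)"
      using core_size[OF finH H3, of "2 * d"] t td by auto
    have "Y \<subseteq> core E (2 * d)" by (rule core_greatest) (use Y HE in auto)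
    then have "card Y \<le> card (core E (2 * d))" using finite_subset[OF core_subset finE] by (intro card_mono) auto
    then have "real (card Y) \<le> g (Suc i)" unfolding g_def d_def by (simp add: mult_ac)
    then show ?thesis using i Y(3) unfolding g_def[of i] H_def d_def[symmetric] by linarith
  qed
  ultimately show ?thesis using td HE Hne cH unfolding m_def by blast
qed

section \<open>Random fans in a core\<close>

locale codegree_core =
  fixes H :: "'a set set" and d :: real and l :: nat
  assumes finite_H: "finite H" and card_H: "e \<in> H \<Longrightarrow> card e = 3" and H_ne: "H \<noteq> {}"
    and l_ge: "2 \<le> l" and d_ge: "24 * real l ^ 2 \<le> d" and codeg: "f \<in> shadow H \<Longrightarrow> d \<le> real (card (extenders H f))"
begin

definition V :: "'a set" where "V = \<Union>H"

text \<open>The degree of \<open>a\<close> in the link of \<open>c\<close>; \<open>stp c\<close> is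
  the simple random walk on that link and \<open>cw c\<close> the probability of a walk given its
  first vertex.\<close>

definition deg :: "'a \<Rightarrow> 'a \<Rightarrow> real" where "deg c a = real (card (extenders H {c, a}))"

definition stp :: "'a \<Rightarrow> 'a \<Rightarrow> 'a \<Rightarrow> real" where
  "stp c a b = (if {c, a, b} \<in> H then 1 / deg c a else 0)"

fun cw :: "'a \<Rightarrow> 'a list \<Rightarrow> real" where
  "cw c (a # b # L) = stp c a b * cw c (b # L)"
| "cw c L = 1"

text \<open>The number of ordered triples spanning a hyperedge, which normalises
  \<open>mu\<close>.\<close>

definition T :: real where "T = (\<Sum>c\<in>V. \<Sum>a\<in>V. deg c a)"

text \<open>A stationary random walk in the link of \<open>u ! 0\<close>, which is itself chosen proportionally to its degree.\<close>

definition mu :: "'a list \<Rightarrow> real" where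
  "mu u = deg (u ! 0) (u ! 1) / T * cw (u ! 0) (tl u)"

lemma d_pos: "0 < d" "1 \<le> d"
proof -
  have "1 \<le> 24 * real l ^ 2" using l_ge by (simp add: power2_eq_square mult_ge1_I)
  then show "0 < d" "1 \<le> d" using d_ge by auto
qed

lemma finite_V: "finite V"
  unfolding V_def using finite_H card_H by (intro finite_Union) (auto intro: card_ge_0_finite)

lemma triple_distinct: assumes "{c, a, b} \<in> H" shows "c \<noteq> a" "c \<noteq> b" "a \<noteq> b"
  using card_H[OF assms] by (auto simp: card_insert_if split: if_splits)

lemma triple_in_V: "{c, a, b} \<in> H \<Longrightarrow> c \<in> V \<and> a \<in> V \<and> b \<in> V"
  unfolding V_def by blast

lemma triple_shadow: assumes "{c, a, b} \<in> H" shows "{c, a} \<in> shadow H" "{c, b} \<in> shadow H" "{a, b} \<in> shadow H"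
  using triple_distinct[OF assms] unfolding shadow_def by (auto intro!: bexI[OF _ assms])

lemma deg_nonneg: "0 \<le> deg c a" unfolding deg_def by simp

lemma deg_sym: "deg c a = deg a c" unfolding deg_def by (simp add: insert_commute)

lemma deg_ge: "{c, a, b} \<in> H \<Longrightarrow> d \<le> deg c a"
  unfolding deg_def by (rule codeg) (rule triple_shadow)

lemma extenders_pair: "extenders H {c, a} = {b. {c, a, b} \<in> H}"
proof -
  have "b \<notin> {c, a}" if "{c, a, b} \<in> H" for b using triple_distinct[OF that] by auto
  then show ?thesis unfolding extenders_def by (auto simp: insert_commute)
qed

lemma sum_triple: "(\<Sum>b\<in>V. if {c, a, b} \<in> H then 1 else 0) = deg c a"
proof -
  have "{b \<in> V. {c, a, b} \<in> H} = extenders H {c, a}" unfolding extenders_pair using triple_in_V by auto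
  then show ?thesis unfolding deg_def using sum.inter_filter[OF finite_V, of "\<lambda>_. 1::real" "\<lambda>b. {c, a, b} \<in> H"] by simp
qed

lemma stp_nonneg: "0 \<le> stp c a b" unfolding stp_def using deg_nonneg by auto

lemma sum_stp: "(\<Sum>b\<in>V. stp c a b) = (if deg c a = 0 then 0 else 1)"
proof -
  have "(\<Sum>b\<in>V. stp c a b) = (\<Sum>b\<in>V. (if {c, a, b} \<in> H then 1 else 0) / deg c a)"
    by (rule sum.cong) (auto simp: stp_def)
  then show ?thesis using sum_triple[of c a] by (simp flip: sum_divide_distrib)
qed

lemma stp_le: "stp c a b \<le> 1 / d"
proof (cases "{c, a, b} \<in> H")
  case True
  then show ?thesis unfolding stp_def using deg_ge[OF True] d_pos by (simp add: frac_le)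
qed (use d_pos in \<open>simp add: stp_def\<close>)

lemma deg_stp: "deg c a * stp c a b = (if {c, a, b} \<in> H then 1 else 0)"
  unfolding stp_def using deg_ge[of c a b] d_pos by auto

lemma deg_stp_sym: "deg c a * stp c a b = deg c b * stp c b a"
  unfolding deg_stp by (simp add: insert_commute)

lemma cw_nonneg: "0 \<le> cw c L"
  by (induction c L rule: cw.induct) (auto simp: stp_nonneg)

lemma cw_append: "A \<noteq> [] \<Longrightarrow> B \<noteq> [] \<Longrightarrow> cw c (A @ B) = cw c A * stp c (last A) (hd B) * cw c B"
proof (induction c A rule: cw.induct)
  case ("2_2" c a)
  then show ?case by (cases B) auto
qed auto

text \<open>Detailed balance: with respect to \<open>deg c\<close>, each step in the link of
  \<open>c\<close> has the same flow in both directions.\<close>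

lemma cw_rev: "A \<noteq> [] \<Longrightarrow> deg c (hd A) * cw c A = deg c (last A) * cw c (rev A)"
proof (induction c A rule: cw.induct)
  case (1 c a b L)
  have IH: "deg c b * cw c (b # L) = deg c (last (b # L)) * cw c (rev (b # L))" using 1 by simp
  have "cw c (rev (b # L) @ [a]) = cw c (rev (b # L)) * stp c (last (rev (b # L))) (hd [a]) * cw c [a]"
    by (rule cw_append) auto
  then have r: "cw c (rev (a # b # L)) = cw c (rev (b # L)) * stp c b a" by simp
  have "deg c a * cw c (a # b # L) = (deg c a * stp c a b) * cw c (b # L)" by simp
  also have "\<dots> = stp c b a * (deg c b * cw c (b # L))" unfolding deg_stp_sym[of c a b] by simp
  also have "\<dots> = deg c (last (b # L)) * (cw c (rev (b # L)) * stp c b a)" unfolding IH by simp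
  finally show ?case unfolding r by simp
qed auto

text \<open>By reversibility the walk may be started at any of its steps: that step is a uniform
  ordered edge of the link, and the two pieces run outwards from it independently.\<close>

lemma cw_split:
  assumes "A \<noteq> []" "B \<noteq> []"
  shows "deg c (hd A) * cw c (A @ B) = (if {c, last A, hd B} \<in> H then 1 else 0) * cw c (rev A) * cw c B"
proof -
  have "deg c (hd A) * cw c (A @ B) = (deg c (hd A) * cw c A) * stp c (last A) (hd B) * cw c B"
    using cw_append[OF assms] by simp
  also have "\<dots> = (deg c (last A) * stp c (last A) (hd B)) * cw c (rev A) * cw c B" unfolding cw_rev[OF assms(1)] by simp
  finally show ?thesis unfolding deg_stp .
qed

lemma walk_sum:
  assumes "x \<in> V" "Z \<subseteq> {1..<Suc r}"
  shows "(\<Sum>R\<in>nlists V r. if \<forall>k\<in>Z. (x # R) ! k = a k then cw c (x # R) else 0) \<le> (1 / d) ^ card Z"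
proof -
  have P: "[x] \<in> nlists V 1" using assms by (simp add: nlists_def)
  have sn: "cw c (L @ [v]) = cw c L * stp c (last L) v" if "1 \<le> length L" for L :: "'a list" and v
  proof -
    have "L \<noteq> []" using that by auto
    from cw_append[OF this, of "[v]" c] show ?thesis by simp
  qed
  have "(\<Sum>R\<in>nlists V r. if \<forall>k\<in>Z. ([x] @ R) ! k = a k then cw c ([x] @ R) else 0) \<le> cw c [x] * (\<Prod>k\<in>Z. 1 / d)"
  proof (rule chain_sum[OF finite_V P])
    show "\<And>L. 0 \<le> cw c L" by (rule cw_nonneg)
    show "\<And>k. 0 \<le> 1 / d" using d_pos by simp
    show "Z \<subseteq> {1..<1 + r}" using assms by simp
    fix L :: "'a list" assume L: "1 \<le> length L"
    have "(\<Sum>v\<in>V. cw c (L @ [v])) = cw c L * (\<Sum>v\<in>V. stp c (last L) v)" unfolding sn[OF L] by (simp add: sum_distrib_left)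
    also have "\<dots> \<le> cw c L * 1" unfolding sum_stp using cw_nonneg[of c L] by auto
    finally show "(\<Sum>v\<in>V. cw c (L @ [v])) \<le> cw c L" by simp
    show "cw c (L @ [v]) \<le> 1 / d * cw c L" for v
      unfolding sn[OF L] using mult_left_mono[OF stp_le cw_nonneg, of c L c "last L" v] by (simp add: mult_ac)
  qed
  then show ?thesis unfolding append_Cons append_Nil by simp
qed

lemma walk_total: "deg c x \<noteq> 0 \<Longrightarrow> (\<Sum>R\<in>nlists V r. cw c (x # R)) = 1"
proof (induction r)
  case 0
  then show ?case by (simp add: nlists_0)
next
  case (Suc r)
  have "(\<Sum>R\<in>nlists V (Suc r). cw c (x # R)) = (\<Sum>R\<in>nlists V r. \<Sum>v\<in>V. cw c ((x # R) @ [v]))"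
    by (simp add: sum_nlists_snoc)
  also have "\<dots> = (\<Sum>R\<in>nlists V r. cw c (x # R))"
  proof (rule sum.cong[OF refl])
    fix R
    have "(\<Sum>v\<in>V. cw c ((x # R) @ [v])) = cw c (x # R) * (\<Sum>v\<in>V. stp c (last (x # R)) v)"
      using cw_append[of "x # R" _ c] by (simp add: sum_distrib_left del: append_Cons)
    also have "\<dots> = cw c (x # R)"
    proof (cases "cw c (x # R) = 0")
      case False
      have "deg c (last (x # R)) \<noteq> 0"
      proof (cases "R = []")
        case True then show ?thesis using Suc.prems by simp
      next
        case R: False
        have "x # R = butlast (x # R) @ [last R]" using R by simp
        then have "cw c (x # R) = cw c (butlast (x # R)) * stp c (last (butlast (x # R))) (last R)"
          using cw_append[of "butlast (x # R)" "[last R]" c] R by simp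
        then have "stp c (last (butlast (x # R))) (last R) \<noteq> 0" using False by auto
        then have "{c, last (butlast (x # R)), last R} \<in> H" unfolding stp_def by (auto split: if_splits)
        then have "{c, last R, last (butlast (x # R))} \<in> H" by (simp add: insert_commute)
        then show ?thesis using deg_ge d_pos R by fastforce
      qed
      then show ?thesis unfolding sum_stp by simp
    qed simp
    finally show "(\<Sum>v\<in>V. cw c ((x # R) @ [v])) = cw c (x # R)" .
  qed
  finally show ?case using Suc by simp
qed

lemma T_ge: "real (card H) \<le> T"
proof -
  define X where "X = (SIGMA c:V. SIGMA a:V. extenders H {c, a})"
  have fx: "finite (extenders H f)" for f
    unfolding extenders_def by (rule finite_subset[OF _ finite_V]) (auto simp: V_def)
  have finX: "finite X" unfolding X_def using finite_V fx by (intro finite_SigmaI) auto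
  have "real (card X) = T"
    unfolding X_def T_def deg_def using finite_V fx by (simp add: card_SigmaI)
  moreover have "H \<subseteq> (\<lambda>(c, a, b). {c, a, b}) ` X"
  proof
    fix e assume e: "e \<in> H"
    then obtain c a b where abc: "e = {c, a, b}" using card_H[OF e] by (metis card_3_iff)
    then have "(c, a, b) \<in> X" unfolding X_def extenders_pair using e triple_in_V by auto
    then show "e \<in> (\<lambda>(c, a, b). {c, a, b}) ` X" unfolding abc by force
  qed
  then have "card H \<le> card X" using finX by (rule surj_card_le[rotated])
  ultimately show ?thesis by simp
qed

lemma T_pos: "0 < T"
proof -
  have "0 < card H" using H_ne finite_H by (simp add: card_gt_0_iff)
  then show ?thesis using T_ge by linarith
qed

lemma mu_nonneg: "0 \<le> mu u"
  unfolding mu_def using deg_nonneg T_pos cw_nonneg by simp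

lemma sum_nlists_cons2: "(\<Sum>u\<in>nlists V (2 * l). f u) = (\<Sum>c\<in>V. \<Sum>x\<in>V. \<Sum>R\<in>nlists V (2 * l - 2). f (c # x # R))"
proof -
  have "2 * l = Suc 0 + (Suc 0 + (2 * l - 2))" using l_ge by simp
  then have "(\<Sum>u\<in>nlists V (2 * l). f u) = (\<Sum>u\<in>nlists V (Suc 0 + (Suc 0 + (2 * l - 2))). f u)" by simp
  then show ?thesis unfolding sum_nlists_append sum_nlists_1 by simp
qed

lemma sum_mu: "(\<Sum>u\<in>nlists V (2 * l). mu u) = 1"
proof -
  have "(\<Sum>u\<in>nlists V (2 * l). mu u) = (\<Sum>c\<in>V. \<Sum>x\<in>V. deg c x / T * (\<Sum>R\<in>nlists V (2 * l - 2). cw c (x # R)))"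
    unfolding sum_nlists_cons2 mu_def by (simp add: sum_distrib_left)
  also have "\<dots> = (\<Sum>c\<in>V. \<Sum>x\<in>V. deg c x / T)"
  proof (intro sum.cong refl)
    fix c x show "deg c x / T * (\<Sum>R\<in>nlists V (2 * l - 2). cw c (x # R)) = deg c x / T"
      using walk_total[of c x] by (cases "deg c x = 0") auto
  qed
  also have "\<dots> = T / T" unfolding T_def sum_divide_distrib ..
  finally show ?thesis using T_pos by simp
qed

text \<open>The fixed edge joins the centre to the first vertex of the link walk and has weight
  \<open>deg e0 e1 / T\<close>; what follows is an ordinary walk, with price at most
  \<open>1 / d\<close> per prescribed vertex.\<close>

lemma spread_0:
  assumes Z: "Z \<subseteq> {2..<2 * l}" and "e1 \<in> V"
  shows "(\<Sum>u\<in>nlists V (2 * l). if u ! 0 = e0 \<and> u ! 1 = e1 \<and> (\<forall>k\<in>Z. u ! k = a k) then mu u else 0)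
    \<le> deg e0 e1 / T * (1 / d) ^ card Z"
proof -
  define Z' where "Z' = (\<lambda>k. k - 1) ` Z"
  have cZ: "card Z' = card Z" unfolding Z'_def by (rule card_image) (use Z in \<open>force simp: inj_on_def\<close>)
  have Z': "Z' \<subseteq> {1..<Suc (2 * l - 2)}" unfolding Z'_def using Z by force
  define s where "s = (\<Sum>R\<in>nlists V (2 * l - 2). if \<forall>k\<in>Z'. (e1 # R) ! k = a (Suc k) then cw e0 (e1 # R) else 0)"
  have s: "s \<le> (1 / d) ^ card Z" unfolding s_def using walk_sum[OF assms(2) Z'] cZ by simp
  have "(\<Sum>u\<in>nlists V (2 * l). if u ! 0 = e0 \<and> u ! 1 = e1 \<and> (\<forall>k\<in>Z. u ! k = a k) then mu u else 0)
    = (\<Sum>c\<in>V. \<Sum>x\<in>V. if c = e0 \<and> x = e1 then deg e0 e1 / T * s else 0)"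
    unfolding sum_nlists_cons2
  proof (intro sum.cong refl)
    fix c x
    have Zk: "(\<forall>k\<in>Z. (c # x # R) ! k = a k) \<longleftrightarrow> (\<forall>k\<in>Z'. (x # R) ! k = a (Suc k))" for R
    proof -
      have "(c # x # R) ! k = (x # R) ! (k - 1)" "Suc (k - 1) = k" if "k \<in> Z" for k
        using that Z by (auto simp: nth_Cons')
      then show ?thesis unfolding Z'_def by auto
    qed
    show "(\<Sum>R\<in>nlists V (2 * l - 2). if (c # x # R) ! 0 = e0 \<and> (c # x # R) ! 1 = e1 \<and> (\<forall>k\<in>Z. (c # x # R) ! k = a k) then mu (c # x # R) else 0)
      = (if c = e0 \<and> x = e1 then deg e0 e1 / T * s else 0)"
    proof (cases "c = e0 \<and> x = e1")
      case True
      then show ?thesis unfolding Zk s_def sum_distrib_left mu_def by (auto intro!: sum.cong)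
    next
      case False
      then show ?thesis by (auto intro!: sum.neutral)
    qed
  qed
  also have "\<dots> \<le> deg e0 e1 / T * (1 / d) ^ card Z"
  proof -
    have q: "0 \<le> deg e0 e1 / T * (1 / d) ^ card Z" using deg_nonneg T_pos d_pos by simp
    have s': "deg e0 e1 / T * s \<le> deg e0 e1 / T * (1 / d) ^ card Z"
      using s deg_nonneg T_pos by (intro mult_left_mono) auto
    have "(\<Sum>c\<in>V. \<Sum>x\<in>V. if c = e0 \<and> x = e1 then deg e0 e1 / T * s else 0) = (\<Sum>c\<in>V. if c = e0 then deg e0 e1 / T * s else 0)"
      using finite_V assms(2) by (intro sum.cong refl) (auto simp: sum.delta)
    also have "\<dots> \<le> deg e0 e1 / T * (1 / d) ^ card Z" using finite_V q s' by (simp add: sum.delta)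
    finally show ?thesis .
  qed
  finally show ?thesis .
qed

definition rv :: "'a list \<Rightarrow> 'a list" where "rv u = hd u # rev (tl u)"

lemma rv_props:
  assumes "u \<in> nlists V (2 * l)"
  shows "rv u \<in> nlists V (2 * l)" "rv (rv u) = u" "rv u ! 0 = u ! 0"
    "\<And>k. 1 \<le> k \<Longrightarrow> k < 2 * l \<Longrightarrow> rv u ! k = u ! (2 * l - k)" "mu (rv u) = mu u"
proof -
  have len: "length u = 2 * l" "set u \<subseteq> V" using assms by (auto simp: nlists_def)
  then obtain h w where hw: "u = h # w" using l_ge by (cases u) auto
  have lw: "length w = 2 * l - 1" "w \<noteq> []" using len hw l_ge by auto
  show "rv u \<in> nlists V (2 * l)" "rv (rv u) = u" "rv u ! 0 = u ! 0" using len hw by (auto simp: rv_def nlists_def)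
  show "rv u ! k = u ! (2 * l - k)" if "1 \<le> k" "k < 2 * l" for k
  proof -
    define k' where "k' = k - 1"
    have k': "k = Suc k'" using that(1) unfolding k'_def by simp
    have "2 * l - k = Suc (length w - Suc k')" using k' lw that by simp
    moreover have "rev w ! k' = w ! (length w - Suc k')" using k' lw that by (intro rev_nth) auto
    ultimately show ?thesis unfolding rv_def hw k' by simp
  qed
  have "deg h (hd w) * cw h w = deg h (last w) * cw h (rev w)" by (rule cw_rev[OF lw(2)])
  moreover have "w ! 0 = hd w" "rev w ! 0 = last w" using lw(2) by (auto simp: hd_conv_nth[symmetric] hd_rev)
  ultimately show "mu (rv u) = mu u" unfolding mu_def rv_def hw by simp
qed

lemma sum_rv: "(\<Sum>u\<in>nlists V (2 * l). f (rv u)) = (\<Sum>u\<in>nlists V (2 * l). f u)"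
  by (rule sum.reindex_bij_witness[where i=rv and j=rv]) (auto simp: rv_props)

text \<open>With an edge of the link walk fixed, the centre becomes the unknown: it is uniform among
  the extenders of \<open>{e0, e1}\<close>, so prescribing position 0 also costs at most
  \<open>1 / d\<close>. The two pieces of the walk leave the edge as in
  \<open>cw_split\<close>.\<close>

lemma spread_mid:
  assumes p: "1 \<le> p" "p + 2 \<le> 2 * l" and Z: "Z \<subseteq> {..<2 * l} - {p, Suc p}" and e: "e0 \<in> V" "e1 \<in> V"
  shows "(\<Sum>u\<in>nlists V (2 * l). if u ! p = e0 \<and> u ! Suc p = e1 \<and> (\<forall>k\<in>Z. u ! k = a k) then mu u else 0)
    \<le> deg e0 e1 / T * (1 / d) ^ card Z"
proof -
  define q where "q = 2 * l - p - 2"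
  \<comment> \<open>The prescribed positions fall into the centre, those before the edge, counted
    backwards from it, and those after the edge.\<close>
  define Z0 where "Z0 = Z \<inter> {0}"
  define ZA where "ZA = (\<lambda>k. p - k) ` (Z \<inter> {1..<p})"
  define ZB where "ZB = (\<lambda>k. k - Suc p) ` (Z \<inter> {p + 2..<2 * l})"
  have finZ: "finite Z" using Z finite_subset by blast
  have cA: "card ZA = card (Z \<inter> {1..<p})" unfolding ZA_def by (rule card_image) (auto simp: inj_on_def)
  have cB: "card ZB = card (Z \<inter> {p + 2..<2 * l})" unfolding ZB_def by (rule card_image) (auto simp: inj_on_def)
  have Zeq: "Z = Z0 \<union> ((Z \<inter> {1..<p}) \<union> (Z \<inter> {p + 2..<2 * l}))"
  proof
    show "Z \<subseteq> Z0 \<union> ((Z \<inter> {1..<p}) \<union> (Z \<inter> {p + 2..<2 * l}))"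
    proof
      fix k assume k: "k \<in> Z"
      then have "k < 2 * l" "k \<noteq> p" "k \<noteq> Suc p" using Z by auto
      then have "k = 0 \<or> (1 \<le> k \<and> k < p) \<or> (p + 2 \<le> k \<and> k < 2 * l)" by linarith
      then show "k \<in> Z0 \<union> ((Z \<inter> {1..<p}) \<union> (Z \<inter> {p + 2..<2 * l}))" using k unfolding Z0_def by auto
    qed
  qed (auto simp: Z0_def)
  have "card Z = card Z0 + (card (Z \<inter> {1..<p}) + card (Z \<inter> {p + 2..<2 * l}))"
  proof -
    have "card (Z0 \<union> ((Z \<inter> {1..<p}) \<union> (Z \<inter> {p + 2..<2 * l}))) = card Z0 + card ((Z \<inter> {1..<p}) \<union> (Z \<inter> {p + 2..<2 * l}))"
      by (rule card_Un_disjoint) (auto simp: Z0_def finZ)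
    moreover have "card ((Z \<inter> {1..<p}) \<union> (Z \<inter> {p + 2..<2 * l})) = card (Z \<inter> {1..<p}) + card (Z \<inter> {p + 2..<2 * l})"
      by (rule card_Un_disjoint) (auto simp: finZ)
    ultimately show ?thesis using Zeq by simp
  qed
  then have cZ: "card Z = card Z0 + (card ZA + card ZB)" using cA cB by simp
  have ZA: "ZA \<subseteq> {1..<Suc (p - 1)}" unfolding ZA_def using p by auto
  have ZB: "ZB \<subseteq> {1..<Suc q}" unfolding ZB_def q_def using p by auto
  define sA where "sA c = (\<Sum>R\<in>nlists V (p - 1). if \<forall>k\<in>ZA. (e0 # R) ! k = a (p - k) then cw c (e0 # R) else 0)" for c
  define sB where "sB c = (\<Sum>R\<in>nlists V q. if \<forall>k\<in>ZB. (e1 # R) ! k = a (k + Suc p) then cw c (e1 # R) else 0)" for c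
  have sA: "sA c \<le> (1 / d) ^ card ZA" "0 \<le> sA c" for c
    unfolding sA_def using walk_sum[OF e(1) ZA] cw_nonneg by (auto intro: sum_nonneg)
  have sB: "sB c \<le> (1 / d) ^ card ZB" "0 \<le> sB c" for c
    unfolding sB_def using walk_sum[OF e(2) ZB] cw_nonneg by (auto intro: sum_nonneg)
  define F where "F u = (if u ! p = e0 \<and> u ! Suc p = e1 \<and> (\<forall>k\<in>Z. u ! k = a k) then mu u else 0)" for u
  have n: "2 * l = Suc 0 + ((p - 1 + Suc 0) + (Suc 0 + q))" using p unfolding q_def by simp
  have "(\<Sum>u\<in>nlists V (2 * l). F u) =
      (\<Sum>c\<in>V. \<Sum>A\<in>nlists V (p - 1). \<Sum>x\<in>V. \<Sum>y\<in>V. \<Sum>B\<in>nlists V q. F (c # (A @ [x]) @ (y # B)))"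
    unfolding n sum_nlists_append sum_nlists_1 by simp
  \<comment> \<open>The piece before the edge is summed in reverse order, so that both pieces start
    at the edge.\<close>
  also have "\<dots> = (\<Sum>c\<in>V. \<Sum>A\<in>nlists V (p - 1). \<Sum>x\<in>V. \<Sum>y\<in>V. \<Sum>B\<in>nlists V q. F (c # (rev A @ [x]) @ (y # B)))"
  proof (rule sum.cong[OF refl])
    fix c
    show "(\<Sum>A\<in>nlists V (p - 1). \<Sum>x\<in>V. \<Sum>y\<in>V. \<Sum>B\<in>nlists V q. F (c # (A @ [x]) @ (y # B)))
      = (\<Sum>A\<in>nlists V (p - 1). \<Sum>x\<in>V. \<Sum>y\<in>V. \<Sum>B\<in>nlists V q. F (c # (rev A @ [x]) @ (y # B)))"
      by (rule sum.reindex_bij_witness[where i=rev and j=rev]) (auto simp: nlists_def)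
  qed
  also have "\<dots> = (\<Sum>c\<in>V. \<Sum>A\<in>nlists V (p - 1). \<Sum>B\<in>nlists V q. F (c # (rev A @ [e0]) @ (e1 # B)))"
  proof (intro sum.cong refl)
    fix c A assume A: "A \<in> nlists V (p - 1)"
    then have lA: "length A = p - 1" by (simp add: nlists_def)
    have nth: "(c # (rev A @ [x]) @ (y # B)) ! p = x" "(c # (rev A @ [x]) @ (y # B)) ! Suc p = y" for x y B
    proof -
      have "(c # (rev A @ [x]) @ (y # B)) = (c # rev A) @ x # y # B" "length (c # rev A) = p" using lA p by auto
      then show "(c # (rev A @ [x]) @ (y # B)) ! p = x" by (metis nth_append_length)
      have "(c # (rev A @ [x]) @ (y # B)) = (c # rev A @ [x]) @ y # B" "length (c # rev A @ [x]) = Suc p" using lA p by auto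
      then show "(c # (rev A @ [x]) @ (y # B)) ! Suc p = y" by (metis nth_append_length)
    qed
    have "(\<Sum>x\<in>V. \<Sum>y\<in>V. \<Sum>B\<in>nlists V q. F (c # (rev A @ [x]) @ (y # B))) =
      (\<Sum>x\<in>V. \<Sum>y\<in>V. if x = e0 \<and> y = e1 then (\<Sum>B\<in>nlists V q. F (c # (rev A @ [e0]) @ (e1 # B))) else 0)"
    proof (intro sum.cong refl)
      fix x y
      show "(\<Sum>B\<in>nlists V q. F (c # (rev A @ [x]) @ (y # B))) =
        (if x = e0 \<and> y = e1 then (\<Sum>B\<in>nlists V q. F (c # (rev A @ [e0]) @ (e1 # B))) else 0)"
      proof (cases "x = e0 \<and> y = e1")
        case False
        then have "F (c # (rev A @ [x]) @ (y # B)) = 0" for B unfolding F_def nth by auto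
        then have "(\<Sum>B\<in>nlists V q. F (c # (rev A @ [x]) @ (y # B))) = 0" by simp
        then show ?thesis using False by (simp only: if_False)
      qed simp
    qed
    also have "\<dots> = (\<Sum>B\<in>nlists V q. F (c # (rev A @ [e0]) @ (e1 # B)))"
    proof -
      have "(\<Sum>y\<in>V. if x = e0 \<and> y = e1 then S else 0) = (if x = e0 then S else 0)" for x and S :: real
        using finite_V e by (cases "x = e0") (auto simp: sum.delta)
      then show ?thesis using finite_V e by (simp add: sum.delta)
    qed
    finally show "(\<Sum>x\<in>V. \<Sum>y\<in>V. \<Sum>B\<in>nlists V q. F (c # (rev A @ [x]) @ (y # B))) = (\<Sum>B\<in>nlists V q. F (c # (rev A @ [e0]) @ (e1 # B)))" .
  qed
  also have "\<dots> \<le> (\<Sum>c\<in>V. \<Sum>A\<in>nlists V (p - 1). \<Sum>B\<in>nlists V q.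
      ((if Z0 = {} \<or> c = a 0 then 1 else 0) * (if {c, e0, e1} \<in> H then 1 else 0) / T) *
      ((if \<forall>k\<in>ZA. (e0 # A) ! k = a (p - k) then cw c (e0 # A) else 0) *
       (if \<forall>k\<in>ZB. (e1 # B) ! k = a (k + Suc p) then cw c (e1 # B) else 0)))"
  proof (intro sum_mono)
    fix c A B assume A: "A \<in> nlists V (p - 1)" and B: "B \<in> nlists V q"
    then have lA: "length A = p - 1" by (simp add: nlists_def)
    define u where "u = c # (rev A @ [e0]) @ (e1 # B)"
    have u0: "u ! 0 = c" unfolding u_def by simp
    have uA: "u ! (p - k) = (e0 # A) ! k" if "k < p" for k
    proof -
      have "(rev A @ [e0]) = rev (e0 # A)" by simp
      moreover have "p - k = Suc (p - Suc k)" using that by simp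
      ultimately have "u ! (p - k) = (rev (e0 # A) @ (e1 # B)) ! (p - Suc k)" unfolding u_def by simp
      also have "\<dots> = rev (e0 # A) ! (p - Suc k)" using that lA p by (subst nth_append) auto
      also have "\<dots> = (e0 # A) ! (length (e0 # A) - Suc (p - Suc k))" using that lA p by (intro rev_nth) auto
      also have "length (e0 # A) - Suc (p - Suc k) = k" using that lA p by simp
      finally show ?thesis .
    qed
    have uB: "u ! (k + Suc p) = (e1 # B) ! k" for k
    proof -
      have "u = (c # rev A @ [e0]) @ (e1 # B)" "length (c # rev A @ [e0]) = Suc p" unfolding u_def using lA p by auto
      then show ?thesis by (metis add.commute nth_append_length_plus)
    qed
    have mu: "mu u = (if {c, e0, e1} \<in> H then 1 else 0) / T * (cw c (e0 # A) * cw c (e1 # B))"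
    proof -
      have "u ! 1 = hd (rev A @ [e0])" unfolding u_def by (cases "rev A") auto
      then have "mu u = (deg c (hd (rev A @ [e0])) * cw c ((rev A @ [e0]) @ (e1 # B))) / T"
        unfolding mu_def u0 by (simp add: u_def)
      also have "\<dots> = ((if {c, last (rev A @ [e0]), hd (e1 # B)} \<in> H then 1 else 0) * cw c (rev (rev A @ [e0])) * cw c (e1 # B)) / T"
        by (subst cw_split) auto
      finally show ?thesis by simp
    qed
    show "F u \<le> ((if Z0 = {} \<or> c = a 0 then 1 else 0) * (if {c, e0, e1} \<in> H then 1 else 0) / T) *
      ((if \<forall>k\<in>ZA. (e0 # A) ! k = a (p - k) then cw c (e0 # A) else 0) *
       (if \<forall>k\<in>ZB. (e1 # B) ! k = a (k + Suc p) then cw c (e1 # B) else 0))" (is "_ \<le> ?rhs")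
    proof (cases "\<forall>k\<in>Z. u ! k = a k")
      case False
      then have "F u = 0" unfolding F_def by auto
      moreover have "0 \<le> ?rhs" using cw_nonneg T_pos by simp
      ultimately show ?thesis by simp
    next
      case True
      have 0: "Z0 = {} \<or> c = a 0" using True u0 unfolding Z0_def by auto
      have 1: "\<forall>k\<in>ZA. (e0 # A) ! k = a (p - k)"
      proof
        fix k assume "k \<in> ZA"
        then obtain j where j: "j \<in> Z" "1 \<le> j" "j < p" "k = p - j" unfolding ZA_def by auto
        then have "(e0 # A) ! k = u ! (p - k)" using uA[of k] by simp
        then show "(e0 # A) ! k = a (p - k)" using True j by simp
      qed
      have 2: "\<forall>k\<in>ZB. (e1 # B) ! k = a (k + Suc p)"
      proof
        fix k assume "k \<in> ZB"
        then obtain j where j: "j \<in> Z" "p + 2 \<le> j" "k = j - Suc p" unfolding ZB_def by auto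
        then have "k + Suc p = j" by simp
        then show "(e1 # B) ! k = a (k + Suc p)" using uB[of k] True j by simp
      qed
      have "F u \<le> mu u" unfolding F_def using mu_nonneg by auto
      also have "mu u = ?rhs" unfolding mu using 0 1 2 by simp
      finally show ?thesis .
    qed
  qed
  also have "\<dots> = (\<Sum>c\<in>V. ((if Z0 = {} \<or> c = a 0 then 1 else 0) * (if {c, e0, e1} \<in> H then 1 else 0) / T) * (sA c * sB c))"
    unfolding sA_def sB_def sum_product by (simp only: sum_distrib_left)
  also have "\<dots> \<le> (\<Sum>c\<in>V. ((if Z0 = {} \<or> c = a 0 then 1 else 0) * (if {c, e0, e1} \<in> H then 1 else 0) / T) * ((1 / d) ^ card ZA * (1 / d) ^ card ZB))"
    using sA sB T_pos d_pos by (intro sum_mono mult_left_mono mult_mono) auto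
  also have "\<dots> = (\<Sum>c\<in>V. (if Z0 = {} \<or> c = a 0 then 1 else 0) * (if {c, e0, e1} \<in> H then 1 else 0)) / T * ((1 / d) ^ card ZA * (1 / d) ^ card ZB)"
    by (simp only: sum_distrib_right sum_divide_distrib)
  also have "\<dots> \<le> (deg e0 e1 * (1 / d) ^ card Z0) / T * ((1 / d) ^ card ZA * (1 / d) ^ card ZB)"
  proof (rule mult_right_mono[OF divide_right_mono])
    have cong: "{c, e0, e1} = {e0, e1, c}" for c by auto
    show "(\<Sum>c\<in>V. (if Z0 = {} \<or> c = a 0 then 1 else 0) * (if {c, e0, e1} \<in> H then 1 else 0)) \<le> deg e0 e1 * (1 / d) ^ card Z0"
    proof (cases "Z0 = {}")
      case True
      then show ?thesis using sum_triple[of e0 e1] unfolding cong by simp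
    next
      case False
      then have c0: "card Z0 = 1" unfolding Z0_def by (auto simp: Int_insert_right split: if_splits)
      have "(\<Sum>c\<in>V. (if Z0 = {} \<or> c = a 0 then 1 else 0) * (if {c, e0, e1} \<in> H then 1 else 0))
        = (\<Sum>c\<in>V. if c = a 0 then (if {c, e0, e1} \<in> H then 1 else 0) else (0::real))"
        using False by (intro sum.cong) auto
      also have "\<dots> \<le> (if {a 0, e0, e1} \<in> H then 1 else 0)" using finite_V by (simp add: sum.delta)
      also have "\<dots> \<le> deg e0 e1 * (1 / d)"
        using deg_ge[of e0 e1 "a 0"] deg_nonneg d_pos unfolding cong by (auto simp: field_simps)
      finally show ?thesis using c0 by simp
    qed
  qed (use T_pos d_pos in auto)
  also have "\<dots> = deg e0 e1 / T * (1 / d) ^ card Z" unfolding cZ by (simp add: power_add)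
  finally show ?thesis unfolding F_def .
qed

text \<open>The only edge left over by \<open>spread_0\<close> and \<open>spread_mid\<close> is the
  one returning to the centre; reversing the walk makes it the first.\<close>

lemma spread:
  assumes p: "p < 2 * l" and Z: "Z \<subseteq> {..<2 * l} - {p, Suc p mod (2 * l)}" and e: "e0 \<in> V" "e1 \<in> V"
  shows "(\<Sum>u\<in>nlists V (2 * l). if u ! p = e0 \<and> u ! (Suc p mod (2 * l)) = e1 \<and> (\<forall>k\<in>Z. u ! k = a k) then mu u else 0)
    \<le> deg e0 e1 / T * (1 / d) ^ card Z"
proof -
  consider "p = 0" | "1 \<le> p" "p + 2 \<le> 2 * l" | "Suc p = 2 * l" using p by linarith
  then show ?thesis
  proof cases
    case 1
    then have m: "Suc p mod (2 * l) = 1" using l_ge by simp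
    have Z2: "Z \<subseteq> {2..<2 * l}"
    proof
      fix k assume "k \<in> Z"
      then have "k < 2 * l" "k \<noteq> 0" "k \<noteq> 1" using Z 1 m by auto
      then show "k \<in> {2..<2 * l}" by auto
    qed
    show ?thesis unfolding m unfolding 1 by (rule spread_0[OF Z2 e(2)])
  next
    case 2
    then have m: "Suc p mod (2 * l) = Suc p" by simp
    show ?thesis unfolding m by (rule spread_mid[OF 2 _ e]) (use Z m in auto)
  next
    case 3
    then have m: "Suc p mod (2 * l) = 0" by simp
    define Z' where "Z' = (\<lambda>k. 2 * l - k) ` Z"
    have Zr: "1 \<le> k \<and> k < p" if "k \<in> Z" for k
    proof -
      have "k < 2 * l" "k \<noteq> p" "k \<noteq> 0" using that Z m by auto
      then show ?thesis using 3 by linarith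
    qed
    have cZ: "card Z' = card Z" unfolding Z'_def
    proof (rule card_image, rule inj_onI)
      fix k k' assume "k \<in> Z" "k' \<in> Z" "2 * l - k = 2 * l - k'"
      then show "k = k'" using Zr[of k] Zr[of k'] 3 by linarith
    qed
    have Z': "Z' \<subseteq> {2..<2 * l}"
    proof
      fix j assume "j \<in> Z'"
      then obtain k where "k \<in> Z" "j = 2 * l - k" unfolding Z'_def by auto
      then show "j \<in> {2..<2 * l}" using Zr[of k] 3 by auto
    qed
    have "(\<Sum>u\<in>nlists V (2 * l). if u ! p = e0 \<and> u ! (Suc p mod (2 * l)) = e1 \<and> (\<forall>k\<in>Z. u ! k = a k) then mu u else 0)
      = (\<Sum>u\<in>nlists V (2 * l). if rv u ! p = e0 \<and> rv u ! (Suc p mod (2 * l)) = e1 \<and> (\<forall>k\<in>Z. rv u ! k = a k) then mu (rv u) else 0)"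
      by (rule sum_rv[symmetric])
    also have "\<dots> = (\<Sum>u\<in>nlists V (2 * l). if u ! 0 = e1 \<and> u ! 1 = e0 \<and> (\<forall>k\<in>Z'. u ! k = a (2 * l - k)) then mu u else 0)"
    proof (rule sum.cong[OF refl])
      fix u assume u: "u \<in> nlists V (2 * l)"
      have "2 * l - p = 1" "1 \<le> p" using 3 l_ge by auto
      then have a1: "rv u ! p = u ! 1" using rv_props(4)[OF u, of p] p by simp
      have a2: "rv u ! k = u ! (2 * l - k)" if "k \<in> Z" for k using rv_props(4)[OF u, of k] Zr[OF that] p by simp
      have "(\<forall>k\<in>Z. rv u ! k = a k) \<longleftrightarrow> (\<forall>k\<in>Z'. u ! k = a (2 * l - k))"
      proof -
        have "2 * l - (2 * l - k) = k" if "k \<in> Z" for k using Zr[OF that] p by linarith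
        then show ?thesis unfolding Z'_def using a2 by simp
      qed
      then show "(if rv u ! p = e0 \<and> rv u ! (Suc p mod (2 * l)) = e1 \<and> (\<forall>k\<in>Z. rv u ! k = a k) then mu (rv u) else 0) =
        (if u ! 0 = e1 \<and> u ! 1 = e0 \<and> (\<forall>k\<in>Z'. u ! k = a (2 * l - k)) then mu u else 0)"
        unfolding m a1 rv_props(3,5)[OF u] by auto
    qed
    also have "\<dots> \<le> deg e1 e0 / T * (1 / d) ^ card Z'" by (rule spread_0[OF Z' e(1)])
    finally show ?thesis using cZ deg_sym by metis
  qed
qed

end

text \<open>The second endpoints of the edges are \<open>card J\<close> distinct vertices. If
  \<open>J\<close> is not the whole cycle, some edge of \<open>J\<close> has its predecessor missing
  and its first endpoint is one more vertex; otherwise the index set would be closed under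
  successor.\<close>

lemma card_Union_cyc_edges:
  assumes u: "distinct u" "3 \<le> length u" and J: "J \<subseteq> cyc_edges u" "J \<noteq> {}"
  shows "card J \<le> card (\<Union>J)" "card J < length u \<Longrightarrow> card J + 1 \<le> card (\<Union>J)" "\<Union>J \<subseteq> set u"
proof -
  define n where "n = length u"
  obtain I where I: "I \<subseteq> {..<n}" "J = cyc_edge u ` I"
    using J(1) unfolding cyc_edges_def n_def by (metis subset_imageE)
  have finI: "finite I" using I finite_subset by blast
  have cJ: "card J = card I"
    unfolding I(2) by (rule card_image) (use inj_on_cyc_edge[OF u] I(1) inj_on_subset n_def in blast)
  define s where "s k = Suc k mod n" for k
  have sn: "s k < n" for k unfolding s_def n_def using u by (intro mod_less_divisor) auto
  have "inj_on s {..<n}"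
  proof (rule inj_onI)
    fix k k' assume "k \<in> {..<n}" "k' \<in> {..<n}" "s k = s k'"
    then show "k = k'" unfolding s_def by (simp add: mod_Suc split: if_splits)
  qed
  then have injs: "inj_on s I" using I(1) inj_on_subset by blast
  have inju: "inj_on (nth u) {..<n}" using u(1) unfolding n_def by (simp add: inj_on_nth)
  show UJ: "\<Union>J \<subseteq> set u" using J(1) cyc_edges_subset by fast
  then have finU: "finite (\<Union>J)" using finite_subset by blast
  have sub1: "nth u ` (s ` I) \<subseteq> \<Union>J" unfolding I(2) cyc_edge_def s_def n_def by auto
  have sub2: "nth u ` I \<subseteq> \<Union>J" unfolding I(2) cyc_edge_def by auto
  have sI: "s ` I \<subseteq> {..<n}" using sn by auto
  have c1: "card (nth u ` (s ` I)) = card I"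
    using card_image[OF inj_on_subset[OF inju sI]] card_image[OF injs] by simp
  show "card J \<le> card (\<Union>J)" using card_mono[OF finU sub1] c1 cJ by simp
  show "card J + 1 \<le> card (\<Union>J)" if lt: "card J < length u"
  proof -
    have "\<exists>k\<in>I. k \<notin> s ` I"
    proof (rule ccontr)
      assume "\<not> ?thesis"
      then have "I \<subseteq> s ` I" by auto
      then have eq: "I = s ` I" using card_image[OF injs] finI by (intro card_subset_eq) auto
      obtain k where k: "k \<in> I" using J(2) I(2) by auto
      have it: "(k + i) mod n \<in> I" for i
      proof (induction i)
        case 0
        then show ?case using k I(1) by auto
      next
        case (Suc i)
        have "s ((k + i) mod n) \<in> I" using Suc eq by blast
        then show ?case unfolding s_def by (simp add: mod_Suc_eq)
      qed
      have "{..<n} \<subseteq> I"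
      proof
        fix j assume j: "j \<in> {..<n}"
        have "k < n" using k I(1) by auto
        then have "(k + (j + n - k)) mod n = j" using j by simp
        then show "j \<in> I" using it[of "j + n - k"] by simp
      qed
      then have "card I = n" using I(1) by (metis card_lessThan subset_antisym)
      then show False using lt cJ n_def by simp
    qed
    then obtain k where k: "k \<in> I" "k \<notin> s ` I" by auto
    have "insert (u ! k) (nth u ` (s ` I)) \<subseteq> \<Union>J" using sub1 sub2 k by auto
    moreover have "u ! k \<notin> nth u ` (s ` I)"
    proof
      assume "u ! k \<in> nth u ` (s ` I)"
      then obtain j where j: "j \<in> s ` I" "u ! k = u ! j" by auto
      have "k = j" by (rule inj_onD[OF inju j(2)]) (use k I(1) j(1) sI in auto)
      then show False using k j by simp
    qed
    moreover have "card (insert (u ! k) (nth u ` (s ` I))) = Suc (card I)" using calculation(2) c1 finI by simp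
    ultimately show ?thesis using card_mono[OF finU] cJ by (metis Suc_eq_plus1)
  qed
qed

section \<open>From random fans to a balanced family\<close>

context codegree_core
begin

lemma cw_nz: "cw c L \<noteq> 0 \<Longrightarrow> Suc k < length L \<Longrightarrow> {c, L ! k, L ! Suc k} \<in> H"
proof (induction c L arbitrary: k rule: cw.induct)
  case (1 c a b L)
  then show ?case by (cases k) (auto simp: stp_def split: if_splits)
qed auto

lemma cyc_edge_shadow:
  assumes "u \<in> nlists V (2 * l)" "mu u \<noteq> 0" "k < 2 * l"
  shows "cyc_edge u k \<in> shadow H"
proof -
  have len: "length u = 2 * l" using assms(1) by (simp add: nlists_def)
  have nz: "cw (u ! 0) (tl u) \<noteq> 0" using assms(2) unfolding mu_def by auto
  have tri: "{u ! 0, u ! j, u ! Suc j} \<in> H" if "1 \<le> j" "Suc j < 2 * l" for j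
  proof -
    have "{u ! 0, tl u ! (j - 1), tl u ! Suc (j - 1)} \<in> H" by (rule cw_nz[OF nz]) (use that len in auto)
    then show ?thesis using that len by (simp add: nth_tl)
  qed
  consider "k = 0" | "1 \<le> k" "Suc k < 2 * l" | "Suc k = 2 * l" using assms(3) by linarith
  then show ?thesis
  proof cases
    case 1
    then show ?thesis using triple_shadow(1)[OF tri[of 1]] l_ge by (simp add: cyc_edge_def len)
  next
    case 2
    then show ?thesis using triple_shadow(3)[OF tri[of k]] by (simp add: cyc_edge_def len)
  next
    case 3
    then have "{u ! 0, u ! k} \<in> shadow H" using triple_shadow(2)[OF tri[of "k - 1"]] l_ge by simp
    then show ?thesis using 3 by (simp add: cyc_edge_def len insert_commute)
  qed
qed

lemma collision:
  assumes "i + 2 \<le> k" "k < 2 * l"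
  shows "(\<Sum>u\<in>nlists V (2 * l). if u ! i = u ! k then mu u else 0) \<le> 1 / d"
proof -
  have m: "Suc i mod (2 * l) = Suc i" using assms by simp
  let ?f = "\<lambda>e u. if u ! i = fst e \<and> u ! (Suc i mod (2 * l)) = snd e \<and> (\<forall>k'\<in>{k}. u ! k' = fst e) then mu u else 0"
  have "(\<Sum>u\<in>nlists V (2 * l). if u ! i = u ! k then mu u else 0) \<le> (\<Sum>u\<in>nlists V (2 * l). \<Sum>e\<in>V \<times> V. ?f e u)"
  proof (rule sum_mono)
    fix u assume u: "u \<in> nlists V (2 * l)"
    then have len: "length u = 2 * l" "set u \<subseteq> V" by (auto simp: nlists_def)
    then have e: "(u ! i, u ! Suc i) \<in> V \<times> V" using assms nth_mem[of i u] nth_mem[of "Suc i" u] by auto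
    have "?f (u ! i, u ! Suc i) u \<le> (\<Sum>e\<in>V \<times> V. ?f e u)"
      by (rule member_le_sum[OF e]) (use mu_nonneg finite_V in auto)
    then show "(if u ! i = u ! k then mu u else 0) \<le> (\<Sum>e\<in>V \<times> V. ?f e u)"
      unfolding m by (auto split: if_splits intro: sum_nonneg mu_nonneg)
  qed
  also have "\<dots> = (\<Sum>e\<in>V \<times> V. \<Sum>u\<in>nlists V (2 * l). ?f e u)" by (rule sum.swap)
  also have "\<dots> \<le> (\<Sum>e\<in>V \<times> V. deg (fst e) (snd e) / T * (1 / d) ^ card {k})"
  proof (rule sum_mono)
    fix e assume e: "e \<in> V \<times> V"
    show "(\<Sum>u\<in>nlists V (2 * l). ?f e u) \<le> deg (fst e) (snd e) / T * (1 / d) ^ card {k}"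
      by (rule spread[where a="\<lambda>_. fst e"]) (use assms e m in auto)
  qed
  also have "\<dots> = (\<Sum>e\<in>V \<times> V. deg (fst e) (snd e)) / T * (1 / d)"
    by (simp add: sum_distrib_right sum_divide_distrib)
  also have "(\<Sum>e\<in>V \<times> V. deg (fst e) (snd e)) = T" unfolding T_def by (simp add: sum.cartesian_product split_def)
  finally show ?thesis using T_pos by simp
qed

definition U :: "'a list set" where "U = {u \<in> nlists V (2 * l). distinct u \<and> mu u \<noteq> 0}"

text \<open>Neighbouring positions form a shadow pair and so never coincide; each of the at most
  \<open>4 * l ^ 2\<close> other pairs does so with probability at most \<open>1 / d\<close>, and
  \<open>d \<ge> 24 * l ^ 2\<close>.\<close>

lemma U_mass: "3 / 4 \<le> sum mu U"
proof -
  define \<D> where "\<D> = {(i, k). i + 2 \<le> k \<and> k < 2 * l}"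
  define g where "g = (\<lambda>(i, k) u. if u ! i = u ! k then mu u else 0)"
  have g0: "0 \<le> g e u" for e u unfolding g_def using mu_nonneg by (auto split: prod.splits)
  have sub: "\<D> \<subseteq> {..<2 * l} \<times> {..<2 * l}" unfolding \<D>_def by auto
  have fin\<D>: "finite \<D>" using finite_subset[OF sub] by simp
  have c\<D>: "real (card \<D>) \<le> 4 * real l ^ 2"
  proof -
    have "card \<D> \<le> (2 * l) * (2 * l)" using card_mono[OF _ sub] by simp
    then have "real (card \<D>) \<le> real ((2 * l) * (2 * l))" by (rule of_nat_mono)
    then show ?thesis by (simp add: power2_eq_square)
  qed
  have "1 = (\<Sum>u\<in>nlists V (2 * l). mu u)" using sum_mu by simp
  also have "\<dots> \<le> (\<Sum>u\<in>nlists V (2 * l). (if u \<in> U then mu u else 0) + (\<Sum>e\<in>\<D>. g e u))"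
  proof (rule sum_mono)
    fix u assume u: "u \<in> nlists V (2 * l)"
    show "mu u \<le> (if u \<in> U then mu u else 0) + (\<Sum>e\<in>\<D>. g e u)"
    proof (cases "u \<in> U \<or> mu u = 0")
      case True
      then show ?thesis using sum_nonneg[of \<D> "\<lambda>e. g e u"] g0 by auto
    next
      case False
      then have nz: "mu u \<noteq> 0" and nd: "\<not> distinct u" using u unfolding U_def by auto
      have len: "length u = 2 * l" using u by (simp add: nlists_def)
      obtain i k where ik: "i < k" "k < 2 * l" "u ! i = u ! k"
        using nd unfolding distinct_conv_nth len by (metis nat_neq_iff)
      have "k \<noteq> Suc i"
      proof
        assume k: "k = Suc i"
        have "cyc_edge u i \<in> shadow H" by (rule cyc_edge_shadow[OF u nz]) (use ik in auto)
        then have "card {u ! i, u ! k} = 2" using k ik unfolding cyc_edge_def len shadow_def by simp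
        then show False using ik(3) by simp
      qed
      then have "(i, k) \<in> \<D>" using ik unfolding \<D>_def by auto
      moreover have "g (i, k) u = mu u" unfolding g_def using ik by simp
      ultimately have "mu u \<le> (\<Sum>e\<in>\<D>. g e u)" using member_le_sum[of "(i, k)" \<D> "\<lambda>e. g e u"] g0 fin\<D> by auto
      then show ?thesis using mu_nonneg[of u] by auto
    qed
  qed
  also have "\<dots> = sum mu U + (\<Sum>e\<in>\<D>. \<Sum>u\<in>nlists V (2 * l). g e u)"
  proof -
    have "(\<Sum>u\<in>nlists V (2 * l). if u \<in> U then mu u else 0) = sum mu U"
    proof -
      have "nlists V (2 * l) \<inter> U = U" unfolding U_def by auto
      then show ?thesis using sum.inter_restrict[OF finite_nlists[OF finite_V], of mu "2 * l" U] by simp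
    qed
    moreover have "(\<Sum>u\<in>nlists V (2 * l). \<Sum>e\<in>\<D>. g e u) = (\<Sum>e\<in>\<D>. \<Sum>u\<in>nlists V (2 * l). g e u)" by (rule sum.swap)
    ultimately show ?thesis by (simp add: sum.distrib)
  qed
  also have "\<dots> \<le> sum mu U + (\<Sum>e\<in>\<D>. 1 / d)"
    by (intro add_left_mono sum_mono) (use collision in \<open>auto simp: g_def \<D>_def\<close>)
  also have "\<dots> = sum mu U + real (card \<D>) / d" by simp
  also have "real (card \<D>) / d \<le> 1 / 4"
  proof -
    have "4 * real (card \<D>) \<le> d" using c\<D> d_ge by linarith
    then show ?thesis using d_pos by (simp add: field_simps)
  qed
  finally show ?thesis by simp
qed

text \<open>Union bound over the place of \<open>J\<close> in the walk: position and orientation of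
  \<open>f0\<close>, then the positions of the other vertices of \<open>J\<close>, in at most
  \<open>2 * n * n ^ n\<close> ways for \<open>n = 2 * l\<close>. For each, \<open>spread\<close>
  fixes \<open>f0\<close> and charges \<open>1 / d\<close> per further vertex.\<close>

lemma U_pattern:
  assumes J: "J \<subseteq> cyc_edges u0" "u0 \<in> U" and f0: "f0 \<in> J"
  shows "(\<Sum>u | u \<in> U \<and> J \<subseteq> cyc_edges u. mu u) \<le>
    4 * real l * real (2 * l) ^ (2 * l) * (real (card (extenders H f0)) / T * (1 / d) ^ card (\<Union>J - f0))"
proof -
  define n where "n = 2 * l"
  define X where "X = \<Union>J - f0"
  have u0: "u0 \<in> nlists V n" "distinct u0" "mu u0 \<noteq> 0" using J(2) unfolding U_def n_def by auto
  have len0: "length u0 = n" "set u0 \<subseteq> V" using u0(1) by (auto simp: nlists_def)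
  have "f0 \<in> cyc_edges u0" using J f0 by auto
  then have "f0 \<in> shadow H" using cyc_edge_shadow[of u0] u0 len0 unfolding cyc_edges_def n_def by auto
  then obtain v w where vw: "f0 = {v, w}" "v \<noteq> w" unfolding shadow_def by (auto simp: card_2_iff)
  have vwV: "v \<in> V" "w \<in> V" using vw \<open>f0 \<in> cyc_edges u0\<close> cyc_edges_subset len0 by fastforce+
  have Xs: "X \<subseteq> set u0" unfolding X_def using J(1) cyc_edges_subset by fast
  have finX: "finite X" using Xs finite_subset by blast
  have cX: "card X \<le> n" using card_mono[OF _ Xs] u0(2) len0 by (simp add: distinct_card)
  define W where "W = {(p, e, pos) \<in> {..<n} \<times> ({(v, w), (w, v)} \<times> PiE X (\<lambda>_. {..<n})).
    inj_on pos X \<and> pos ` X \<inter> {p, Suc p mod n} = {}}"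
  have subW: "W \<subseteq> {..<n} \<times> ({(v, w), (w, v)} \<times> PiE X (\<lambda>_. {..<n}))" unfolding W_def by auto
  have finB: "finite ({..<n} \<times> ({(v, w), (w, v)} \<times> PiE X (\<lambda>_. {..<n})))"
    using finX by (auto intro!: finite_PiE)
  have finW: "finite W" using finite_subset[OF subW finB] .
  have cW: "real (card W) \<le> 4 * real l * real n ^ n"
  proof -
    have "card W \<le> n * (card {(v, w), (w, v)} * n ^ card X)"
    proof -
      have "card (PiE X (\<lambda>_. {..<n})) = n ^ card X" using finX by (simp add: card_PiE)
      then show ?thesis using card_mono[OF finB subW] by (simp only: card_cartesian_product card_lessThan)
    qed
    also have "\<dots> \<le> n * (2 * n ^ n)"
    proof -
      have a: "n ^ card X \<le> n ^ n"
      proof (rule power_increasing[OF cX])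
        show "1 \<le> n" using l_ge n_def by simp
      qed
      have c: "card {(v, w), (w, v)} \<le> 2" using card_length[of "[(v, w), (w, v)]"] by simp
      show ?thesis by (rule mult_le_mono2, rule mult_le_mono[OF c a])
    qed
    finally have "real (card W) \<le> real (n * (2 * n ^ n))" by (rule of_nat_mono)
    then show ?thesis unfolding n_def by simp
  qed
  define G where "G = (\<lambda>(p, e, pos) u. u ! p = fst e \<and> u ! (Suc p mod n) = snd e \<and> (\<forall>x\<in>X. u ! pos x = (x::'a)))"
  have exW: "\<exists>\<tau>\<in>W. G \<tau> u" if uU: "u \<in> U" and Ju: "J \<subseteq> cyc_edges u" for u
  proof -
    have u: "u \<in> nlists V n" "distinct u" using uU unfolding U_def n_def by auto
    have len: "length u = n" using u(1) by (simp add: nlists_def)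
    obtain p where p: "p < n" "f0 = cyc_edge u p" using Ju f0 len unfolding cyc_edges_def by auto
    have n0: "0 < n" using p by simp
    define e where "e = (u ! p, u ! (Suc p mod n))"
    have e: "e \<in> {(v, w), (w, v)}" using p(2) vw len unfolding e_def cyc_edge_def by (auto simp: doubleton_eq_iff)
    have "\<forall>x\<in>X. \<exists>k. k < n \<and> u ! k = x"
    proof
      fix x assume "x \<in> X"
      then have "x \<in> set u" unfolding X_def using Ju cyc_edges_subset by fast
      then show "\<exists>k. k < n \<and> u ! k = x" using len by (metis in_set_conv_nth)
    qed
    then obtain q where q: "\<And>x. x \<in> X \<Longrightarrow> q x < n \<and> u ! q x = x" by metis
    define pos where "pos = restrict q X"
    have pos: "pos x < n" "u ! pos x = x" if "x \<in> X" for x using q[OF that] that unfolding pos_def by auto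
    have "pos \<in> PiE X (\<lambda>_. {..<n})" using q unfolding pos_def by auto
    moreover have "inj_on pos X" by (rule inj_on_inverseI[where g="nth u"]) (rule pos(2))
    moreover have "pos ` X \<inter> {p, Suc p mod n} = {}"
    proof -
      have "pos x \<noteq> p \<and> pos x \<noteq> Suc p mod n" if x: "x \<in> X" for x
      proof -
        have "x \<notin> f0" using x unfolding X_def by auto
        then show ?thesis using pos(2)[OF x] p(2) len unfolding cyc_edge_def by auto
      qed
      then show ?thesis by blast
    qed
    ultimately have "(p, e, pos) \<in> W" unfolding W_def using p e by auto
    moreover have "G (p, e, pos) u" unfolding G_def e_def using pos by auto
    ultimately show ?thesis by blast
  qed
  have finN: "finite (nlists V n)" using finite_nlists[OF finite_V] .
  have "(\<Sum>u | u \<in> U \<and> J \<subseteq> cyc_edges u. mu u) \<le> (\<Sum>u | u \<in> U \<and> J \<subseteq> cyc_edges u. \<Sum>\<tau>\<in>W. if G \<tau> u then mu u else 0)"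
  proof (rule sum_mono)
    fix u assume "u \<in> {u. u \<in> U \<and> J \<subseteq> cyc_edges u}"
    then obtain \<tau> where "\<tau> \<in> W" "G \<tau> u" using exW by blast
    then show "mu u \<le> (\<Sum>\<tau>\<in>W. if G \<tau> u then mu u else 0)"
      using member_le_sum[of \<tau> W "\<lambda>\<tau>. if G \<tau> u then mu u else 0"] finW mu_nonneg by auto
  qed
  also have "\<dots> \<le> (\<Sum>u\<in>nlists V n. \<Sum>\<tau>\<in>W. if G \<tau> u then mu u else 0)"
    using finN mu_nonneg unfolding U_def n_def by (intro sum_mono2) (auto intro: sum_nonneg)
  also have "\<dots> = (\<Sum>\<tau>\<in>W. \<Sum>u\<in>nlists V n. if G \<tau> u then mu u else 0)" by (rule sum.swap)
  also have "\<dots> \<le> (\<Sum>\<tau>\<in>W. real (card (extenders H f0)) / T * (1 / d) ^ card X)"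
  proof (rule sum_mono)
    fix \<tau> assume "\<tau> \<in> W"
    then obtain p e pos where \<tau>: "\<tau> = (p, e, pos)" "p < n" "e \<in> {(v, w), (w, v)}" "pos \<in> PiE X (\<lambda>_. {..<n})"
      "inj_on pos X" "pos ` X \<inter> {p, Suc p mod n} = {}" unfolding W_def by auto
    have dg: "deg (fst e) (snd e) = real (card (extenders H f0))" unfolding deg_def using \<tau>(3) vw(1) by (auto simp: insert_commute)
    have eV: "fst e \<in> V" "snd e \<in> V" using \<tau>(3) vwV by auto
    have "(\<Sum>u\<in>nlists V n. if G \<tau> u then mu u else 0) =
      (\<Sum>u\<in>nlists V (2 * l). if u ! p = fst e \<and> u ! (Suc p mod (2 * l)) = snd e \<and> (\<forall>k\<in>pos ` X. u ! k = inv_into X pos k) then mu u else 0)"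
      unfolding G_def \<tau>(1) n_def using \<tau>(5) by (simp add: inv_into_f_f)
    also have "\<dots> \<le> deg (fst e) (snd e) / T * (1 / d) ^ card (pos ` X)"
    proof (rule spread[OF _ _ eV])
      show "p < 2 * l" using \<tau>(2) n_def by simp
      show "pos ` X \<subseteq> {..<2 * l} - {p, Suc p mod (2 * l)}" 
      proof -
        have "pos ` X \<subseteq> {..<n}" using \<tau>(4) by auto
        then show ?thesis using \<tau>(6) unfolding n_def by blast
      qed
    qed
    also have "card (pos ` X) = card X" by (rule card_image[OF \<tau>(5)])
    finally show "(\<Sum>u\<in>nlists V n. if G \<tau> u then mu u else 0) \<le> real (card (extenders H f0)) / T * (1 / d) ^ card X" unfolding dg .
  qed
  also have "\<dots> = real (card W) * (real (card (extenders H f0)) / T * (1 / d) ^ card X)" by simp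
  also have "\<dots> \<le> 4 * real l * real n ^ n * (real (card (extenders H f0)) / T * (1 / d) ^ card X)"
    using cW T_pos d_pos by (intro mult_right_mono) auto
  finally show ?thesis unfolding n_def X_def .
qed

text \<open>The codegree of \<open>f0\<close> cancels against its own third vertex, leaving a factor
  \<open>1 / d\<close> for each further vertex and each further third vertex. For
  \<open>card J < 2 * l\<close> these are at least \<open>2 * (card J - 1)\<close> factors, for the
  full cycle \<open>(2 * l - 2) + (2 * l - 1) = 4 * l - 3\<close>. The full cycle dictates
  \<open>\<beta>\<close>, and \<open>(1 / d) ^ 2 \<le> \<beta>\<close> settles the rest.\<close>

theorem fan_cycles:
  fixes \<beta> :: real
  assumes \<beta>: "0 < \<beta>" "\<beta> ^ (2 * l - 1) = (1 / d) ^ (4 * l - 3)"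
  shows "\<exists>S\<subseteq>linear_cycle_copies (2 * l) H. S \<noteq> {} \<and> (\<forall>J. card J \<in> {1..2 * l} \<longrightarrow>
    real (cdeg S J) \<le> 16 * real l * 12 ^ (2 * l) * real (card S) * (4 * real l * real (2 * l) ^ (2 * l) / card H) * \<beta> ^ (card J - 1))"
proof -
  have dd: "0 < 1 / d" "1 / d \<le> 1" using d_pos by auto
  have S1: "2 * l - 1 = Suc (2 * l - 2)" using l_ge by simp
  have \<beta>1: "\<beta> \<le> 1"
  proof (rule power_le_imp_le_base)
    show "\<beta> ^ Suc (2 * l - 2) \<le> 1 ^ Suc (2 * l - 2)" using \<beta>(2) dd unfolding S1[symmetric] by (simp add: power_le_one)
  qed simp
  have \<beta>2: "(1 / d) ^ 2 \<le> \<beta>"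
  proof (rule power_le_imp_le_base)
    have "((1 / d) ^ 2) ^ (2 * l - 1) = (1 / d) ^ (2 * (2 * l - 1))" by (simp only: power_mult)
    also have "\<dots> \<le> (1 / d) ^ (4 * l - 3)" by (rule power_decreasing) (use dd l_ge in auto)
    also have "\<dots> = \<beta> ^ (2 * l - 1)" using \<beta>(2) by simp
    finally show "((1 / d) ^ 2) ^ Suc (2 * l - 2) \<le> \<beta> ^ Suc (2 * l - 2)" unfolding S1 .
  qed (use \<beta> in simp)
  have cH: "0 < real (card H)" using H_ne finite_H by (simp add: card_gt_0_iff)
  have Ud: "distinct u \<and> length u = 2 * l" if "u \<in> U" for u using that unfolding U_def nlists_def by auto
  show ?thesis
  proof (rule expansion[OF l_ge finite_H card_H _ Ud _ U_mass d_ge])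
    show "finite U" unfolding U_def using finite_nlists[OF finite_V] by simp
    show "\<And>u. 0 \<le> mu u" by (rule mu_nonneg)
    show "d \<le> real (card (extenders H f))" if "u \<in> U" "f \<in> cyc_edges u" for u f
    proof (rule codeg)
      show "f \<in> shadow H" using that cyc_edge_shadow[of u] unfolding U_def cyc_edges_def nlists_def by auto
    qed
    show "0 < 4 * real l * real (2 * l) ^ (2 * l) / real (card H)" using l_ge cH by simp
    show "0 < \<beta>" "\<beta> \<le> 1" using \<beta> \<beta>1 by auto
    fix J :: "'a set set" assume J: "card J \<in> {1..2 * l}"
    define C where "C = 4 * real l * real (2 * l) ^ (2 * l)"
    have C0: "0 \<le> C" unfolding C_def by simp
    show "(\<Sum>u | u \<in> U \<and> J \<subseteq> cyc_edges u. mu u) * (\<Prod>f\<in>J. 1 / real (card (extenders H f)))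
      \<le> 4 * real l * real (2 * l) ^ (2 * l) / real (card H) * \<beta> ^ (card J - 1)"
    proof (cases "\<exists>u\<in>U. J \<subseteq> cyc_edges u")
      case False
      then have "{u. u \<in> U \<and> J \<subseteq> cyc_edges u} = {}" by auto
      then show ?thesis using \<beta> by (simp only: sum.empty) simp
    next
      case True
      then obtain u0 where u0: "u0 \<in> U" "J \<subseteq> cyc_edges u0" by auto
      have finJ: "finite J" using u0(2) finite_cyc_edges finite_subset by blast
      obtain f0 where f0: "f0 \<in> J" using J by (metis atLeastAtMost_iff card.empty equals0I not_one_le_zero)
      have fge: "d \<le> real (card (extenders H f))" if "f \<in> J" for f
      proof (rule codeg)
        have "f \<in> cyc_edges u0" using that u0(2) by auto
        then show "f \<in> shadow H" using u0(1) cyc_edge_shadow[of u0] unfolding U_def cyc_edges_def nlists_def by auto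
      qed
      define g0 where "g0 = real (card (extenders H f0))"
      have g0: "0 < g0" using fge[OF f0] d_pos unfolding g0_def by linarith
      define N where "N = card (\<Union>J - f0)"
      have pr: "(\<Prod>f\<in>J. 1 / real (card (extenders H f))) \<le> 1 / g0 * (1 / d) ^ (card J - 1)"
      proof -
        have "(\<Prod>f\<in>J. 1 / real (card (extenders H f))) = 1 / g0 * (\<Prod>f\<in>J - {f0}. 1 / real (card (extenders H f)))"
          using prod.remove[OF finJ f0, of "\<lambda>f. 1 / real (card (extenders H f))"] unfolding g0_def by simp
        also have "\<dots> \<le> 1 / g0 * (\<Prod>f\<in>J - {f0}. 1 / d)"
        proof (rule mult_left_mono[OF prod_mono])
          fix f assume f: "f \<in> J - {f0}"
          then have "d \<le> real (card (extenders H f))" using fge by simp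
          then show "0 \<le> 1 / real (card (extenders H f)) \<and> 1 / real (card (extenders H f)) \<le> 1 / d" using d_pos by (simp add: frac_le)
        qed (use g0 in simp)
        also have "(\<Prod>f\<in>J - {f0}. 1 / d) = (1 / d) ^ (card J - 1)" using finJ f0 by simp
        finally show ?thesis .
      qed
      have "(\<Sum>u | u \<in> U \<and> J \<subseteq> cyc_edges u. mu u) * (\<Prod>f\<in>J. 1 / real (card (extenders H f)))
        \<le> (C * (g0 / T * (1 / d) ^ N)) * (1 / g0 * (1 / d) ^ (card J - 1))"
      proof (rule mult_mono)
        show "(\<Sum>u | u \<in> U \<and> J \<subseteq> cyc_edges u. mu u) \<le> C * (g0 / T * (1 / d) ^ N)"
          using U_pattern[OF u0(2,1) f0] unfolding C_def g0_def N_def .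
        show "0 \<le> C * (g0 / T * (1 / d) ^ N)" using C0 g0 T_pos d_pos by simp
        show "0 \<le> (\<Prod>f\<in>J. 1 / real (card (extenders H f)))" by (intro prod_nonneg) auto
      qed (rule pr)
      also have "\<dots> = C / T * (1 / d) ^ (N + (card J - 1))" using g0 by (simp add: power_add)
      also have "\<dots> \<le> C / T * \<beta> ^ (card J - 1)"
      proof (rule mult_left_mono)
        have ud: "distinct u0" "3 \<le> length u0" "length u0 = 2 * l" using Ud[OF u0(1)] l_ge by auto
        have Jne: "J \<noteq> {}" using f0 by auto
        note cu = card_Union_cyc_edges[OF ud(1,2) u0(2) Jne]
        have finU: "finite (\<Union>J)" using cu(3) finite_subset by blast
        have c2: "card f0 = 2"
        proof -
          have "f0 \<in> cyc_edges u0" using f0 u0 by auto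
          then have "f0 \<in> shadow H" using u0(1) cyc_edge_shadow[of u0] unfolding U_def cyc_edges_def nlists_def by auto
          then show ?thesis unfolding shadow_def by simp
        qed
        have "f0 \<subseteq> \<Union>J" using f0 by auto
        then have N: "N = card (\<Union>J) - 2" unfolding N_def using c2 finU
          by (metis card_Diff_subset finite_subset)
        show "(1 / d) ^ (N + (card J - 1)) \<le> \<beta> ^ (card J - 1)"
        proof (cases "card J < 2 * l")
          case True
          then have "2 * (card J - 1) \<le> N + (card J - 1)" using cu(2) ud(3) N by simp
          then have "(1 / d) ^ (N + (card J - 1)) \<le> (1 / d) ^ (2 * (card J - 1))"
            using dd by (intro power_decreasing) auto
          also have "\<dots> = ((1 / d) ^ 2) ^ (card J - 1)" by (simp only: power_mult)
          also have "\<dots> \<le> \<beta> ^ (card J - 1)" using \<beta>2 dd by (intro power_mono) auto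
          finally show ?thesis .
        next
          case False
          then have cJ: "card J = 2 * l" using J by simp
          have "4 * l - 3 \<le> N + (card J - 1)" using cu(1) N cJ l_ge by simp
          then have "(1 / d) ^ (N + (card J - 1)) \<le> (1 / d) ^ (4 * l - 3)"
            using dd by (intro power_decreasing) auto
          then show ?thesis using \<beta>(2) cJ by simp
        qed
        show "0 \<le> C / T" using C0 T_pos by simp
      qed
      also have "\<dots> \<le> C / real (card H) * \<beta> ^ (card J - 1)"
        using T_ge cH T_pos C0 \<beta> by (intro mult_right_mono divide_left_mono) auto
      finally show ?thesis unfolding C_def .
    qed
  qed
qed

end

section \<open>Asymptotics and the two regimes\<close>

lemma ln_powr_times_powr_tendsto_0:
  fixes a q :: real assumes "0 < q"
  shows "((\<lambda>n::nat. ln (real n) powr a * real n powr (- q)) \<longlongrightarrow> 0) sequentially"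
  using assms by real_asymp

text \<open>The bound is uniform in \<open>\<tau>\<close>: a nonpositive power of
  \<open>\<tau>\<close> is largest at the left end \<open>1 / ln n\<close>, where it is a power of
  the logarithm and loses to a power of \<open>n\<close>.\<close>

lemma eventually_powr_small:
  fixes a q \<epsilon> :: real
  assumes "0 \<le> a" "0 < q" "0 < \<epsilon>"
  shows "\<forall>\<^sub>F n::nat in sequentially. \<forall>\<tau>\<ge>1 / ln (real n). \<tau> powr (- a) * real n powr (- q) \<le> \<epsilon>"
proof -
  have "\<forall>\<^sub>F n::nat in sequentially. ln (real n) powr a * real n powr (- q) < \<epsilon>"
    using order_tendstoD(2)[OF ln_powr_times_powr_tendsto_0[OF assms(2), of a] assms(3)] .
  moreover have "\<forall>\<^sub>F n::nat in sequentially. 3 \<le> n" by (rule eventually_ge_at_top)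
  ultimately show ?thesis
  proof eventually_elim
    case (elim n)
    have ln0: "0 < ln (real n)" using elim(2) by simp
    show ?case
    proof (intro allI impI)
      fix \<tau> :: real assume \<tau>: "1 / ln (real n) \<le> \<tau>"
      have "\<tau> powr (- a) \<le> (1 / ln (real n)) powr (- a)"
        using \<tau> ln0 assms(1) by (intro powr_mono2') auto
      also have "\<dots> = ln (real n) powr a" using ln0 by (simp add: powr_minus powr_divide)
      finally have "\<tau> powr (- a) * real n powr (- q) \<le> ln (real n) powr a * real n powr (- q)"
        by (intro mult_right_mono) auto
      then show "\<tau> powr (- a) * real n powr (- q) \<le> \<epsilon>" using elim(1) by simp
    qed
  qed
qed

text \<open>Common denominator of the exponents. Here and below \<open>r\<close>,
  \<open>\<tau>\<close> and \<open>N\<close> stand for \<open>l\<close>, \<open>t / ln n\<close> and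
  \<open>n\<close>; \<open>ratio_sparse\<close> and \<open>ratio_dense\<close> are the two terms of
  the maximum.\<close>

definition exp_denom :: "real \<Rightarrow> real" where "exp_denom r = 4 * r ^ 2 - 5 * r + 2"

definition ratio_sparse :: "real \<Rightarrow> real \<Rightarrow> real \<Rightarrow> real" where
  "ratio_sparse r \<tau> N = \<tau> powr (- (r * (4 * r - 3) / exp_denom r)) * N powr (- ((r - 1) * (4 * r - 3) / exp_denom r))"

definition ratio_dense :: "real \<Rightarrow> real \<Rightarrow> real \<Rightarrow> real" where
  "ratio_dense r \<tau> N = \<tau> powr (- 1) * N powr (- ((2 * r - 2) / (2 * r - 1)))"

text \<open>The codegree at which the core and the shadow construction give the same bound.\<close>

definition codeg_threshold :: "real \<Rightarrow> real \<Rightarrow> real \<Rightarrow> real" where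
  "codeg_threshold r \<tau> N = \<tau> powr (r * (2 * r - 1) / exp_denom r) * N powr ((r - 1) * (2 * r - 1) / exp_denom r)"

lemma exp_denom_pos: "2 \<le> r \<Longrightarrow> 0 < exp_denom r"
proof -
  assume "2 \<le> r"
  then have "0 \<le> (r - 2) * (4 * r + 3)" by simp
  also have "\<dots> = 4 * r ^ 2 - 5 * r - 6" by (simp add: power2_eq_square algebra_simps)
  finally show ?thesis unfolding exp_denom_def by simp
qed

context
  fixes r \<tau> N :: real
  assumes r: "2 \<le> r" and \<tau>: "0 < \<tau>" and N: "0 < N"
begin

lemma codeg_threshold_pos: "0 < codeg_threshold r \<tau> N" unfolding codeg_threshold_def using \<tau> N by simp

lemma ratio_sparse_pos: "0 < ratio_sparse r \<tau> N" unfolding ratio_sparse_def using \<tau> N by simp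

lemma ratio_dense_pos: "0 < ratio_dense r \<tau> N" unfolding ratio_dense_def using \<tau> N by simp

text \<open>The left-hand side is the ratio that the core construction attains at the threshold
  codegree.\<close>

lemma codeg_threshold_powr: "codeg_threshold r \<tau> N powr (- ((4 * r - 3) / (2 * r - 1))) = ratio_sparse r \<tau> N"
proof -
  have e: "2 * r - 1 \<noteq> 0" using r by simp
  have "r * (2 * r - 1) / exp_denom r * (- ((4 * r - 3) / (2 * r - 1))) = - (r * (4 * r - 3) / exp_denom r)"
    "(r - 1) * (2 * r - 1) / exp_denom r * (- ((4 * r - 3) / (2 * r - 1))) = - ((r - 1) * (4 * r - 3) / exp_denom r)"
    using e by auto
  then show ?thesis unfolding codeg_threshold_def ratio_sparse_def using \<tau> N by (simp add: powr_mult powr_powr)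
qed

text \<open>The ratio for graph cycles is that for hypergraph cycles times the codegree, and
  \<open>balanced_graph_cycles\<close> needs it below \<open>1 / cap_const l\<close>. The negative
  exponents here and in \<open>ratio_dense_threshold\<close> ensure this for large
  \<open>N\<close>.\<close>

lemma ratio_sparse_threshold: "ratio_sparse r \<tau> N * codeg_threshold r \<tau> N = \<tau> powr (- (2 * r * (r - 1) / exp_denom r)) * N powr (- (2 * (r - 1) ^ 2 / exp_denom r))"
proof -
  have D: "exp_denom r \<noteq> 0" using exp_denom_pos[OF r] by auto
  have 1: "- (r * (4 * r - 3) / exp_denom r) + r * (2 * r - 1) / exp_denom r = - (2 * r * (r - 1) / exp_denom r)"
    using D by (simp add: field_simps)
  have 2: "- ((r - 1) * (4 * r - 3) / exp_denom r) + (r - 1) * (2 * r - 1) / exp_denom r = - (2 * (r - 1) ^ 2 / exp_denom r)"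
    using D by (simp add: field_simps power2_eq_square)
  show ?thesis unfolding ratio_sparse_def codeg_threshold_def 1[symmetric] 2[symmetric] powr_add by (simp add: mult_ac)
qed

lemma ratio_dense_threshold: "ratio_dense r \<tau> N * codeg_threshold r \<tau> N = \<tau> powr (- (2 * (r - 1) ^ 2 / exp_denom r)) *
  N powr (- ((r - 1) * (4 * r ^ 2 - 6 * r + 3) / (exp_denom r * (2 * r - 1))))"
proof -
  have D: "exp_denom r \<noteq> 0" "2 * r - 1 \<noteq> 0" using exp_denom_pos[OF r] r by auto
  have 1: "- 1 + r * (2 * r - 1) / exp_denom r = - (2 * (r - 1) ^ 2 / exp_denom r)"
    using D by (simp add: field_simps) (simp add: exp_denom_def power2_eq_square algebra_simps)
  have 2: "- ((2 * r - 2) / (2 * r - 1)) + (r - 1) * (2 * r - 1) / exp_denom r = - ((r - 1) * (4 * r ^ 2 - 6 * r + 3) / (exp_denom r * (2 * r - 1)))"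
    using D by (simp add: field_simps) (simp add: exp_denom_def power2_eq_square algebra_simps)
  show ?thesis unfolding ratio_dense_def codeg_threshold_def 1[symmetric] 2[symmetric] powr_add by (simp add: mult_ac)
qed

text \<open>In the shadow construction \<open>\<delta>\<close> is of order
  \<open>\<tau> * N / d\<close>, which makes \<open>b / d\<close> of the order of the left-hand side
  with \<open>d\<close> in place of the threshold. So at the threshold it meets the ratio of the
  core construction.\<close>

lemma codeg_threshold_powr_inverse: "\<tau> powr (- (r / (r - 1))) * N powr (- 1) * codeg_threshold r \<tau> N powr (1 / (r - 1)) = ratio_sparse r \<tau> N"
proof -
  have D: "exp_denom r \<noteq> 0" "r - 1 \<noteq> 0" using exp_denom_pos[OF r] r by auto
  have k: "2 * r - 1 - exp_denom r = - ((r - 1) * (4 * r - 3))" by (simp add: exp_denom_def power2_eq_square algebra_simps)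
  have "- (r / (r - 1)) + r * (2 * r - 1) / exp_denom r * (1 / (r - 1)) = r * (2 * r - 1 - exp_denom r) / (exp_denom r * (r - 1))"
    using D by (simp add: divide_simps) (simp add: algebra_simps)
  then have 1: "- (r / (r - 1)) + r * (2 * r - 1) / exp_denom r * (1 / (r - 1)) = - (r * (4 * r - 3) / exp_denom r)"
    unfolding k using D by simp
  have "- 1 + (r - 1) * (2 * r - 1) / exp_denom r * (1 / (r - 1)) = (2 * r - 1 - exp_denom r) / exp_denom r"
    using D by (simp add: divide_simps)
  then have 2: "- 1 + (r - 1) * (2 * r - 1) / exp_denom r * (1 / (r - 1)) = - ((r - 1) * (4 * r - 3) / exp_denom r)"
    unfolding k by simp
  show ?thesis unfolding ratio_sparse_def 1[symmetric] 2[symmetric] powr_add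
    unfolding codeg_threshold_def using \<tau> N by (simp add: powr_mult powr_powr mult_ac)
qed

text \<open>The quotient of the two ratios contains \<open>\<tau>\<close> to the power
  \<open>- (2 * r - 2) / exp_denom r\<close>, so it falls as \<open>\<tau>\<close> grows, and it
  equals 1 at the stated lower bound for \<open>\<tau>\<close>.\<close>

lemma ratio_sparse_le_dense:
  assumes "N powr (1 / (2 * (2 * r - 1))) \<le> \<tau>"
  shows "ratio_sparse r \<tau> N \<le> ratio_dense r \<tau> N"
proof -
  have D: "0 < exp_denom r" "exp_denom r \<noteq> 0" "0 < 2 * r - 1" "2 * r - 1 \<noteq> 0" using exp_denom_pos[OF r] r by auto
  have 1: "- 1 + (- ((2 * r - 2) / exp_denom r)) = - (r * (4 * r - 3) / exp_denom r)"
    using D by (simp add: field_simps) (simp add: exp_denom_def power2_eq_square algebra_simps)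
  have 2: "1 / (2 * (2 * r - 1)) * (- ((2 * r - 2) / exp_denom r)) + (- ((r - 1) * (4 * r - 3) / exp_denom r)) = - ((2 * r - 2) / (2 * r - 1))"
    using D by (simp add: field_simps) (simp add: exp_denom_def power2_eq_square algebra_simps)
  have "\<tau> powr (- ((2 * r - 2) / exp_denom r)) \<le> (N powr (1 / (2 * (2 * r - 1)))) powr (- ((2 * r - 2) / exp_denom r))"
    using assms N r D by (intro powr_mono2') auto
  then have "\<tau> powr (- 1) * (\<tau> powr (- ((2 * r - 2) / exp_denom r)) * N powr (- ((r - 1) * (4 * r - 3) / exp_denom r))) \<le>
    \<tau> powr (- 1) * (N powr (1 / (2 * (2 * r - 1)) * (- ((2 * r - 2) / exp_denom r))) * N powr (- ((r - 1) * (4 * r - 3) / exp_denom r)))"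
    unfolding powr_powr by (intro mult_left_mono mult_right_mono) auto
  then show ?thesis unfolding ratio_sparse_def ratio_dense_def 1[symmetric] 2[symmetric] powr_add by (simp add: mult_ac)
qed

end

text \<open>The shadow has at least about \<open>\<tau> * n ^ 2 / d\<close> pairs, so graph cycles
  are built with out-degree \<open>\<delta>\<close> of order \<open>\<tau> * n / d\<close>.
  Expansion multiplies the bound for single edges and the ratio by \<open>1 / d\<close> each. The
  graph ratio is the maximum of \<open>b\<close>, from partial patterns, and \<open>b2\<close>, from
  the full cycle; these lead to the two terms of the final maximum.\<close>

lemma shadow_case:
  fixes H :: "'a set set" and d \<tau> :: real
  assumes l: "2 \<le> l" and H: "finite H" "\<And>e. e \<in> H \<Longrightarrow> card e = 3 \<and> e \<subseteq> V" and V: "finite V" "card V = n" "1 \<le> n"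
    and d: "24 * real l ^ 2 \<le> d" "\<And>f. f \<in> shadow H \<Longrightarrow> d \<le> real (card (extenders H f))"
    and \<tau>: "0 < \<tau>" and sh: "\<tau> * real n ^ 2 / 6 \<le> 2 * d * real (card (shadow H))"
    and dd: "d \<le> codeg_threshold (real l) \<tau> (real n)"
    and small: "2304 * cap_const l * (ratio_sparse (real l) \<tau> (real n) * codeg_threshold (real l) \<tau> (real n)) \<le> 1"
      "2304 * cap_const l * (ratio_dense (real l) \<tau> (real n) * codeg_threshold (real l) \<tau> (real n)) \<le> 1"
  shows "\<exists>S\<subseteq>linear_cycle_copies (2 * l) H. S \<noteq> {} \<and> (\<forall>J. card J \<in> {1..2 * l} \<longrightarrow>
    real (cdeg S J) \<le> 16 * real l * 12 ^ (2 * l) * real (card S) * (96 * 2 ^ (2 * l) / (\<tau> * real n ^ 2)) *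
      (2304 * cap_const l * max (ratio_sparse (real l) \<tau> (real n)) (ratio_dense (real l) \<tau> (real n))) ^ (card J - 1))"
proof -
  define r where "r = real l"
  define N where "N = real n"
  have r: "2 \<le> r" unfolding r_def using l by simp
  have N: "0 < N" "1 \<le> N" unfolding N_def using V by auto
  define bf where "bf = ratio_sparse r \<tau> N"
  define bs where "bs = ratio_dense r \<tau> N"
  define D where "D = codeg_threshold r \<tau> N"
  have pos: "0 < bf" "0 < bs" "0 < D" unfolding bf_def bs_def D_def using ratio_sparse_pos ratio_dense_pos codeg_threshold_pos r \<tau> N by auto
  define M where "M = cap_const l"
  have M: "1 \<le> M" unfolding M_def using cap_const_ge(1)[OF l] .
  have sm: "2304 * M * (bf * D) \<le> 1" "2304 * M * (bs * D) \<le> 1"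
    using small unfolding bf_def bs_def D_def r_def N_def M_def by auto
  have "24 * 1 \<le> 24 * real l ^ 2" using l by (intro mult_left_mono) auto
  then have d1: "1 \<le> d" "0 < d" using d(1) by auto
  have dD: "d \<le> D" using dd unfolding D_def r_def N_def .
  have NBs: "\<tau> * N * bs = N powr (1 / (2 * r - 1))"
  proof -
    have "1 + (- ((2 * r - 2) / (2 * r - 1))) = 1 / (2 * r - 1)" using r by (simp add: field_simps)
    then have "N powr (1 / (2 * r - 1)) = N * N powr (- ((2 * r - 2) / (2 * r - 1)))"
      using N powr_add[of N 1 "- ((2 * r - 2) / (2 * r - 1))"] by simp
    then show ?thesis unfolding bs_def ratio_dense_def using \<tau> by (simp add: powr_minus field_simps)
  qed
  \<comment> \<open>The largest out-degree compatible with
    \<open>2 * card V * \<delta> \<le> card (shadow H)\<close> under the given lower bound on the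
    shadow. Below, \<open>z = y / 2\<close> bounds its integer part from below.\<close>
  define y where "y = \<tau> * N / (24 * d)"
  \<comment> \<open>Ensures a positive integer out-degree: \<open>\<tau> * N * bs\<close> is a
    nonnegative power of \<open>N\<close>, while \<open>24 * d * bs \<le> 1\<close> by the smallness
    at the threshold.\<close>
  have y1: "1 \<le> y"
  proof -
    have "1 \<le> \<tau> * N * bs" unfolding NBs using N r by (simp add: ge_one_powr_ge_zero)
    have "24 * d * bs \<le> 2304 * M * (bs * D)"
    proof -
      have "24 * d * bs \<le> 24 * D * bs" using dD pos by (intro mult_right_mono) auto
      also have "\<dots> \<le> (2304 * M) * (D * bs)" using M pos by (simp add: mult_right_mono)
      finally show ?thesis by (simp add: mult_ac)
    qed
    then have "24 * d * bs \<le> \<tau> * N * bs" using sm(2) \<open>1 \<le> \<tau> * N * bs\<close> by linarith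
    then have "24 * d \<le> \<tau> * N" using pos by simp
    then show ?thesis unfolding y_def using d1 by simp
  qed
  define \<delta> where "\<delta> = nat \<lfloor>y\<rfloor>"
  have \<delta>le: "real \<delta> \<le> y" unfolding \<delta>_def using y1 by simp
  have \<delta>1: "1 \<le> \<delta>" unfolding \<delta>_def using y1 by (simp add: le_nat_iff le_floor_iff)
  define z where "z = \<tau> * N / (48 * d)"
  have z0: "0 < z" unfolding z_def using \<tau> N d1 by simp
  have z\<delta>: "z \<le> real \<delta>"
  proof -
    have "y < real \<delta> + 1" unfolding \<delta>_def using y1 by (simp add: real_of_int_floor_add_one_gt)
    then have "y / 2 \<le> real \<delta>" using \<delta>1 by linarith
    then show ?thesis unfolding z_def y_def by simp
  qed
  have \<delta>0: "0 < real \<delta>" using \<delta>1 by simp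
  \<comment> \<open>Both numbers solve conditions of \<open>balanced_graph_cycles\<close> with
    equality: \<open>b ^ (l - 1) = N / \<delta> ^ l\<close>, and the full-cycle condition for
    \<open>b2\<close>.\<close>
  define b where "b = (N / real \<delta> ^ l) powr (1 / (r - 1))"
  define b2 where "b2 = N powr (1 / (2 * r - 1)) / real \<delta>"
  define \<beta>g where "\<beta>g = max b b2"
  have b0: "0 < b" unfolding b_def using N \<delta>0 by simp
  have bl: "b ^ (l - 1) = N / real \<delta> ^ l"
  proof -
    have "b ^ (l - 1) = b powr real (l - 1)" using b0 by (simp add: powr_realpow)
    also have "real (l - 1) = r - 1" unfolding r_def using l by simp
    also have "b powr (r - 1) = N / real \<delta> ^ l" unfolding b_def powr_powr using r N \<delta>0 by simp
    finally show ?thesis .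
  qed
  have b2l: "b2 ^ (2 * l - 1) = N / real \<delta> ^ (2 * l - 1)"
  proof -
    have "(N powr (1 / (2 * r - 1))) ^ (2 * l - 1) = (N powr (1 / (2 * r - 1))) powr real (2 * l - 1)"
      using N by (simp add: powr_realpow)
    also have "real (2 * l - 1) = 2 * r - 1" unfolding r_def using l by simp
    also have "(N powr (1 / (2 * r - 1))) powr (2 * r - 1) = N" unfolding powr_powr using r N by simp
    finally show ?thesis unfolding b2_def power_divide by simp
  qed
  have bB: "b \<le> 2304 * d * bf"
  proof -
    have "N / real \<delta> ^ l \<le> N / z ^ l" using z\<delta> z0 N \<delta>0 by (intro divide_left_mono power_mono) auto
    also have "z ^ l = z powr r" unfolding r_def using z0 by (simp add: powr_realpow)
    finally have "b \<le> (N / z powr r) powr (1 / (r - 1))" unfolding b_def using N \<delta>0 r by (intro powr_mono2) auto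
    also have "\<dots> = N powr (1 / (r - 1)) * z powr (- (r / (r - 1)))"
      using N z0 by (simp add: powr_divide powr_powr powr_minus_divide)
    also have "z powr (- (r / (r - 1))) = \<tau> powr (- (r / (r - 1))) * N powr (- (r / (r - 1))) * 48 powr (r / (r - 1)) * d powr (r / (r - 1))"
    proof -
      have ze: "z powr e = \<tau> powr e * N powr e / (48 powr e * d powr e)" for e
        unfolding z_def using \<tau> N d1 by (simp add: powr_divide powr_mult)
      show ?thesis unfolding powr_minus_divide ze by simp
    qed
    also have "N powr (1 / (r - 1)) * \<dots> = 48 powr (r / (r - 1)) * (\<tau> powr (- (r / (r - 1))) * N powr (- 1) * d powr (r / (r - 1)))"
    proof -
      have "1 / (r - 1) + (- (r / (r - 1))) = - 1" using r by (simp add: divide_simps)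
      then have "N powr (- 1) = N powr (1 / (r - 1)) * N powr (- (r / (r - 1)))" by (metis powr_add)
      then show ?thesis by simp
    qed
    also have "d powr (r / (r - 1)) = d * d powr (1 / (r - 1))"
    proof -
      have "r / (r - 1) = 1 + 1 / (r - 1)" using r by (simp add: divide_simps)
      then show ?thesis using d1 by (simp add: powr_add)
    qed
    also have "48 powr (r / (r - 1)) * (\<tau> powr (- (r / (r - 1))) * N powr (- 1) * (d * d powr (1 / (r - 1))))
      = (48 powr (r / (r - 1)) * d) * (\<tau> powr (- (r / (r - 1))) * N powr (- 1) * d powr (1 / (r - 1)))" by simp
    also have "\<dots> \<le> (2304 * d) * (\<tau> powr (- (r / (r - 1))) * N powr (- 1) * D powr (1 / (r - 1)))"
    proof (intro mult_mono)
      \<comment> \<open>\<open>r \<ge> 2\<close> gives \<open>r / (r - 1) \<le> 2\<close>; the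
        constant 2304 is \<open>48 ^ 2\<close>.\<close>
      have "(48::real) powr (r / (r - 1)) \<le> 48 powr 2" using r by (intro powr_mono) (auto simp: divide_le_eq)
      also have "(48::real) powr 2 = 2304" by simp
      finally show "(48::real) powr (r / (r - 1)) \<le> 2304" .
      show "d powr (1 / (r - 1)) \<le> D powr (1 / (r - 1))" using dD d1 r by (intro powr_mono2) auto
    qed (use d1 in auto)
    also have "\<dots> = 2304 * d * bf" unfolding D_def bf_def codeg_threshold_powr_inverse[OF r \<tau> N(1)] ..
    finally show ?thesis .
  qed
  have b2B: "b2 \<le> 48 * d * bs"
  proof -
    have "b2 \<le> N powr (1 / (2 * r - 1)) / z" unfolding b2_def using z\<delta> z0 \<delta>0 by (intro divide_left_mono) auto
    also have "\<dots> = 48 * d * bs" unfolding NBs[symmetric] z_def using \<tau> N d1 by simp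
    finally show ?thesis .
  qed
  define B where "B = max bf bs"
  have B0: "0 < B" unfolding B_def using pos by auto
  have \<beta>B: "\<beta>g \<le> 2304 * d * B"
  proof -
    have "2304 * d * bf \<le> 2304 * d * B" unfolding B_def using d1 by (intro mult_left_mono) auto
    moreover have "48 * d * bs \<le> 2304 * d * B" unfolding B_def using d1 pos by (intro mult_mono) auto
    ultimately have "b \<le> 2304 * d * B" "b2 \<le> 2304 * d * B" using bB b2B by linarith+
    then show ?thesis unfolding \<beta>g_def by simp
  qed
  have M\<beta>: "M * \<beta>g \<le> 1"
  proof -
    have "M * \<beta>g \<le> M * (2304 * d * B)" using \<beta>B M by (intro mult_left_mono) auto
    also have "\<dots> \<le> M * (2304 * D * B)" using dD M B0 by (intro mult_left_mono mult_right_mono) auto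
    also have "\<dots> \<le> 1" unfolding B_def using sm by (auto simp: max_def mult_ac)
    finally show ?thesis .
  qed
  have \<beta>g0: "0 < \<beta>g" unfolding \<beta>g_def using b0 by auto
  have E: "e \<subseteq> V \<and> card e = 2" if "e \<in> shadow H" for e using that H(2) unfolding shadow_def by auto
  have big: "2 * card V * \<delta> \<le> card (shadow H)"
  proof -
    have "real (2 * card V * \<delta>) = 2 * N * real \<delta>" unfolding N_def using V by simp
    also have "\<dots> \<le> 2 * N * y" using \<delta>le N by (intro mult_left_mono) auto
    also have "\<dots> = (\<tau> * N ^ 2 / 6) / (2 * d)" unfolding y_def by (simp add: power2_eq_square)
    also have "\<dots> \<le> real (card (shadow H))" using sh d1 unfolding N_def by (simp add: field_simps)
    finally show ?thesis by linarith
  qed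
  have "\<exists>S. S \<noteq> {} \<and> finite S \<and> (\<forall>C\<in>S. \<exists>u. distinct u \<and> length u = 2 * l \<and> C = cyc_edges u \<and> C \<subseteq> shadow H) \<and>
    (\<forall>J. card J \<in> {1..2 * l} \<longrightarrow> real (cdeg S J) \<le>
      2 * 2 ^ (2 * l) * real (card S) / (real (card V) * \<delta>) * (cap_const l * \<beta>g) ^ (card J - 1))"
  proof (rule balanced_graph_cycles[OF l V(1) E _ big b0])
    show "b ^ (l - 1) = real (card V) / real \<delta> ^ l" using bl V unfolding N_def by simp
    show "b \<le> \<beta>g" unfolding \<beta>g_def by simp
    have "b2 ^ (2 * l - 1) \<le> \<beta>g ^ (2 * l - 1)" unfolding \<beta>g_def using N \<delta>0 by (intro power_mono) (auto simp: b2_def)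
    then show "real (card V) / real \<delta> ^ (2 * l - 1) \<le> \<beta>g ^ (2 * l - 1)" unfolding b2l using V N_def by simp
    show "cap_const l * \<beta>g \<le> 1" using M\<beta> unfolding M_def .
  qed (use \<delta>1 in auto)
  then obtain S where S: "S \<noteq> {}" "finite S" "\<And>C. C \<in> S \<Longrightarrow> \<exists>u. distinct u \<and> length u = 2 * l \<and> C = cyc_edges u \<and> C \<subseteq> shadow H"
    "\<And>J. card J \<in> {1..2 * l} \<Longrightarrow> real (cdeg S J) \<le> 2 * 2 ^ (2 * l) * real (card S) / (N * \<delta>) * (M * \<beta>g) ^ (card J - 1)"
    unfolding N_def M_def using V(2) by auto
  obtain ul where ul: "\<And>C. C \<in> S \<Longrightarrow> distinct (ul C) \<and> length (ul C) = 2 * l \<and> C = cyc_edges (ul C) \<and> C \<subseteq> shadow H"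
    using S(3) by metis
  define U where "U = ul ` S"
  have injul: "inj_on ul S" by (rule inj_on_inverseI[where g=cyc_edges]) (use ul in metis)
  have cS: "0 < real (card S)" using S(1,2) by (simp add: card_gt_0_iff)
  define \<alpha> where "\<alpha> = 2 * 2 ^ (2 * l) / (N * \<delta> * d)"
  define \<beta> where "\<beta> = M * \<beta>g / d"
  have \<alpha>0: "0 < \<alpha>" unfolding \<alpha>_def using N \<delta>0 d1 by simp
  have \<beta>0: "0 < \<beta>" "\<beta> \<le> 1" unfolding \<beta>_def using M \<beta>g0 M\<beta> d1 by (auto simp: divide_le_eq)
  have "\<exists>S\<subseteq>linear_cycle_copies (2 * l) H. S \<noteq> {} \<and> (\<forall>J. card J \<in> {1..2 * l} \<longrightarrow>
    real (cdeg S J) \<le> 16 * real l * 12 ^ (2 * l) * real (card S) * \<alpha> * \<beta> ^ (card J - 1))"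
  proof (rule expansion[OF l H(1), where \<mu>="\<lambda>_. 1 / real (card S)" and U=U and d=d])
    show "\<And>e. e \<in> H \<Longrightarrow> card e = 3" using H(2) by blast
    show "finite U" unfolding U_def using S(2) by simp
    show "\<And>u. u \<in> U \<Longrightarrow> distinct u \<and> length u = 2 * l" unfolding U_def using ul by auto
    show "3 / 4 \<le> (\<Sum>u\<in>U. 1 / real (card S))" using cS card_image[OF injul] unfolding U_def by simp
    show "d \<le> real (card (extenders H f))" if "u \<in> U" "f \<in> cyc_edges u" for u f
      using that ul d(2) unfolding U_def by blast
    fix J :: "'a set set" assume J: "card J \<in> {1..2 * l}"
    have finJ: "finite J" using J by (intro card_ge_0_finite) auto
    show "(\<Sum>u | u \<in> U \<and> J \<subseteq> cyc_edges u. 1 / real (card S)) * (\<Prod>f\<in>J. 1 / real (card (extenders H f))) \<le> \<alpha> * \<beta> ^ (card J - 1)"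
    proof (cases "J \<subseteq> shadow H")
      case False
      then have e: "{u. u \<in> U \<and> J \<subseteq> cyc_edges u} = {}" unfolding U_def using ul by auto
      show ?thesis unfolding e using \<alpha>0 \<beta>0 by simp
    next
      case True
      have "{u. u \<in> U \<and> J \<subseteq> cyc_edges u} = ul ` {C \<in> S. J \<subseteq> C}" unfolding U_def using ul by auto
      then have "card {u. u \<in> U \<and> J \<subseteq> cyc_edges u} = cdeg S J"
        unfolding cdeg_def using card_image[OF inj_on_subset[OF injul, of "{C \<in> S. J \<subseteq> C}"]] by auto
      then have "(\<Sum>u | u \<in> U \<and> J \<subseteq> cyc_edges u. 1 / real (card S)) = real (cdeg S J) / real (card S)" by simp
      also have "\<dots> \<le> (2 * 2 ^ (2 * l) * real (card S) / (N * \<delta>) * (M * \<beta>g) ^ (card J - 1)) / real (card S)"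
        by (rule divide_right_mono[OF S(4)[OF J]]) simp
      also have "\<dots> = 2 * 2 ^ (2 * l) / (N * \<delta>) * (M * \<beta>g) ^ (card J - 1)" using cS by simp
      finally have 1: "(\<Sum>u | u \<in> U \<and> J \<subseteq> cyc_edges u. 1 / real (card S)) \<le> 2 * 2 ^ (2 * l) / (N * \<delta>) * (M * \<beta>g) ^ (card J - 1)" .
      have 2: "(\<Prod>f\<in>J. 1 / real (card (extenders H f))) \<le> (1 / d) ^ card J"
      proof -
        have "(\<Prod>f\<in>J. 1 / real (card (extenders H f))) \<le> (\<Prod>f\<in>J. 1 / d)"
        proof (rule prod_mono)
          fix f assume "f \<in> J"
          then have "d \<le> real (card (extenders H f))" using True d(2) by auto
          then show "0 \<le> 1 / real (card (extenders H f)) \<and> 1 / real (card (extenders H f)) \<le> 1 / d" using d1 by (simp add: frac_le)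
        qed
        then show ?thesis by simp
      qed
      have "(\<Sum>u | u \<in> U \<and> J \<subseteq> cyc_edges u. 1 / real (card S)) * (\<Prod>f\<in>J. 1 / real (card (extenders H f)))
        \<le> (2 * 2 ^ (2 * l) / (N * \<delta>) * (M * \<beta>g) ^ (card J - 1)) * (1 / d) ^ card J"
      proof (rule mult_mono[OF 1 2])
        show "0 \<le> 2 * 2 ^ (2 * l) / (N * \<delta>) * (M * \<beta>g) ^ (card J - 1)" using N M \<beta>g0 by simp
        show "0 \<le> (\<Prod>f\<in>J. 1 / real (card (extenders H f)))" by (intro prod_nonneg) auto
      qed
      also have "\<dots> = \<alpha> * \<beta> ^ (card J - 1)"
      proof -
        have "card J = Suc (card J - 1)" using J by simp
        then have "(1 / d) ^ card J = (1 / d) * (1 / d) ^ (card J - 1)" by (metis power_Suc)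
        then show ?thesis unfolding \<alpha>_def \<beta>_def by (simp add: power_divide)
      qed
      finally show ?thesis .
    qed
  qed (use d \<alpha>0 \<beta>0 in auto)
  then obtain S' where S': "S' \<subseteq> linear_cycle_copies (2 * l) H" "S' \<noteq> {}"
    "\<And>J. card J \<in> {1..2 * l} \<Longrightarrow> real (cdeg S' J) \<le> 16 * real l * 12 ^ (2 * l) * real (card S') * \<alpha> * \<beta> ^ (card J - 1)" by blast
  have "real (cdeg S' J) \<le> 16 * real l * 12 ^ (2 * l) * real (card S') * (96 * 2 ^ (2 * l) / (\<tau> * N ^ 2)) * (2304 * M * B) ^ (card J - 1)"
    if J: "card J \<in> {1..2 * l}" for J
  proof -
    have a: "\<alpha> \<le> 96 * 2 ^ (2 * l) / (\<tau> * N ^ 2)"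
    proof -
      have "\<tau> * N ^ 2 / 48 = N * z * d" unfolding z_def using d1 by (simp add: power2_eq_square)
      also have "\<dots> \<le> N * \<delta> * d" using z\<delta> N d1 by (intro mult_right_mono mult_left_mono) auto
      finally have *: "\<tau> * N ^ 2 / 48 \<le> N * \<delta> * d" .
      have "\<alpha> \<le> 2 * 2 ^ (2 * l) / (\<tau> * N ^ 2 / 48)" unfolding \<alpha>_def
        using * \<tau> N \<delta>0 d1 by (intro divide_left_mono) auto
      then show ?thesis by simp
    qed
    have c: "\<beta> \<le> 2304 * M * B"
    proof -
      have "M * \<beta>g \<le> M * (2304 * d * B)" using \<beta>B M by (intro mult_left_mono) auto
      then show ?thesis unfolding \<beta>_def using d1 by (simp add: divide_le_eq mult_ac)
    qed
    have "\<alpha> * \<beta> ^ (card J - 1) \<le> (96 * 2 ^ (2 * l) / (\<tau> * N ^ 2)) * (2304 * M * B) ^ (card J - 1)"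
      using a c \<alpha>0 \<beta>0 \<tau> by (intro mult_mono power_mono) auto
    then have "(16 * real l * 12 ^ (2 * l) * real (card S')) * (\<alpha> * \<beta> ^ (card J - 1)) \<le>
      (16 * real l * 12 ^ (2 * l) * real (card S')) * ((96 * 2 ^ (2 * l) / (\<tau> * N ^ 2)) * (2304 * M * B) ^ (card J - 1))"
      by (intro mult_left_mono) auto
    then show ?thesis using S'(3)[OF J] by (simp add: mult_ac)
  qed
  then show ?thesis using S'(1,2) unfolding B_def bf_def bs_def M_def N_def r_def by blast
qed

text \<open>The ratio of the fans is a negative power of \<open>d\<close>, so for \<open>d\<close>
  above the threshold it is at most its value there.\<close>

lemma core_case:
  fixes H :: "'a set set" and d \<tau> :: real
  assumes l: "2 \<le> l" and H: "finite H" "\<And>e. e \<in> H \<Longrightarrow> card e = 3" "H \<noteq> {}" and n: "1 \<le> n"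
    and d: "24 * real l ^ 2 \<le> d" "\<And>f. f \<in> shadow H \<Longrightarrow> d \<le> real (card (extenders H f))"
    and \<tau>: "0 < \<tau>" and cH: "\<tau> * real n ^ 2 / 6 \<le> real (card H)"
    and dd: "codeg_threshold (real l) \<tau> (real n) \<le> d"
  shows "\<exists>S\<subseteq>linear_cycle_copies (2 * l) H. S \<noteq> {} \<and> (\<forall>J. card J \<in> {1..2 * l} \<longrightarrow>
    real (cdeg S J) \<le> 16 * real l * 12 ^ (2 * l) * real (card S) *
      (24 * real l * real (2 * l) ^ (2 * l) / (\<tau> * real n ^ 2)) * ratio_sparse (real l) \<tau> (real n) ^ (card J - 1))"
proof -
  interpret codegree_core H d l by unfold_locales (use assms in auto)
  define r where "r = real l"
  have r: "2 \<le> r" unfolding r_def using l by simp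
  have N: "0 < real n" using n by simp
  define \<beta> where "\<beta> = d powr (- ((4 * r - 3) / (2 * r - 1)))"
  have \<beta>0: "0 < \<beta>" unfolding \<beta>_def using d_pos by simp
  have "\<beta> ^ (2 * l - 1) = \<beta> powr real (2 * l - 1)" using \<beta>0 by (simp add: powr_realpow)
  also have "real (2 * l - 1) = 2 * r - 1" unfolding r_def using l by simp
  also have "\<beta> powr (2 * r - 1) = d powr (- (4 * r - 3))" unfolding \<beta>_def powr_powr using r by simp
  also have "4 * r - 3 = real (4 * l - 3)" unfolding r_def using l by simp
  also have "d powr (- real (4 * l - 3)) = (1 / d) ^ (4 * l - 3)"
    using d_pos by (simp add: powr_minus_divide powr_realpow power_divide)
  finally have \<beta>l: "\<beta> ^ (2 * l - 1) = (1 / d) ^ (4 * l - 3)" .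
  have "\<beta> \<le> codeg_threshold r \<tau> (real n) powr (- ((4 * r - 3) / (2 * r - 1)))"
    unfolding \<beta>_def using dd codeg_threshold_pos[OF r \<tau> N] r unfolding r_def[symmetric] by (intro powr_mono2') auto
  also have "\<dots> = ratio_sparse r \<tau> (real n)" by (rule codeg_threshold_powr[OF r \<tau> N])
  finally have \<beta>B: "\<beta> \<le> ratio_sparse r \<tau> (real n)" .
  obtain S where S: "S \<subseteq> linear_cycle_copies (2 * l) H" "S \<noteq> {}" "\<And>J. card J \<in> {1..2 * l} \<Longrightarrow>
    real (cdeg S J) \<le> 16 * real l * 12 ^ (2 * l) * real (card S) * (4 * real l * real (2 * l) ^ (2 * l) / card H) * \<beta> ^ (card J - 1)"
    using fan_cycles[OF \<beta>0 \<beta>l] by blast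
  have "real (cdeg S J) \<le> 16 * real l * 12 ^ (2 * l) * real (card S) *
      (24 * real l * real (2 * l) ^ (2 * l) / (\<tau> * real n ^ 2)) * ratio_sparse r \<tau> (real n) ^ (card J - 1)"
    if J: "card J \<in> {1..2 * l}" for J
  proof -
    have m0: "0 < \<tau> * real n ^ 2 / 6" using \<tau> N by simp
    have "4 * real l * real (2 * l) ^ (2 * l) / card H \<le> 4 * real l * real (2 * l) ^ (2 * l) / (\<tau> * real n ^ 2 / 6)"
      using cH m0 by (intro divide_left_mono mult_pos_pos) auto
    also have "\<dots> = 24 * real l * real (2 * l) ^ (2 * l) / (\<tau> * real n ^ 2)" by simp
    finally have "(4 * real l * real (2 * l) ^ (2 * l) / card H) * \<beta> ^ (card J - 1) \<le>
      (24 * real l * real (2 * l) ^ (2 * l) / (\<tau> * real n ^ 2)) * ratio_sparse r \<tau> (real n) ^ (card J - 1)"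
      using \<beta>B \<beta>0 \<tau> by (intro mult_mono power_mono) auto
    then have "(16 * real l * 12 ^ (2 * l) * real (card S)) * ((4 * real l * real (2 * l) ^ (2 * l) / card H) * \<beta> ^ (card J - 1)) \<le>
      (16 * real l * 12 ^ (2 * l) * real (card S)) * ((24 * real l * real (2 * l) ^ (2 * l) / (\<tau> * real n ^ 2)) * ratio_sparse r \<tau> (real n) ^ (card J - 1))"
      by (intro mult_left_mono) auto
    then show ?thesis using S(3)[OF J] by (simp add: mult_ac)
  qed
  then show ?thesis using S(1,2) unfolding r_def by blast
qed

text \<open>The summands cover the two regimes; the last factor absorbs the constant
  \<open>2304 * cap_const l\<close> attached to the ratio in \<open>shadow_case\<close>, raised to
  at most the power \<open>2 * l\<close>.\<close>

definition codegree_const :: "nat \<Rightarrow> real" where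
  "codegree_const l = 16 * real l * 12 ^ (2 * l) * (24 * real l * real (2 * l) ^ (2 * l) + 96 * 2 ^ (2 * l) * (2304 * cap_const l) ^ (2 * l))"

lemma balanced_cycles:
  fixes t :: real and V :: "'a set"
  assumes l: "2 \<le> l" and G: "three_graph V E" and n: "card V = n" "3 \<le> n"
    and E: "real (card E) = t * real n ^ 2" and t: "24 * real l ^ 2 \<le> t"
    and small: "2304 * cap_const l * (ratio_sparse (real l) (t / ln (real n)) (real n) * codeg_threshold (real l) (t / ln (real n)) (real n)) \<le> 1"
      "2304 * cap_const l * (ratio_dense (real l) (t / ln (real n)) (real n) * codeg_threshold (real l) (t / ln (real n)) (real n)) \<le> 1"
  shows "\<exists>S\<subseteq>linear_cycle_copies (2 * l) E. S \<noteq> {} \<and> (\<forall>J. card J \<in> {1..2 * l} \<longrightarrow>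
    real (cdeg S J) \<le> codegree_const l * real (card S) * ln (real n) / (t * real n ^ 2) *
      max (ratio_sparse (real l) (t / ln (real n)) (real n)) (ratio_dense (real l) (t / ln (real n)) (real n)) ^ (card J - 1))"
proof -
  define \<tau> where "\<tau> = t / ln (real n)"
  have "24 * 1 \<le> 24 * real l ^ 2" using l by (intro mult_left_mono) auto
  then have t1: "1 \<le> t" using t by simp
  have ln0: "0 < ln (real n)" using n by simp
  have \<tau>: "0 < \<tau>" unfolding \<tau>_def using t1 ln0 by simp
  have V: "finite V" "\<And>e. e \<in> E \<Longrightarrow> e \<subseteq> V \<and> card e = 3" using G unfolding three_graph_def by auto
  have finE: "finite E" using V by (meson PowI finite_Pow_iff finite_subset subsetI)
  obtain H d where H: "H \<subseteq> E" "t \<le> d" "H \<noteq> {}" "\<And>f. f \<in> shadow H \<Longrightarrow> d \<le> real (card (extenders H f))"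
    "t * real n ^ 2 / (6 * ln (real n)) \<le> real (card H)"
    "t * real n ^ 2 / (6 * ln (real n)) \<le> 2 * d * real (card (shadow H))"
    using core_pigeonhole[OF G n E t1] by blast
  have m: "t * real n ^ 2 / (6 * ln (real n)) = \<tau> * real n ^ 2 / 6" unfolding \<tau>_def by simp
  have finH: "finite H" using H(1) finE finite_subset by blast
  have H3: "card e = 3 \<and> e \<subseteq> V" if "e \<in> H" for e using that H(1) V(2) by auto
  have dl: "24 * real l ^ 2 \<le> d" using t H(2) by simp
  define B where "B = max (ratio_sparse (real l) \<tau> (real n)) (ratio_dense (real l) \<tau> (real n))"
  have N: "0 < real n" "1 \<le> n" using n by auto
  have r: "2 \<le> real l" using l by simp
  have Bf0: "0 < ratio_sparse (real l) \<tau> (real n)" using ratio_sparse_pos[OF r \<tau> N(1)] .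
  then have B0: "0 < B" unfolding B_def by simp
  define C1 where "C1 = 24 * real l * real (2 * l) ^ (2 * l)"
  define C2 where "C2 = 96 * 2 ^ (2 * l) * (2304 * cap_const l) ^ (2 * l)"
  have M: "1 \<le> 2304 * cap_const l" using cap_const_ge(1)[OF l] by simp
  have C0: "0 \<le> C1" "0 \<le> C2" unfolding C1_def C2_def using M by auto
  have "\<exists>S\<subseteq>linear_cycle_copies (2 * l) H. S \<noteq> {} \<and> (\<forall>J. card J \<in> {1..2 * l} \<longrightarrow>
    real (cdeg S J) \<le> 16 * real l * 12 ^ (2 * l) * real (card S) * ((C1 + C2) / (\<tau> * real n ^ 2)) * B ^ (card J - 1))"
  proof (cases "codeg_threshold (real l) \<tau> (real n) \<le> d")
    case True
    obtain S where S: "S \<subseteq> linear_cycle_copies (2 * l) H" "S \<noteq> {}" "\<And>J. card J \<in> {1..2 * l} \<Longrightarrow>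
      real (cdeg S J) \<le> 16 * real l * 12 ^ (2 * l) * real (card S) * (C1 / (\<tau> * real n ^ 2)) * ratio_sparse (real l) \<tau> (real n) ^ (card J - 1)"
      using core_case[OF l finH _ H(3) N(2) dl H(4) \<tau> _ True] H3 H(5) unfolding m C1_def by blast
    have "16 * real l * 12 ^ (2 * l) * real (card S) * (C1 / (\<tau> * real n ^ 2)) * ratio_sparse (real l) \<tau> (real n) ^ (card J - 1)
      \<le> 16 * real l * 12 ^ (2 * l) * real (card S) * ((C1 + C2) / (\<tau> * real n ^ 2)) * B ^ (card J - 1)" for J :: "'a set set"
      using C0 Bf0 \<tau> by (intro mult_mono power_mono mult_left_mono divide_right_mono) (auto simp: B_def)
    then show ?thesis using S by (meson order_trans)
  next
    case False
    then have dd: "d \<le> codeg_threshold (real l) \<tau> (real n)" by simp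
    obtain S where S: "S \<subseteq> linear_cycle_copies (2 * l) H" "S \<noteq> {}" "\<And>J. card J \<in> {1..2 * l} \<Longrightarrow>
      real (cdeg S J) \<le> 16 * real l * 12 ^ (2 * l) * real (card S) * (96 * 2 ^ (2 * l) / (\<tau> * real n ^ 2)) * (2304 * cap_const l * B) ^ (card J - 1)"
      using shadow_case[OF l finH H3 V(1) n(1) N(2) dl H(4) \<tau> _ dd] small H(6) unfolding m B_def \<tau>_def[symmetric] by blast
    have "16 * real l * 12 ^ (2 * l) * real (card S) * (96 * 2 ^ (2 * l) / (\<tau> * real n ^ 2)) * (2304 * cap_const l * B) ^ (card J - 1)
      \<le> 16 * real l * 12 ^ (2 * l) * real (card S) * ((C1 + C2) / (\<tau> * real n ^ 2)) * B ^ (card J - 1)"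
      if J: "card J \<in> {1..2 * l}" for J :: "'a set set"
    proof -
      have "(2304 * cap_const l) ^ (card J - 1) \<le> (2304 * cap_const l) ^ (2 * l)" using M J by (intro power_increasing) auto
      then have "96 * 2 ^ (2 * l) * (2304 * cap_const l) ^ (card J - 1) \<le> C2" unfolding C2_def by (intro mult_left_mono) auto
      then have "96 * 2 ^ (2 * l) * (2304 * cap_const l) ^ (card J - 1) \<le> C1 + C2" using C0 by simp
      then have "(16 * real l * 12 ^ (2 * l) * real (card S) / (\<tau> * real n ^ 2) * B ^ (card J - 1)) * (96 * 2 ^ (2 * l) * (2304 * cap_const l) ^ (card J - 1))
        \<le> (16 * real l * 12 ^ (2 * l) * real (card S) / (\<tau> * real n ^ 2) * B ^ (card J - 1)) * (C1 + C2)"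
        using \<tau> B0 by (intro mult_left_mono) auto
      then show ?thesis by (simp add: power_mult_distrib mult_ac)
    qed
    then show ?thesis using S by (meson order_trans)
  qed
  then obtain S where S: "S \<subseteq> linear_cycle_copies (2 * l) H" "S \<noteq> {}" "\<And>J. card J \<in> {1..2 * l} \<Longrightarrow>
    real (cdeg S J) \<le> 16 * real l * 12 ^ (2 * l) * real (card S) * ((C1 + C2) / (\<tau> * real n ^ 2)) * B ^ (card J - 1)" by blast
  have "16 * real l * 12 ^ (2 * l) * real (card S) * ((C1 + C2) / (\<tau> * real n ^ 2)) = codegree_const l * real (card S) * ln (real n) / (t * real n ^ 2)"
    unfolding codegree_const_def C1_def[symmetric] C2_def[symmetric] \<tau>_def by (simp add: mult_ac)
  moreover have "linear_cycle_copies (2 * l) H \<subseteq> linear_cycle_copies (2 * l) E"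
    using H(1) unfolding linear_cycle_copies_def by auto
  ultimately show ?thesis using S unfolding B_def \<tau>_def[symmetric] by (metis subset_trans)
qed

text \<open>\<open>Max\<close> is meaningful only on a nonempty set; \<open>j \<le> card E\<close>
  provides a set of \<open>j\<close> edges.\<close>

lemma max_codegree_le:
  fixes x :: real
  assumes "finite E" "j \<le> card E" and "\<And>J. card J = j \<Longrightarrow> real (cdeg S J) \<le> x"
  shows "real (max_codegree E j S) \<le> x"
proof -
  define A where "A = {card {C \<in> S. J \<subseteq> C} | J. J \<subseteq> E \<and> card J = j}"
  have eq: "A = (\<lambda>J. card {C \<in> S. J \<subseteq> C}) ` {J. J \<subseteq> E \<and> card J = j}" unfolding A_def by auto
  have "finite {J. J \<subseteq> E \<and> card J = j}" by (rule finite_subset[of _ "Pow E"]) (use assms(1) in auto)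
  then have fin: "finite A" unfolding eq by (rule finite_imageI)
  obtain J where "J \<subseteq> E" "card J = j" by (rule obtain_subset_with_card_n[OF assms(2)])
  then have "A \<noteq> {}" unfolding eq by auto
  then have "Max A \<in> A" using fin by (rule Max_in[rotated])
  then obtain J where "card J = j" "Max A = cdeg S J" unfolding A_def cdeg_def by auto
  then show ?thesis unfolding max_codegree_def A_def[symmetric] using assms(3) by simp
qed

theorem theorem2p4:
  fixes l :: nat
  assumes "l \<ge> 2"
  shows "\<exists>K>0. \<exists>c>0. \<forall>\<^sub>F n :: nat in sequentially. \<forall>t\<ge>K. \<forall>(V :: 'a set) E.
    three_graph V E \<and> card V = n \<and> real (card E) = t * real n ^ 2 \<longrightarrow>
    (\<exists>S. S \<noteq> {} \<and> S \<subseteq> linear_cycle_copies (2 * l) E \<and>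
      (\<forall>j\<in>{1..2 * l}. real (max_codegree E j S) \<le>
         c * real (card S) * ln (real n) / (t * real n ^ 2) *
         (max ((t / ln (real n)) powr
                 (- (real l * (4 * real l - 3) / (4 * real l ^ 2 - 5 * real l + 2))) *
               real n powr
                 (- ((real l - 1) * (4 * real l - 3) / (4 * real l ^ 2 - 5 * real l + 2))))
              ((t / ln (real n)) powr (- 1) *
               real n powr (- ((2 * real l - 2) / (2 * real l - 1))))) ^ (j - 1)) \<and>
      (t \<ge> real n powr (1 / (2 * (2 * real l - 1))) * ln (real n) \<longrightarrow>
        (\<forall>j\<in>{1..2 * l}. real (max_codegree E j S) \<le>
           c * real (card S) * ln (real n) / (t * real n ^ 2) *
           ((t / ln (real n)) powr (- 1) *
            real n powr (- ((2 * real l - 2) / (2 * real l - 1)))) ^ (j - 1))))"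
proof -
  define r where "r = real l"
  have r: "2 \<le> r" unfolding r_def using assms by simp
  \<comment> \<open>Since the selected codegree satisfies \<open>d \<ge> t\<close>, this makes
    \<open>d\<close> large enough for \<open>valid_ext_mass\<close>.\<close>
  define K where "K = 24 * real l ^ 2"
  have "24 * 1 \<le> K" unfolding K_def using assms by (intro mult_left_mono) auto
  then have K: "0 < K" "1 \<le> K" by auto
  have M: "1 \<le> cap_const l" using cap_const_ge(1)[OF assms] .
  define \<epsilon> where "\<epsilon> = 1 / (2304 * cap_const l)"
  have \<epsilon>: "0 < \<epsilon>" unfolding \<epsilon>_def using M by simp
  have c0: "0 < codegree_const l"
  proof -
    have "0 < 24 * real l * real (2 * l) ^ (2 * l)" using assms by simp
    moreover have "0 \<le> 96 * 2 ^ (2 * l) * (2304 * cap_const l) ^ (2 * l)" using M by simp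
    ultimately show ?thesis unfolding codegree_const_def using assms by (intro mult_pos_pos add_pos_nonneg) auto
  qed
  have D: "0 < exp_denom r" using exp_denom_pos[OF r] .
  have q: "0 < (r - 1) * (4 * r ^ 2 - 6 * r + 3) / (exp_denom r * (2 * r - 1))"
  proof -
    have "0 \<le> r * (4 * r - 6)" using r by simp
    then have "0 < 4 * r ^ 2 - 6 * r + 3" by (simp add: power2_eq_square algebra_simps)
    then show ?thesis using r D by simp
  qed
  have ev1: "\<forall>\<^sub>F n::nat in sequentially. \<forall>\<tau>\<ge>1 / ln (real n). \<tau> powr (- (2 * r * (r - 1) / exp_denom r)) * real n powr (- (2 * (r - 1) ^ 2 / exp_denom r)) \<le> \<epsilon>"
    by (rule eventually_powr_small) (use r D \<epsilon> in auto)
  have ev2: "\<forall>\<^sub>F n::nat in sequentially. \<forall>\<tau>\<ge>1 / ln (real n). \<tau> powr (- (2 * (r - 1) ^ 2 / exp_denom r)) *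
      real n powr (- ((r - 1) * (4 * r ^ 2 - 6 * r + 3) / (exp_denom r * (2 * r - 1)))) \<le> \<epsilon>"
    by (rule eventually_powr_small) (use r D \<epsilon> q in auto)
  have "\<forall>\<^sub>F n :: nat in sequentially. \<forall>t\<ge>K. \<forall>(V :: 'a set) E.
    three_graph V E \<and> card V = n \<and> real (card E) = t * real n ^ 2 \<longrightarrow>
    (\<exists>S. S \<noteq> {} \<and> S \<subseteq> linear_cycle_copies (2 * l) E \<and>
      (\<forall>j\<in>{1..2 * l}. real (max_codegree E j S) \<le> codegree_const l * real (card S) * ln (real n) / (t * real n ^ 2) *
         (max (ratio_sparse r (t / ln (real n)) (real n)) (ratio_dense r (t / ln (real n)) (real n))) ^ (j - 1)) \<and>
      (t \<ge> real n powr (1 / (2 * (2 * r - 1))) * ln (real n) \<longrightarrow>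
        (\<forall>j\<in>{1..2 * l}. real (max_codegree E j S) \<le> codegree_const l * real (card S) * ln (real n) / (t * real n ^ 2) *
           ratio_dense r (t / ln (real n)) (real n) ^ (j - 1))))"
    using ev1 ev2 eventually_ge_at_top[of 3]
  proof eventually_elim
    case (elim n)
    show ?case
    proof (intro allI impI)
      fix t and V :: "'a set" and E
      assume t: "K \<le> t" and G: "three_graph V E \<and> card V = n \<and> real (card E) = t * real n ^ 2"
      define \<tau> where "\<tau> = t / ln (real n)"
      have ln0: "0 < ln (real n)" using elim(3) by simp
      have N: "0 < real n" using elim(3) by simp
      \<comment> \<open>The range of \<open>\<tau>\<close> on which smallness holds uniformly, so
        that the lower bound on \<open>n\<close> does not depend on \<open>t\<close>.\<close>
      have \<tau>1: "1 / ln (real n) \<le> \<tau>" unfolding \<tau>_def using t K ln0 by (intro divide_right_mono) auto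
      have \<tau>: "0 < \<tau>" unfolding \<tau>_def using t K ln0 by simp
      have s1: "2304 * cap_const l * (ratio_sparse r \<tau> (real n) * codeg_threshold r \<tau> (real n)) \<le> 1"
        using elim(1) \<tau>1 M unfolding ratio_sparse_threshold[OF r \<tau> N] \<epsilon>_def by (simp add: field_simps)
      have s2: "2304 * cap_const l * (ratio_dense r \<tau> (real n) * codeg_threshold r \<tau> (real n)) \<le> 1"
        using elim(2) \<tau>1 M unfolding ratio_dense_threshold[OF r \<tau> N] \<epsilon>_def by (simp add: field_simps)
      obtain S where S: "S \<subseteq> linear_cycle_copies (2 * l) E" "S \<noteq> {}" "\<And>J. card J \<in> {1..2 * l} \<Longrightarrow>
        real (cdeg S J) \<le> codegree_const l * real (card S) * ln (real n) / (t * real n ^ 2) * max (ratio_sparse r \<tau> (real n)) (ratio_dense r \<tau> (real n)) ^ (card J - 1)"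
        using balanced_cycles[OF assms _ _ elim(3), of V E t] G t s1 s2 unfolding K_def r_def \<tau>_def by blast
      have finE: "finite E" using G unfolding three_graph_def by (meson PowI finite_Pow_iff finite_subset subsetI)
      have cE: "2 * l \<le> card E"
      proof -
        have "real (2 * l) \<le> K" unfolding K_def using assms by (simp add: power2_eq_square)
        also have "\<dots> \<le> t * real n ^ 2"
        proof -
          have "1 \<le> real n ^ 2" using elim(3) by simp
          then have "t * 1 \<le> t * real n ^ 2" using t K by (intro mult_left_mono) auto
          then show ?thesis using t by simp
        qed
        finally show ?thesis using G by linarith
      qed
      have main: "real (max_codegree E j S) \<le> codegree_const l * real (card S) * ln (real n) / (t * real n ^ 2) *
         max (ratio_sparse r \<tau> (real n)) (ratio_dense r \<tau> (real n)) ^ (j - 1)" if j: "j \<in> {1..2 * l}" for j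
        by (rule max_codegree_le[OF finE]) (use S(3) cE j in auto)
      have "max (ratio_sparse r \<tau> (real n)) (ratio_dense r \<tau> (real n)) = ratio_dense r \<tau> (real n)"
        if "real n powr (1 / (2 * (2 * r - 1))) * ln (real n) \<le> t"
      proof -
        have "real n powr (1 / (2 * (2 * r - 1))) \<le> \<tau>" unfolding \<tau>_def using that ln0 by (simp add: pos_le_divide_eq)
        then show ?thesis using ratio_sparse_le_dense[OF r \<tau> N] by simp
      qed
      then show "\<exists>S. S \<noteq> {} \<and> S \<subseteq> linear_cycle_copies (2 * l) E \<and>
        (\<forall>j\<in>{1..2 * l}. real (max_codegree E j S) \<le> codegree_const l * real (card S) * ln (real n) / (t * real n ^ 2) *
           (max (ratio_sparse r (t / ln (real n)) (real n)) (ratio_dense r (t / ln (real n)) (real n))) ^ (j - 1)) \<and>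
        (t \<ge> real n powr (1 / (2 * (2 * r - 1))) * ln (real n) \<longrightarrow>
          (\<forall>j\<in>{1..2 * l}. real (max_codegree E j S) \<le> codegree_const l * real (card S) * ln (real n) / (t * real n ^ 2) *
             ratio_dense r (t / ln (real n)) (real n) ^ (j - 1)))"
        using S(1,2) main unfolding \<tau>_def by (intro exI[of _ S]) auto
    qed
  qed
  then show ?thesis using K(1) c0 unfolding ratio_sparse_def ratio_dense_def exp_denom_def r_def by blast
qed

end
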